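(* Let $F$ be an algebraically closed field, let $A_0$ be a commutative domain over $F$, and let $A$ be a $\mathbb{Z}_+$-filtered deformation of $A_0$ (i.e., $\operatorname{gr}(A)=A_0$). Suppose that $A$ is a PI algebra of degree $d$. (i) If $\operatorname{char} F=0$, then $d=1$ (i.e., $A$ is commutative). (ii) If $\operatorname{char} F=p>0$, then $d$ is a power of $p$.
   Context: Algebras are associative and unital. A $\mathbb{Z}_+$-filtered deformation of a commutative $F$-algebra $A_0$ is an $F$-algebra $A$ (not necessarily commutative) with an exhaustive increasing algebra filtration $F_0A\subset F_1A\subset\cdots$ by subspaces (with $F_{-1}A=0$, $1\in F_0A$, $F_iA\cdot F_jA\subset F_{i+j}A$, $\bigcup_i F_iA=A$) whose associated graded algebra $\operatorname{gr}(A)=\bigoplus_{i\ge 0}F_iA/F_{i-1}A$ is identified with $A_0$ as an algebra. When $A_0$ is a domain, so is $A$. A PI algebra is an algebra satisfying a nontrivial polynomial identity. A PI domain $A$ has a quotient division algebra, which is finite dimensional over its center; $A$ is PI of degree $d$ if this dimension is $d^2$ (equivalently, $A$ satisfies the polynomial identities of $d\times d$ matrices but not those of matrices of smaller size). A power of $p$ means $p^k$ with $k\ge 0$ an integer. *)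

theory Defs
  imports "HOL-Algebra.Algebra"
begin

section \<open>Characteristic, center, associative algebras\<close>

text \<open>The order of an element of infinite order is \<open>0\<close>, so this is \<open>0\<close> exactly in
  characteristic zero.\<close>

definition ring_char :: "('a, 'b) ring_scheme \<Rightarrow> nat"
  where "ring_char R = group.ord (add_monoid R) \<one>\<^bsub>R\<^esub>"

definition ring_center :: "('a, 'b) ring_scheme \<Rightarrow> 'a set"
  where "ring_center R =
    {z \<in> carrier R. \<forall>x \<in> carrier R. z \<otimes>\<^bsub>R\<^esub> x = x \<otimes>\<^bsub>R\<^esub> z}"

text \<open>The locale \<^locale>\<open>algebra\<close> of the library requires a commutative multiplication; here
  the algebra is only associative and unital.\<close>

locale assoc_algebra = module R M + ring M for R and M (structure) +
  assumes smult_mult_left: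
      "\<lbrakk> c \<in> carrier R; x \<in> carrier M; y \<in> carrier M \<rbrakk> \<Longrightarrow>
        (c \<odot> x) \<otimes> y = c \<odot> (x \<otimes> y)"
    and smult_mult_right:
      "\<lbrakk> c \<in> carrier R; x \<in> carrier M; y \<in> carrier M \<rbrakk> \<Longrightarrow>
        x \<otimes> (c \<odot> y) = c \<odot> (x \<otimes> y)"


section \<open>Filtered algebras and their associated graded algebras\<close>

locale filtered_algebra = assoc_algebra R M for R and M (structure) +
  fixes Fil :: "nat \<Rightarrow> 'c set"
  assumes Fil_submodule: "submodule (Fil i) R M"
    and Fil_Suc: "Fil i \<subseteq> Fil (Suc i)"
    and Fil_one: "\<one> \<in> Fil 0"
    and Fil_mult: "\<lbrakk> x \<in> Fil i; y \<in> Fil j \<rbrakk> \<Longrightarrow> x \<otimes> y \<in> Fil (i + j)"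
    and Fil_exhaustive: "(\<Union>i. Fil i) = carrier M"

text \<open>\<open>Fil_prev A Fil n\<close> is the filtration step of index \<open>n - 1\<close>, with step \<open>-1\<close> equal to zero.\<close>

definition Fil_prev :: "('b, 'm) ring_scheme \<Rightarrow> (nat \<Rightarrow> 'b set) \<Rightarrow> nat \<Rightarrow> 'b set"
  where "Fil_prev A Fil n = (case n of 0 \<Rightarrow> {\<zero>\<^bsub>A\<^esub>} | Suc m \<Rightarrow> Fil m)"

text \<open>The quotient group of step \<open>n\<close> by step \<open>n - 1\<close>. As everywhere with \<open>A_Mod\<close>, the addition of
  cosets is the \<^emph>\<open>multiplication\<close> of this monoid record.\<close>

definition gr_piece :: "('b, 'm) ring_scheme \<Rightarrow> (nat \<Rightarrow> 'b set) \<Rightarrow> nat \<Rightarrow> 'b set monoid"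
  where "gr_piece A Fil n = (A\<lparr>carrier := Fil n\<rparr>) A_Mod (Fil_prev A Fil n)"

text \<open>An element of the direct sum of the pieces is a function \<open>u\<close> with \<open>u n\<close> a coset in the
  \<open>n\<close>-th piece and \<open>u n\<close> the zero coset for almost all \<open>n\<close>. The product of the coset of \<open>x\<close> in
  degree \<open>i\<close> and the coset of \<open>y\<close> in degree \<open>j\<close> is the coset of \<open>x \<otimes> y\<close> in degree \<open>i + j\<close>.\<close>

definition gr_algebra :: "('f, 'b) module \<Rightarrow> (nat \<Rightarrow> 'b set) \<Rightarrow> ('f, nat \<Rightarrow> 'b set) module"
  where "gr_algebra A Fil = \<lparr>
    carrier = {u. (\<forall>n. u n \<in> carrier (gr_piece A Fil n)) \<and>
                  finite {n. u n \<noteq> \<one>\<^bsub>gr_piece A Fil n\<^esub>}},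
    monoid.mult = (\<lambda>u v n. finprod (gr_piece A Fil n)
              (\<lambda>i. rcoset_mult A (Fil_prev A Fil n) (u i) (v (n - i))) {..n}),
    one = (\<lambda>n. if n = 0 then Fil_prev A Fil 0 +>\<^bsub>A\<^esub> \<one>\<^bsub>A\<^esub> else \<one>\<^bsub>gr_piece A Fil n\<^esub>),
    ring.zero = (\<lambda>n. \<one>\<^bsub>gr_piece A Fil n\<^esub>),
    ring.add = (\<lambda>u v n. u n \<otimes>\<^bsub>gr_piece A Fil n\<^esub> v n),
    smult = (\<lambda>c u n. \<Union>x \<in> u n. Fil_prev A Fil n +>\<^bsub>A\<^esub> (c \<odot>\<^bsub>A\<^esub> x)) \<rparr>"

definition algebra_iso ::
    "('f, 'm) ring_scheme \<Rightarrow> ('f, 'a) module \<Rightarrow> ('f, 'b) module \<Rightarrow> ('a \<Rightarrow> 'b) set"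
  where "algebra_iso K A B = {h \<in> ring_iso A B.
    \<forall>c \<in> carrier K. \<forall>x \<in> carrier A. h (c \<odot>\<^bsub>A\<^esub> x) = c \<odot>\<^bsub>B\<^esub> h x}"

definition filtered_deformation ::
    "('f, 'm) ring_scheme \<Rightarrow> ('f, 'a) module \<Rightarrow> ('f, 'b) module \<Rightarrow> (nat \<Rightarrow> 'b set) \<Rightarrow> bool"
  where "filtered_deformation K A0 A Fil \<longleftrightarrow>
    filtered_algebra K A Fil \<and> algebra_iso K (gr_algebra A Fil) A0 \<noteq> {}"


section \<open>Polynomial identities and PI degree\<close>

text \<open>The free algebra on countably many variables: a word \<open>[i, j, \<dots>]\<close> is the monomial
  \<open>X\<^sub>i X\<^sub>j \<dots>\<close>, and a polynomial is a finitely supported coefficient function on words.\<close>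

definition nc_polys :: "('f, 'm) ring_scheme \<Rightarrow> (nat list \<Rightarrow> 'f) set"
  where "nc_polys K = {f. range f \<subseteq> carrier K \<and> finite {w. f w \<noteq> \<zero>\<^bsub>K\<^esub>}}"

definition nc_eval ::
    "('f, 'm) ring_scheme \<Rightarrow> ('f, 'b) module \<Rightarrow> (nat \<Rightarrow> 'b) \<Rightarrow> (nat list \<Rightarrow> 'f) \<Rightarrow> 'b"
  where "nc_eval K A x f =
    (\<Oplus>\<^bsub>A\<^esub>w \<in> {w. f w \<noteq> \<zero>\<^bsub>K\<^esub>}. f w \<odot>\<^bsub>A\<^esub> foldr (\<lambda>i y. x i \<otimes>\<^bsub>A\<^esub> y) w \<one>\<^bsub>A\<^esub>)"

definition PI_algebra :: "('f, 'm) ring_scheme \<Rightarrow> ('f, 'b) module \<Rightarrow> bool"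
  where "PI_algebra K A \<longleftrightarrow> assoc_algebra K A \<and>
    (\<exists>f \<in> nc_polys K. f \<noteq> (\<lambda>w. \<zero>\<^bsub>K\<^esub>) \<and>
      (\<forall>x \<in> UNIV \<rightarrow> carrier A. nc_eval K A x f = \<zero>\<^bsub>A\<^esub>))"

definition division_ring_rec :: "('a, 'm) ring_scheme \<Rightarrow> bool"
  where "division_ring_rec D \<longleftrightarrow> ring D \<and> \<one>\<^bsub>D\<^esub> \<noteq> \<zero>\<^bsub>D\<^esub> \<and> Units D = carrier D - {\<zero>\<^bsub>D\<^esub>}"

text \<open>\<open>D\<close> is the (two-sided Ore) quotient division ring of \<open>A\<close> via the embedding \<open>\<iota>\<close>: every
  element of \<open>D\<close> is a right fraction and a left fraction of elements of \<open>A\<close>.\<close>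

definition quotient_division_ring ::
    "('b, 'm) ring_scheme \<Rightarrow> ('c, 'n) ring_scheme \<Rightarrow> ('b \<Rightarrow> 'c) \<Rightarrow> bool"
  where "quotient_division_ring A D \<iota> \<longleftrightarrow>
    division_ring_rec D \<and> \<iota> \<in> ring_hom A D \<and> inj_on \<iota> (carrier A) \<and>
    (\<forall>x \<in> carrier D.
      (\<exists>a \<in> carrier A. \<exists>s \<in> carrier A - {\<zero>\<^bsub>A\<^esub>}. x = \<iota> a \<otimes>\<^bsub>D\<^esub> inv\<^bsub>D\<^esub> (\<iota> s)) \<and>
      (\<exists>a \<in> carrier A. \<exists>s \<in> carrier A - {\<zero>\<^bsub>A\<^esub>}. x = inv\<^bsub>D\<^esub> (\<iota> s) \<otimes>\<^bsub>D\<^esub> \<iota> a))"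

text \<open>A quotient division ring is unique up to isomorphism over \<open>A\<close>, and one whose elements are
  equivalence classes of pairs of elements of \<open>A\<close> exists as soon as one exists in any type, so
  the choice of carrier type for \<open>D\<close> is no restriction.\<close>

definition PI_degree :: "('f, 'm) ring_scheme \<Rightarrow> ('f, 'b) module \<Rightarrow> nat \<Rightarrow> bool"
  where "PI_degree K A d \<longleftrightarrow> PI_algebra K A \<and>
    (\<exists>(D :: ('b \<times> 'b) set ring) \<iota>. quotient_division_ring A D \<iota> \<and>
      ring.dimension D (d\<^sup>2) (ring_center D) (carrier D))"

end

theory Submission
  imports Defs
begin

text \<open>The filtration gives a degree function on \<open>A\<close>, hence a discrete valuation on the quotient
  division ring \<open>D\<close>, for which commutators have smaller degree than expected because \<open>gr A\<close> is
  commutative. Every \<open>Z\<close>-linear map \<open>D \<rightarrow> D\<close> over the center \<open>Z\<close> has the form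
  \<open>y \<mapsto> \<Sum> b\<^sub>i y c\<^sub>i\<close> and is therefore continuous; so a family that is a basis to leading order is a
  basis, and \<open>[D : Z] = e f\<close> with the ramification index \<open>e\<close> and the residue degree \<open>f\<close>.

  In characteristic zero a nonzero commutator \<open>y\<close> cannot exist: \<open>b \<mapsto> y\<^sup>-\<^sup>1 b y\<close> has trace \<open>0\<close>, but to
  leading order it is the identity, of trace \<open>[D : Z]\<close>. In characteristic \<open>p\<close>, commuting with
  \<open>x\<^bsup>p^k\<^esup>\<close> lowers degrees by at least \<open>2\<^sup>k\<close> more than expected, so comparison with a linear
  projection onto the center shows that every \<open>x\<^bsup>p^k\<^esup>\<close> with \<open>k\<close> large agrees with a central element
  to leading order. Hence \<open>e\<close> divides a power of \<open>p\<close>, the residue extension is purely inseparable,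
  and \<open>[D : Z] = d\<^sup>2\<close> is a power of \<open>p\<close>.\<close>

text \<open>What replaces completeness is that the coordinates of a basis are sums of terms
  \<open>b y c\<close> with fixed \<open>b\<close>, \<open>c\<close> in \<open>D\<close>: such a sum
  raises degrees by at most a constant, so it cannot vanish on a dense subspace without vanishing
  everywhere.

  The same operators fix the constants in both characteristics. In characteristic zero the number
  \<open>[D : Z]\<close> is an invertible scalar of \<open>F\<close>, so its degree is not negative,
  whereas the error in the trace has negative degree. In characteristic \<open>p\<close> the
  projection onto the center is one fixed sum of terms \<open>b y c\<close>; pulling a nearly
  central \<open>x\<close> out of it costs only commutators of \<open>x\<close> with the factors
  \<open>b\<close>, so the error has degree at most \<open>deg x + C - N\<close>, where
  \<open>C\<close> does not depend on \<open>x\<close> and \<open>N\<close> is the gain in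
  commutators. Since \<open>N = 2^k\<close> for a \<open>p^k\<close>-th power, a single
  \<open>k\<close> serves all of \<open>D\<close>, and this one exponent controls both the value
  group and the residue field.\<close>

section \<open>Purely inseparable extensions\<close>

lemma (in cring) binomial:
  assumes a: "a \<in> carrier R" and b: "b \<in> carrier R"
  shows "(a \<oplus> b) [^] n = (\<Oplus>i \<in> {..n}. [(n choose i)] \<cdot> (a [^] i \<otimes> b [^] (n - i)))"
proof (induction n)
  case 0 then show ?case by simp
next
  case (Suc n)
  define f where "f i = [(n choose i)] \<cdot> (a [^] i \<otimes> b [^] (n - i))" for i
  define g where "g i = [(n choose i)] \<cdot> (a [^] i \<otimes> b [^] (Suc n - i))" for i
  have f: "f i \<in> carrier R" and g: "g i \<in> carrier R" for i using a b by (auto simp: f_def g_def)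
  have "(a \<oplus> b) [^] Suc n = (\<Oplus>i \<in> {..n}. f i) \<otimes> (a \<oplus> b)" using Suc by (simp add: f_def)
  also have "\<dots> = (\<Oplus>i \<in> {..n}. f i) \<otimes> a \<oplus> (\<Oplus>i \<in> {..n}. f i) \<otimes> b"
    using a b f by (intro r_distr finsum_closed) auto
  also have "(\<Oplus>i \<in> {..n}. f i) \<otimes> a = (\<Oplus>i \<in> {..n}. f i \<otimes> a)"
    using a f by (intro finsum_ldistr) auto
  also have "(\<Oplus>i \<in> {..n}. f i) \<otimes> b = (\<Oplus>i \<in> {..n}. f i \<otimes> b)"
    using b f by (intro finsum_ldistr) auto
  also have "(\<Oplus>i \<in> {..n}. f i \<otimes> b) = (\<Oplus>i \<in> {..n}. g i)"
  proof (rule finsum_cong')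
    fix i assume "i \<in> {..n}"
    then have "b [^] (n - i) \<otimes> b = b [^] (Suc n - i)" using b by (simp add: Suc_diff_le)
    then show "f i \<otimes> b = g i"
      unfolding f_def g_def using a b by (simp add: add_pow_ldistr m_assoc)
  qed (use g in auto)
  also have "\<dots> = (\<Oplus>i \<in> {..Suc n}. g i)"
  proof -
    have "g (Suc n) = \<zero>" by (simp add: g_def binomial_eq_0)
    moreover have "(\<Oplus>i \<in> {..Suc n}. g i) = g (Suc n) \<oplus> (\<Oplus>i \<in> {..n}. g i)"
      using g by (intro finsum_Suc) auto
    moreover have "(\<Oplus>i \<in> {..n}. g i) \<in> carrier R" using g by (intro finsum_closed) auto
    ultimately show ?thesis by simp
  qed
  also have "\<dots> = (\<Oplus>i \<in> {..n}. g (Suc i)) \<oplus> g 0" using g by (intro finsum_Suc2) auto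
  also have "(\<Oplus>i \<in> {..n}. f i \<otimes> a) \<oplus> \<dots> = ((\<Oplus>i \<in> {..n}. f i \<otimes> a) \<oplus> (\<Oplus>i \<in> {..n}. g (Suc i))) \<oplus> g 0"
    using f g a by (intro a_assoc[symmetric] finsum_closed) auto
  also have "(\<Oplus>i \<in> {..n}. f i \<otimes> a) \<oplus> (\<Oplus>i \<in> {..n}. g (Suc i)) = (\<Oplus>i \<in> {..n}. f i \<otimes> a \<oplus> g (Suc i))"
    using f g a by (intro finsum_addf[symmetric]) auto
  also have "\<dots> = (\<Oplus>i \<in> {..n}. [(Suc n choose Suc i)] \<cdot> (a [^] Suc i \<otimes> b [^] (Suc n - Suc i)))"
  proof (rule finsum_cong')
    fix i assume "i \<in> {..n}"
    have "f i \<otimes> a = [(n choose i)] \<cdot> (a [^] Suc i \<otimes> b [^] (n - i))"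
    proof -
      have "a [^] i \<otimes> b [^] (n - i) \<otimes> a = a [^] Suc i \<otimes> b [^] (n - i)" using a b by (simp add: m_ac)
      then show ?thesis unfolding f_def using a b by (simp add: add_pow_ldistr del: nat_pow_Suc)
    qed
    then show "f i \<otimes> a \<oplus> g (Suc i) = [(Suc n choose Suc i)] \<cdot> (a [^] Suc i \<otimes> b [^] (Suc n - Suc i))"
      unfolding g_def using a b add.nat_pow_mult[of "a [^] Suc i \<otimes> b [^] (n - i)" "n choose i" "n choose Suc i"]
      by simp
  qed (use a b in auto)
  also have "g 0 = [(Suc n choose 0)] \<cdot> (a [^] (0 :: nat) \<otimes> b [^] (Suc n - 0))" by (simp add: g_def)
  also have "(\<Oplus>i \<in> {..n}. [(Suc n choose Suc i)] \<cdot> (a [^] Suc i \<otimes> b [^] (Suc n - Suc i)))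
      \<oplus> [(Suc n choose 0)] \<cdot> (a [^] (0 :: nat) \<otimes> b [^] (Suc n - 0))
    = (\<Oplus>i \<in> {..Suc n}. [(Suc n choose i)] \<cdot> (a [^] i \<otimes> b [^] (Suc n - i)))"
    using a b by (intro finsum_Suc2[symmetric]) auto
  finally show ?case .
qed

lemma (in cring) frobenius_add:
  assumes p: "Factorial_Ring.prime (p :: nat)" "[p] \<cdot> \<one> = \<zero>" and a: "a \<in> carrier R" and b: "b \<in> carrier R"
  shows "(a \<oplus> b) [^] p = a [^] p \<oplus> b [^] p"
proof -
  \<comment> \<open>With \<open>p = r + 2\<close> the summands of index \<open>p\<close> and
    \<open>0\<close> can be split off; the remaining indices run from 1 to \<open>r + 1\<close>,
    where \<open>p\<close> divides the binomial coefficient.\<close>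
  obtain r where "p = 2 + r" using le_Suc_ex[OF prime_ge_2_nat[OF p(1)]] by blast
  then have r: "p = Suc (Suc r)" by simp
  define f where "f i = [(p choose i)] \<cdot> (a [^] i \<otimes> b [^] (p - i))" for i
  have f: "f i \<in> carrier R" for i using a b by (auto simp: f_def)
  have z: "f (Suc i) = \<zero>" if "i \<le> r" for i
  proof -
    have "p dvd (p choose Suc i)" using dvd_choose_prime[of "Suc i" p] p(1) that r by auto
    then obtain k where k: "p choose Suc i = p * k" by blast
    define c where "c = a [^] Suc i \<otimes> b [^] (p - Suc i)"
    have c: "c \<in> carrier R" using a b by (simp add: c_def)
    have "[p] \<cdot> c = [p] \<cdot> \<one> \<otimes> c" using c by (simp add: add_pow_ldistr)
    then have "[p] \<cdot> c = \<zero>" using p(2) c by simp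
    then have "[(p * k)] \<cdot> c = \<zero>" using add.nat_pow_pow[OF c, of k p] by simp
    then show ?thesis unfolding f_def c_def k .
  qed
  have "(a \<oplus> b) [^] p = (\<Oplus>i \<in> {..p}. f i)" unfolding f_def by (rule binomial[OF a b])
  also have "\<dots> = f p \<oplus> (\<Oplus>i \<in> {..Suc r}. f i)" unfolding r using f by (intro finsum_Suc) auto
  also have "(\<Oplus>i \<in> {..Suc r}. f i) = (\<Oplus>i \<in> {..r}. f (Suc i)) \<oplus> f 0" using f by (intro finsum_Suc2) auto
  also have "(\<Oplus>i \<in> {..r}. f (Suc i)) = (\<Oplus>i \<in> {..r}. \<zero>)" using z by (intro finsum_cong') auto
  finally show ?thesis using a b f by (simp add: f_def finsum_zero)
qed

text \<open>Each step cancels one factor \<open>q\<close> from \<open>g\<close> or from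
  \<open>h\<close>, so primality of \<open>q\<close> and cancellation do the work of unique
  factorization.\<close>

lemma (in domain) divisor_of_prime_power:
  assumes q: "q \<in> carrier R" "ring_prime q" and "g \<in> carrier R" "h \<in> carrier R"
    and "g \<otimes> h = q [^] (n :: nat)"
  shows "\<exists>s. \<exists>u \<in> Units R. g = u \<otimes> q [^] (s :: nat)"
  using assms(3-)
proof (induction n arbitrary: g h)
  case 0
  then have "h \<otimes> g = \<one>" "g \<otimes> h = \<one>" using m_comm by auto
  then have "g \<in> Units R" using 0 unfolding Units_def by blast
  moreover have "g = g \<otimes> q [^] (0 :: nat)" using 0 by simp
  ultimately show ?case by blast
next
  case (Suc n)
  have prime: "prime R q" and q0: "q \<noteq> \<zero>" using ring_primeE[OF q] by auto
  have "q divides g \<otimes> h" using Suc.prems q by (intro dividesI[of "q [^] n"]) (auto simp: m_comm)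
  then consider "q divides g" | "q divides h" using primeE[OF prime] Suc.prems q by blast
  then show ?case
  proof cases
    case 1
    then obtain g' where g': "g' \<in> carrier R" "g = q \<otimes> g'" unfolding factor_def by blast
    have "q \<otimes> (g' \<otimes> h) = g \<otimes> h" using Suc.prems(2) q(1) g' by (simp add: m_assoc)
    also have "\<dots> = q \<otimes> q [^] n" using Suc.prems(3) q(1) m_comm[of q "q [^] n"] by simp
    finally have "q \<otimes> (g' \<otimes> h) = q \<otimes> q [^] n" .
    then have "g' \<otimes> h = q [^] n" using m_lcancel[OF q0 q(1)] g' Suc.prems q by simp
    then obtain s u where u: "u \<in> Units R" "g' = u \<otimes> q [^] (s :: nat)"
      using Suc.IH[OF g'(1) Suc.prems(2)] by blast
    have "g = u \<otimes> q [^] (Suc s)" unfolding g'(2) u(2) nat_pow_Suc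
      using q(1) Units_closed[OF u(1)] by (simp add: m_ac)
    then show ?thesis using u by blast
  next
    case 2
    then obtain h' where h': "h' \<in> carrier R" "h = q \<otimes> h'" unfolding factor_def by blast
    have "q \<otimes> (g \<otimes> h') = g \<otimes> h" using Suc.prems(1) q(1) h' by (simp add: m_lcomm)
    also have "\<dots> = q \<otimes> q [^] n" using Suc.prems(3) q(1) m_comm[of q "q [^] n"] by simp
    finally have "q \<otimes> (g \<otimes> h') = q \<otimes> q [^] n" .
    then have "g \<otimes> h' = q [^] n" using m_lcancel[OF q0 q(1)] h' Suc.prems q by simp
    then show ?thesis using Suc.IH[OF Suc.prems(1) h'(1)] by blast
  qed
qed

text \<open>Bezout: if \<open>m a = n b + 1\<close>, then \<open>x\<close> is the quotient of a
  power of \<open>x^m\<close> by a power of \<open>x^n\<close>.\<close>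

lemma (in field) mem_subfield_of_coprime_powers:
  assumes K: "subfield K R" and x: "x \<in> carrier R" and "coprime m n"
    and "x [^] (m :: nat) \<in> K" "x [^] (n :: nat) \<in> K" "m > 0"
  shows "x \<in> K"
proof (cases "x = \<zero>")
  case True then show ?thesis using subringE(2)[OF subfieldE(1)[OF K]] by simp
next
  case False
  note Kr = subringE[OF subfieldE(1)[OF K]]
  have pow: "y [^] (i :: nat) \<in> K" if "y \<in> K" for y i by (induction i) (use that Kr in auto)
  obtain a b where ab: "m * a = n * b + 1"
    using bezout_nat[of m n] assms(3,6) by (auto simp: coprime_iff_gcd_eq_1)
  define y where "y = x [^] (n * b)"
  have "x [^] i \<noteq> \<zero>" for i :: nat by (induction i) (use x False integral_iff in auto)
  then have y: "y \<in> K" "y \<noteq> \<zero>" "y \<in> carrier R"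
    using pow[OF assms(5), of b] x nat_pow_pow[OF x] by (auto simp: y_def)
  have yx: "y \<otimes> x \<in> K"
    using pow[OF assms(4), of a] nat_pow_pow[OF x, of m a] ab unfolding y_def by simp
  have "inv y \<in> K" "inv y \<otimes> y = \<one>" using subfield_m_inv[OF K] y by auto
  moreover have "inv y \<otimes> (y \<otimes> x) = x"
    using calculation Kr(1) x y by (metis m_assoc l_one subsetD)
  ultimately show ?thesis using Kr(6) yx by metis
qed

text \<open>The minimal polynomial divides \<open>(X - x)\<^sup>p\<close>, so it is \<open>(X - x)\<^sup>s\<close>; its constant term puts
  \<open>x\<^sup>s\<close> into the base field.\<close>

lemma (in field) dimension_adjoin_p_root:
  assumes p: "Factorial_Ring.prime (p :: nat)" "[p] \<cdot> \<one> = \<zero>" and K: "subfield K R"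
    and x: "x \<in> carrier R" "x \<notin> K" "x [^] p \<in> K"
  shows "subfield (simple_extension K x) R" "dimension p K (simple_extension K x)"
proof -
  note Kr = subringE[OF subfieldE(1)[OF K]]
  interpret UP: domain "poly_ring R" using univ_poly_is_domain[OF carrier_is_subring] .
  interpret UK: domain "K[X]" using univ_poly_is_domain[OF subfieldE(1)[OF K]] .
  have KX: "carrier (K[X]) \<subseteq> carrier (poly_ring R)"
    using carrier_polynomial_shell[OF subfieldE(1)[OF K]] by auto
  define q where "q = [\<one>, \<ominus> x]"
  have q: "q \<in> carrier (poly_ring R)" unfolding q_def sym[OF univ_poly_carrier] polynomial_def
    using x by auto
  have hom: "(\<lambda>f. eval f y) \<in> ring_hom (poly_ring R) R" if "y \<in> carrier R" for y
    using eval_is_hom[OF carrier_is_subring that] .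
  have hom_pow: "eval (q [^]\<^bsub>poly_ring R\<^esub> i) y = (eval q y) [^] (i :: nat)" if "y \<in> carrier R" for i y
  proof -
    interpret E: ring_hom_ring "poly_ring R" R "\<lambda>f. eval f y"
      using eval_ring_hom[OF carrier_is_subring that] .
    show ?thesis using E.hom_nat_pow[OF q] by simp
  qed
  define Q where "Q = q [^]\<^bsub>poly_ring R\<^esub> p"
  have Qc: "Q \<in> carrier (poly_ring R)" using q by (simp add: Q_def)
  have Q0: "Q \<noteq> []" unfolding Q_def by (rule polynomial_pow_not_zero[OF q]) (simp add: q_def)
  have "x \<noteq> \<zero>" using x Kr(2) by auto
  define y where "y = \<ominus> x"
  have y: "y \<in> carrier R" "y \<noteq> \<zero>" using x \<open>x \<noteq> \<zero>\<close> unfolding y_def by (simp, metis minus_minus minus_zero)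
  have yK: "y [^] p \<in> K"
  proof -
    have "y = \<ominus> \<one> \<otimes> x" using x by (simp add: y_def l_minus)
    then have "y [^] p = (\<ominus> \<one>) [^] p \<otimes> x [^] p" using x by (simp add: nat_pow_distrib)
    moreover have "(\<ominus> \<one>) [^] i \<in> K" for i :: nat
      by (induction i) (use Kr(3,5,6) in auto)
    ultimately show ?thesis using Kr(6) x by simp
  qed
  interpret C: ring_hom_ring R "poly_ring R" poly_of_const
    using canonical_embedding_ring_hom[OF carrier_is_subring] by simp
  have cpow: "[n] \<cdot>\<^bsub>poly_ring R\<^esub> \<one>\<^bsub>poly_ring R\<^esub> = poly_of_const ([n] \<cdot> \<one>)" for n :: nat
    by (induction n) (auto simp: C.hom_zero C.hom_one C.hom_add)
  have X: "X \<in> carrier (poly_ring R)" using var_closed(1)[OF carrier_is_subring] .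
  \<comment> \<open>Written as a power of \<open>X - x\<close>, \<open>Q\<close> has no visible
    reason to lie over \<open>K\<close>; the Frobenius identity rewrites it as
    \<open>X^p + y^p\<close>, and \<open>y^p\<close> lies in \<open>K\<close>.\<close>
  have "q = X \<oplus>\<^bsub>poly_ring R\<^esub> poly_of_const y"
    unfolding q_def var_def univ_poly_add poly_of_const_def using y by (simp add: y_def)
  then have "Q = X [^]\<^bsub>poly_ring R\<^esub> p \<oplus>\<^bsub>poly_ring R\<^esub> (poly_of_const y) [^]\<^bsub>poly_ring R\<^esub> p"
    unfolding Q_def using UP.frobenius_add[OF p(1) _ X] cpow[of p] p(2) y C.hom_zero by simp
  also have "(poly_of_const y) [^]\<^bsub>poly_ring R\<^esub> p = poly_of_const (y [^] p)"
    using C.hom_nat_pow[OF y(1)] by simp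
  also have "X [^]\<^bsub>poly_ring R\<^esub> p = X [^]\<^bsub>K[X]\<^esub> p"
    using unitary_monom_eq_var_pow[OF carrier_is_subring] unitary_monom_eq_var_pow[OF subfieldE(1)[OF K]]
    by metis
  finally have Q: "Q = X [^]\<^bsub>K[X]\<^esub> p \<oplus>\<^bsub>K[X]\<^esub> poly_of_const (y [^] p)"
    by (simp add: univ_poly_add)
  have "poly_of_const (y [^] p) \<in> carrier (K[X])"
    using canonical_embedding_is_hom[OF subfieldE(1)[OF K]] yK unfolding ring_hom_def by auto
  then have QK: "Q \<in> carrier (K[X])"
    unfolding Q using var_pow_closed[OF subfieldE(1)[OF K]] by (intro UK.a_closed)
  have "eval q x = \<zero>" using x by (simp add: q_def r_neg)
  then have Qx: "eval Q x = \<zero>"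
    unfolding Q_def using hom_pow[OF x(1)] prime_gt_0_nat[OF p(1)] by (simp add: nat_pow_zero)
  have alg: "(algebraic over K) x" by (rule algebraicI[OF QK Q0 Qx])
  define f where "f = Irr K x"
  have f: "f \<in> carrier (K[X])" "lead_coeff f = \<one>" "eval f x = \<zero>"
    using IrrE[OF K x(1) alg] by (auto simp: f_def)
  have fR: "f \<in> carrier (poly_ring R)" using f KX by blast
  have "f pdivides Q" unfolding f_def by (rule Irr_minimal[OF K x(1) alg QK Qx])
  then obtain h where h: "h \<in> carrier (poly_ring R)" "Q = f \<otimes>\<^bsub>poly_ring R\<^esub> h"
    unfolding pdivides_def factor_def by blast
  have "pprime (carrier R) q"
    using pprime_iff_pirreducible[OF carrier_is_subfield q]
      degree_one_imp_pirreducible[OF carrier_is_subfield q] by (simp add: q_def)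
  then obtain s u where u: "u \<in> Units (poly_ring R)" "f = u \<otimes>\<^bsub>poly_ring R\<^esub> q [^]\<^bsub>poly_ring R\<^esub> (s :: nat)"
    using UP.divisor_of_prime_power[OF q _ fR h(1), of p] h(2) unfolding Q_def by auto
  obtain k where k: "u = [k]" "k \<in> carrier R" "k \<noteq> \<zero>" using u(1) univ_poly_carrier_units by auto
  have qs: "q [^]\<^bsub>poly_ring R\<^esub> i \<in> carrier (poly_ring R)" "q [^]\<^bsub>poly_ring R\<^esub> i \<noteq> []" for i :: nat
    using q polynomial_pow_not_zero[OF q] by (auto simp: q_def)
  \<comment> \<open>The divisor lemma gives \<open>f\<close> only up to a unit; since
    \<open>f\<close> and the powers of \<open>q\<close> are monic, that unit is 1.\<close>
  have lq: "lead_coeff (q [^]\<^bsub>poly_ring R\<^esub> i) = \<one>" for i :: nat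
  proof (induction i)
    case 0 then show ?case by (simp add: univ_poly_one)
  next
    case (Suc i)
    have "lead_coeff (poly_mult (q [^]\<^bsub>poly_ring R\<^esub> i) q) = lead_coeff (q [^]\<^bsub>poly_ring R\<^esub> i) \<otimes> lead_coeff q"
      using qs q by (intro poly_mult_lead_coeff[OF carrier_is_subring]) (auto simp: univ_poly_carrier q_def)
    then show ?case using Suc by (simp add: univ_poly_mult q_def)
  qed
  have "lead_coeff (poly_mult u (q [^]\<^bsub>poly_ring R\<^esub> s)) = lead_coeff u \<otimes> lead_coeff (q [^]\<^bsub>poly_ring R\<^esub> s)"
    using qs UP.Units_closed[OF u(1)] k by (intro poly_mult_lead_coeff[OF carrier_is_subring]) (auto simp: univ_poly_carrier)
  then have "k = \<one>" using f(2) lq k u(2) by (simp add: univ_poly_mult)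
  then have fq: "f = q [^]\<^bsub>poly_ring R\<^esub> s"
    using u(2) k(1) qs(1) UP.l_one by (simp add: univ_poly_one)
  have deg: "degree f = s" unfolding fq polynomial_pow_degree[OF q] by (simp add: q_def)
  have s0: "s \<noteq> 0"
  proof
    assume "s = 0"
    then have "f = [\<one>]" unfolding fq by (simp add: univ_poly_one)
    then show False using f(3) x by simp
  qed
  have "const_term f \<in> K" using const_term_simprules_shell(1)[OF subfieldE(1)[OF K] f(1)] .
  then have ys: "y [^] s \<in> K" unfolding const_term_def fq hom_pow[OF zero_closed] using x by (simp add: q_def y_def)
  have "degree f \<le> degree Q"
    using pdivides_imp_degree_le[OF subfieldE(1)[OF K] f(1) QK Q0 \<open>f pdivides Q\<close>] .
  also have "degree Q = p" unfolding Q_def polynomial_pow_degree[OF q] by (simp add: q_def)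
  finally have "s \<le> p" using deg by simp
  \<comment> \<open>An exponent \<open>s\<close> strictly between 0 and \<open>p\<close> is coprime
    to \<open>p\<close>, so \<open>y^s\<close> and \<open>y^p\<close> in \<open>K\<close> would put
    \<open>y\<close>, and hence \<open>x\<close>, into \<open>K\<close>.\<close>
  have "s = p"
  proof (rule ccontr)
    assume "s \<noteq> p"
    then have "\<not> p dvd s" using \<open>s \<le> p\<close> s0 by (auto dest: dvd_imp_le)
    then have "coprime s p" using prime_imp_coprime[OF p(1)] coprime_commute by blast
    then have "y \<in> K" using mem_subfield_of_coprime_powers[OF K y(1) _ ys yK] s0 by simp
    then have "x \<in> K" using Kr(5) x unfolding y_def by (metis minus_minus)
    then show False using x by simp
  qed
  then show "dimension p K (simple_extension K x)"
    using dimension_simple_extension[OF K x(1) alg] deg unfolding f_def by simp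
  show "subfield (simple_extension K x) R" using simple_extension_is_subfield[OF K x(1)] alg by simp
qed

text \<open>Induction along a tower: for \<open>y\<close> outside \<open>K\<close>, the last
  iterated \<open>p\<close>-th power of \<open>y\<close> outside \<open>K\<close> generates an
  intermediate field of degree \<open>p\<close>, and dimensions multiply.\<close>

lemma (in field) purely_inseparable_dimension:
  assumes p: "Factorial_Ring.prime (p :: nat)" "[p] \<cdot> \<one> = \<zero>" and "subfield K R" "dimension n K (carrier R)"
    and "\<forall>x \<in> carrier R. x [^] (p ^ e) \<in> K"
  shows "\<exists>j. n = p ^ j"
  using assms(3-)
proof (induction n arbitrary: K rule: less_induct)
  case (less n)
  note K = less.prems(1) and dim = less.prems(2) and pe = less.prems(3)
  show ?case
  proof (cases "K = carrier R")
    case True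
    then have "n = 1" using dimension_is_inj[OF K dim] dimension_one[OF K] by simp
    then show ?thesis by (metis power_0)
  next
    case False
    then obtain y where y: "y \<in> carrier R" "y \<notin> K" using subfieldE(3)[OF K] by blast
    define i where "i = (LEAST i. y [^] (p ^ i) \<in> K)"
    have iK: "y [^] (p ^ i) \<in> K" unfolding i_def using pe y by (intro LeastI) auto
    have "i \<noteq> 0" using iK y by (intro notI) simp
    then obtain i' where i': "i = Suc i'" using not0_implies_Suc by blast
    define x where "x = y [^] (p ^ i')"
    have xK: "x \<notin> K" using not_less_Least[of i' "\<lambda>i. y [^] (p ^ i) \<in> K"] i' unfolding x_def i_def by simp
    have xc: "x \<in> carrier R" using y by (simp add: x_def)
    have xp: "x [^] p \<in> K" using iK y unfolding x_def i' by (simp add: nat_pow_pow mult.commute)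
    define L where "L = simple_extension K x"
    have L: "subfield L R" "dimension p K L"
      using dimension_adjoin_p_root[OF p K xc xK xp] by (auto simp: L_def)
    have KL: "K \<subseteq> L" unfolding L_def by (rule simple_extension_incl[OF subfieldE(3)[OF K] xc])
    obtain Us where Us: "set Us \<subseteq> carrier R" "Span K Us = carrier R" using exists_base[OF K dim] by blast
    \<comment> \<open>A spanning list over \<open>K\<close> still spans over the larger
      \<open>L\<close>; this gives the finite dimension over \<open>L\<close> that the tower formula
      asks for.\<close>
    have "Span K Us \<subseteq> Span L Us"
      using Us(1) KL
    proof (induction Us)
      case (Cons a Us)
      then show ?case by (fastforce simp: line_extension_mem_iff)
    qed simp
    then have "Span L Us = carrier R" using Us(2) Span_in_carrier[OF subfieldE(3)[OF L(1)] Us(1)] by blast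
    then obtain m where m: "dimension m L (carrier R)"
      using Span_finite_dimension[OF L(1) Us(1)] unfolding finite_dimension_def by auto
    have nm: "n = p * m"
      using dimension_is_inj[OF K dim] telescopic_base[OF K L(1,2) m] by simp
    have "m \<noteq> 0"
    proof
      assume "m = 0"
      then have "carrier R = {\<zero>}" using dimension_zero[OF L(1)] m by simp
      then show False using one_closed one_not_zero by auto
    qed
    then have "m < n" using nm prime_gt_1_nat[OF p(1)] by simp
    then obtain j where "m = p ^ j" using less.IH[OF _ L(1) m] pe KL by blast
    then show ?thesis using nm by (metis power_Suc)
  qed
qed

section \<open>Division rings with a discrete valuation\<close>

locale skew_field = ring D for D (structure) +
  assumes one_not_zero: "\<one> \<noteq> \<zero>"
    and Units_eq: "Units D = carrier D - {\<zero>}"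
begin

lemma inv_props:
  assumes "x \<in> carrier D" "x \<noteq> \<zero>"
  shows "inv x \<in> carrier D" "inv x \<noteq> \<zero>" "inv x \<otimes> x = \<one>" "x \<otimes> inv x = \<one>"
proof -
  have u: "x \<in> Units D" using assms Units_eq by blast
  show "inv x \<in> carrier D" "inv x \<otimes> x = \<one>" "x \<otimes> inv x = \<one>" using u by auto
  show "inv x \<noteq> \<zero>" using Units_inv_Units[OF u] Units_eq by blast
qed

lemma mult_nonzero:
  assumes "x \<in> carrier D" "y \<in> carrier D" "x \<noteq> \<zero>" "y \<noteq> \<zero>"
  shows "x \<otimes> y \<noteq> \<zero>"
  using assms Units_eq Units_m_closed by blast

lemma pow_nonzero:
  assumes "x \<in> carrier D" "x \<noteq> \<zero>"
  shows "x [^] (n :: nat) \<noteq> \<zero>"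
  by (induction n) (use assms one_not_zero mult_nonzero in auto)

lemma inv_prod:
  assumes "x \<in> carrier D" "x \<noteq> \<zero>" "y \<in> carrier D" "y \<noteq> \<zero>"
  shows "inv (x \<otimes> y) = inv y \<otimes> inv x"
proof -
  note i = inv_props[OF assms(1,2)] and j = inv_props[OF assms(3,4)]
  have "x \<otimes> y \<otimes> (inv y \<otimes> inv x) = x \<otimes> (y \<otimes> inv y) \<otimes> inv x"
    using assms i(1) j(1) by (simp only: m_assoc m_closed)
  then have 1: "x \<otimes> y \<otimes> (inv y \<otimes> inv x) = \<one>" using assms i j by simp
  have "inv y \<otimes> inv x \<otimes> (x \<otimes> y) = inv y \<otimes> (inv x \<otimes> x) \<otimes> y"
    using assms i(1) j(1) by (simp only: m_assoc m_closed)
  then have 2: "inv y \<otimes> inv x \<otimes> (x \<otimes> y) = \<one>" using assms i j by simp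
  show ?thesis using inv_unique'[OF _ _ 1 2] assms i(1) j(1) by simp
qed

end

text \<open>\<open>deg\<close> is the negative of a valuation, so small elements are those of very
  negative degree. Its value at \<open>\<zero>\<close> is unconstrained, so statements about size go
  through balls, which always contain \<open>\<zero>\<close>.\<close>

locale valued_division_ring = skew_field D for D (structure) +
  fixes deg :: "'a \<Rightarrow> int"
  assumes deg_mult: "\<lbrakk> x \<in> carrier D - {\<zero>}; y \<in> carrier D - {\<zero>} \<rbrakk> \<Longrightarrow>
          deg (x \<otimes> y) = deg x + deg y"
    and deg_add: "\<lbrakk> x \<in> carrier D - {\<zero>}; y \<in> carrier D - {\<zero>}; x \<oplus> y \<noteq> \<zero> \<rbrakk> \<Longrightarrow>
          deg (x \<oplus> y) \<le> max (deg x) (deg y)"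
begin

definition ball :: "int \<Rightarrow> 'a set"
  where "ball n = {x \<in> carrier D. x \<noteq> \<zero> \<longrightarrow> deg x \<le> n}"

abbreviation Z :: "'a set" where "Z \<equiv> ring_center D"

lemma deg_one: "deg \<one> = 0"
  using deg_mult[of \<one> \<one>] one_not_zero by auto

lemma deg_inv:
  assumes "x \<in> carrier D" "x \<noteq> \<zero>"
  shows "deg (inv x) = - deg x"
  using deg_mult[of x "inv x"] inv_props[OF assms] assms deg_one by auto

lemma deg_uminus:
  assumes "x \<in> carrier D"
  shows "deg (\<ominus> x) = deg x"
proof (cases "x = \<zero>")
  case True then show ?thesis by simp
next
  case False
  have m: "\<ominus> \<one> \<noteq> \<zero>" using one_not_zero by (metis minus_minus minus_zero one_closed)
  have "(\<ominus> \<one>) \<otimes> (\<ominus> \<one>) = \<one>" by (simp add: l_minus)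
  then have "deg (\<ominus> \<one>) = 0" using deg_mult[of "\<ominus> \<one>" "\<ominus> \<one>"] m deg_one by auto
  moreover have "\<ominus> x = (\<ominus> \<one>) \<otimes> x" using assms by (simp add: l_minus)
  ultimately show ?thesis using deg_mult[of "\<ominus> \<one>" x] m assms False by auto
qed

lemma deg_pow:
  assumes "x \<in> carrier D" "x \<noteq> \<zero>"
  shows "deg (x [^] (n :: nat)) = int n * deg x"
proof (induction n)
  case 0 then show ?case using deg_one by simp
next
  case (Suc n)
  then show ?case using deg_mult[of "x [^] n" x] pow_nonzero[OF assms] assms
    by (simp add: algebra_simps)
qed

lemma ball_carrier: "x \<in> ball n \<Longrightarrow> x \<in> carrier D"
  by (simp add: ball_def)

lemma zero_ball [simp]: "\<zero> \<in> ball n"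
  by (simp add: ball_def)

lemma ball_deg: "x \<in> carrier D \<Longrightarrow> x \<in> ball (deg x)"
  by (simp add: ball_def)

lemma ball_mono: "x \<in> ball m \<Longrightarrow> m \<le> n \<Longrightarrow> x \<in> ball n"
  by (auto simp: ball_def)

lemma ball_add: "x \<in> ball n \<Longrightarrow> y \<in> ball n \<Longrightarrow> x \<oplus> y \<in> ball n"
  using deg_add[of x y] by (cases "x = \<zero>"; cases "y = \<zero>") (auto simp: ball_def)

lemma ball_uminus: "x \<in> ball n \<Longrightarrow> \<ominus> x \<in> ball n"
  by (auto simp: ball_def deg_uminus)

lemma ball_minus: "x \<in> ball n \<Longrightarrow> y \<in> ball n \<Longrightarrow> x \<ominus> y \<in> ball n"
  unfolding a_minus_def by (intro ball_add ball_uminus)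

lemma ball_mult: "x \<in> ball m \<Longrightarrow> y \<in> ball n \<Longrightarrow> x \<otimes> y \<in> ball (m + n)"
  using deg_mult[of x y] by (cases "x = \<zero>"; cases "y = \<zero>") (auto simp: ball_def)

lemma ball_unit_cancel:
  assumes "x \<otimes> y \<in> ball n" "x \<in> carrier D" "x \<noteq> \<zero>" "y \<in> carrier D"
  shows "y \<in> ball (n - deg x)"
  using assms deg_mult[of x y] mult_nonzero[of x y] by (auto simp: ball_def)

lemma not_ball_deg: "x \<in> carrier D \<Longrightarrow> x \<notin> ball n \<Longrightarrow> x \<noteq> \<zero> \<and> deg x > n"
  by (auto simp: ball_def)

text \<open>An error of lower degree than \<open>x\<close> cannot change the leading term.\<close>

lemma deg_approx:
  assumes "x \<in> carrier D" "x \<noteq> \<zero>" "y \<in> carrier D" "x \<ominus> y \<in> ball (deg x - 1)"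
  shows "y \<noteq> \<zero>" "deg y = deg x"
proof -
  show nz: "y \<noteq> \<zero>" using assms by (auto simp: ball_def a_minus_def)
  have e: "x = (x \<ominus> y) \<oplus> y" "y = x \<ominus> (x \<ominus> y)" using assms by algebra+
  have "deg x \<le> deg y"
  proof (rule ccontr)
    assume "\<not> deg x \<le> deg y"
    then have "y \<in> ball (deg x - 1)" using assms by (auto simp: ball_def)
    then have "(x \<ominus> y) \<oplus> y \<in> ball (deg x - 1)" using ball_add assms(4) by blast
    then have "x \<in> ball (deg x - 1)" using e(1) by simp
    then show False using assms by (auto simp: ball_def)
  qed
  moreover have "x \<ominus> (x \<ominus> y) \<in> ball (deg x)"
    using ball_minus[OF ball_deg[OF assms(1)] ball_mono[OF assms(4)]] by simp
  then have "deg y \<le> deg x" using e(2) nz by (auto simp: ball_def)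
  ultimately show "deg y = deg x" by simp
qed

section \<open>The center as a subfield\<close>

lemma center_carrier: "z \<in> Z \<Longrightarrow> z \<in> carrier D"
  by (simp add: ring_center_def)

lemma center_commute: "z \<in> Z \<Longrightarrow> x \<in> carrier D \<Longrightarrow> z \<otimes> x = x \<otimes> z"
  by (simp add: ring_center_def)

lemma center_inv: 
  assumes "z \<in> Z" "z \<noteq> \<zero>"
  shows "inv z \<in> Z"
proof -
  have c: "z \<in> carrier D" using assms center_carrier by blast
  note i = inv_props[OF c assms(2)]
  have "inv z \<otimes> x = x \<otimes> inv z" if x: "x \<in> carrier D" for x
  proof -
    have "inv z \<otimes> x = inv z \<otimes> (x \<otimes> z) \<otimes> inv z"
      using i c x by (metis m_assoc m_closed r_one)
    also have "\<dots> = inv z \<otimes> (z \<otimes> x) \<otimes> inv z" using center_commute[OF assms(1) x] by simp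
    also have "\<dots> = x \<otimes> inv z" using i c x by (metis m_assoc m_closed l_one)
    finally show ?thesis .
  qed
  then show ?thesis using i by (simp add: ring_center_def)
qed

lemma center_subring: "subring Z D"
proof (rule subringI)
  show "Z \<subseteq> carrier D" by (auto simp: ring_center_def)
  show "\<one> \<in> Z" by (auto simp: ring_center_def)
  show "\<ominus> h \<in> Z" if "h \<in> Z" for h using that by (auto simp: ring_center_def l_minus r_minus)
  show "h1 \<otimes> h2 \<in> Z" if h: "h1 \<in> Z" "h2 \<in> Z" for h1 h2
  proof -
    have c: "h1 \<in> carrier D" "h2 \<in> carrier D" using h center_carrier by auto
    have "h1 \<otimes> h2 \<otimes> x = x \<otimes> (h1 \<otimes> h2)" if x: "x \<in> carrier D" for x
      by (metis c x h center_commute m_assoc)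
    then show ?thesis using c by (simp add: ring_center_def)
  qed
  show "h1 \<oplus> h2 \<in> Z" if "h1 \<in> Z" "h2 \<in> Z" for h1 h2
    using that by (auto simp: ring_center_def l_distr r_distr)
qed

lemma center_subfield: "subfield Z D"
proof -
  have "subcring Z D"
    using subcringI[OF center_subring] center_commute center_carrier by blast
  have "cring (D\<lparr>carrier := Z\<rparr>)" using subcring_iff \<open>subcring Z D\<close> center_carrier by blast
  have "field (D\<lparr>carrier := Z\<rparr>)"
  proof (rule cring.cring_fieldI2[OF \<open>cring (D\<lparr>carrier := Z\<rparr>)\<close>])
    show "\<zero>\<^bsub>D\<lparr>carrier := Z\<rparr>\<^esub> \<noteq> \<one>\<^bsub>D\<lparr>carrier := Z\<rparr>\<^esub>" using one_not_zero by simp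
    fix a assume "a \<in> carrier (D\<lparr>carrier := Z\<rparr>)" "a \<noteq> \<zero>\<^bsub>D\<lparr>carrier := Z\<rparr>\<^esub>"
    then have "inv a \<in> Z" "a \<otimes> inv a = \<one>" using center_inv inv_props center_carrier by auto
    then show "\<exists>b\<in>carrier (D\<lparr>carrier := Z\<rparr>). a \<otimes>\<^bsub>D\<lparr>carrier := Z\<rparr>\<^esub> b = \<one>\<^bsub>D\<lparr>carrier := Z\<rparr>\<^esub>" by auto
  qed
  then show ?thesis using subfield_iff center_carrier by blast
qed

text \<open>The sums of maps \<open>y \<mapsto> b y c\<close>, that is, the image of
  \<open>D\<close> tensored with its opposite ring. The inductive form makes linearity over the
  center, degree bounds and commutation estimates provable by rule induction.\<close>

inductive_set mult_ops :: "('a \<Rightarrow> 'a) set" where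
  ident: "(\<lambda>y. y) \<in> mult_ops"
| lmult: "\<phi> \<in> mult_ops \<Longrightarrow> b \<in> carrier D \<Longrightarrow> (\<lambda>y. b \<otimes> \<phi> y) \<in> mult_ops"
| rmult: "\<phi> \<in> mult_ops \<Longrightarrow> c \<in> carrier D \<Longrightarrow> (\<lambda>y. \<phi> y \<otimes> c) \<in> mult_ops"
| plus: "\<phi> \<in> mult_ops \<Longrightarrow> \<psi> \<in> mult_ops \<Longrightarrow> (\<lambda>y. \<phi> y \<oplus> \<psi> y) \<in> mult_ops"

lemma mult_ops_closed: "\<phi> \<in> mult_ops \<Longrightarrow> x \<in> carrier D \<Longrightarrow> \<phi> x \<in> carrier D"
  by (induction rule: mult_ops.induct) auto

lemma mult_ops_add:
  "\<phi> \<in> mult_ops \<Longrightarrow> x \<in> carrier D \<Longrightarrow> y \<in> carrier D \<Longrightarrow> \<phi> (x \<oplus> y) = \<phi> x \<oplus> \<phi> y"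
proof (induction rule: mult_ops.induct)
  case (plus \<phi> \<psi>)
  then show ?case using mult_ops_closed[of \<phi>] mult_ops_closed[of \<psi>] by (simp add: a_ac)
qed (auto simp: mult_ops_closed l_distr r_distr)

lemma mult_ops_smult:
  "\<phi> \<in> mult_ops \<Longrightarrow> z \<in> Z \<Longrightarrow> x \<in> carrier D \<Longrightarrow> \<phi> (z \<otimes> x) = z \<otimes> \<phi> x"
proof (induction rule: mult_ops.induct)
  case (lmult \<phi> b)
  then show ?case using mult_ops_closed[of \<phi>] center_commute center_carrier
    by (metis m_assoc)
qed (auto simp: mult_ops_closed center_carrier r_distr m_assoc)

lemma mult_ops_zero: "\<phi> \<in> mult_ops \<Longrightarrow> \<phi> \<zero> = \<zero>"
  by (induction rule: mult_ops.induct) auto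

lemma mult_ops_uminus: "\<phi> \<in> mult_ops \<Longrightarrow> x \<in> carrier D \<Longrightarrow> \<phi> (\<ominus> x) = \<ominus> \<phi> x"
  using mult_ops_add[of \<phi> x "\<ominus> x"] mult_ops_zero[of \<phi>] mult_ops_closed
  by (metis a_inv_closed add.inv_equality add.m_comm r_neg)

lemma mult_ops_minus: 
  "\<phi> \<in> mult_ops \<Longrightarrow> x \<in> carrier D \<Longrightarrow> y \<in> carrier D \<Longrightarrow> \<phi> (x \<ominus> y) = \<phi> x \<ominus> \<phi> y"
  by (simp add: a_minus_def mult_ops_add mult_ops_uminus)

text \<open>Subtraction appears in the form that the generators produce; \<open>diff_eq\<close>
  translates it back.\<close>

lemma mult_ops_diff:
  assumes "\<phi> \<in> mult_ops" "\<psi> \<in> mult_ops"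
  shows "(\<lambda>y. \<phi> y \<oplus> (\<ominus> \<one>) \<otimes> \<psi> y) \<in> mult_ops"
  using assms by (intro mult_ops.plus mult_ops.lmult) auto

lemma diff_eq: "a \<in> carrier D \<Longrightarrow> b \<in> carrier D \<Longrightarrow> a \<oplus> (\<ominus> \<one>) \<otimes> b = a \<ominus> b"
  by (simp add: a_minus_def l_minus)

text \<open>Continuity: multiplication by \<open>b\<close> raises degrees by at most
  \<open>deg b\<close>, and a sum by at most the larger of two bounds. The constant depends on the
  operator alone.\<close>

lemma mult_ops_bounded: "\<phi> \<in> mult_ops \<Longrightarrow> \<exists>C. \<forall>n. \<forall>x \<in> ball n. \<phi> x \<in> ball (n + C)"
proof (induction rule: mult_ops.induct)
  case ident
  show ?case by (rule exI[of _ 0]) auto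
next
  case (lmult \<phi> b)
  then obtain C where "\<forall>n. \<forall>x \<in> ball n. \<phi> x \<in> ball (n + C)" by blast
  then have "\<forall>n. \<forall>x \<in> ball n. b \<otimes> \<phi> x \<in> ball (n + (C + deg b))"
    using ball_mult[OF ball_deg[OF lmult.hyps(2)]] by (metis add.commute add.left_commute)
  then show ?case by blast
next
  case (rmult \<phi> c)
  then obtain C where "\<forall>n. \<forall>x \<in> ball n. \<phi> x \<in> ball (n + C)" by blast
  then have "\<forall>n. \<forall>x \<in> ball n. \<phi> x \<otimes> c \<in> ball (n + (C + deg c))"
    using ball_mult[OF _ ball_deg[OF rmult.hyps(2)]] by (metis add.assoc)
  then show ?case by blast
next
  case (plus \<phi> \<psi>)
  then obtain C C' where "\<forall>n. \<forall>x \<in> ball n. \<phi> x \<in> ball (n + C)" "\<forall>n. \<forall>x \<in> ball n. \<psi> x \<in> ball (n + C')"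
    by blast
  then have "\<forall>n. \<forall>x \<in> ball n. \<phi> x \<oplus> \<psi> x \<in> ball (n + max C C')"
    by (metis ball_add ball_mono add_le_cancel_left max.cobounded1 max.cobounded2)
  then show ?case by blast
qed

lemma Span_Cons_iff: "x \<in> Span Z (a # as) \<longleftrightarrow> (\<exists>z \<in> Z. \<exists>y \<in> Span Z as. x = z \<otimes> a \<oplus> y)"
  using line_extension_mem_iff[of x Z a "Span Z as"] by simp

lemma independent_Cons_iff:
  "independent Z (a # as) \<longleftrightarrow> a \<in> carrier D \<and> a \<notin> Span Z as \<and> independent Z as"
  by (metis independent.cases independent.li_Cons list.discI list.inject)

lemma Span_carrier: "set as \<subseteq> carrier D \<Longrightarrow> x \<in> Span Z as \<Longrightarrow> x \<in> carrier D"
  using Span_in_carrier[OF subfieldE(3)[OF center_subfield]] by blast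

lemma mult_ops_Span_zero:
  assumes "\<phi> \<in> mult_ops" "set as \<subseteq> carrier D" "\<forall>b \<in> set as. \<phi> b = \<zero>" "x \<in> Span Z as"
  shows "\<phi> x = \<zero>"
  using assms(2-)
proof (induction as arbitrary: x)
  case Nil then show ?case using mult_ops_zero[OF assms(1)] by simp
next
  case (Cons a as)
  then obtain z y where zy: "z \<in> Z" "y \<in> Span Z as" "x = z \<otimes> a \<oplus> y"
    using Span_Cons_iff by blast
  then have "y \<in> carrier D" using Span_carrier Cons.prems(1) by auto
  then have "\<phi> x = z \<otimes> \<phi> a \<oplus> \<phi> y"
    using zy(1) unfolding zy(3)
    using mult_ops_add[OF assms(1)] mult_ops_smult[OF assms(1)] Cons.prems(1) center_carrier by simp
  then show ?case using Cons zy center_carrier by simp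
qed

text \<open>Artin--Whaples: otherwise \<open>\<phi> b \<mapsto> \<phi> a\<close> would be a well-defined bimodule endomorphism of \<open>D\<close>, that
  is, multiplication by some central \<open>z\<close>, and \<open>a - z b\<close> could not be separated either.\<close>

lemma mult_ops_separate:
  assumes "independent Z (a # as)"
  shows "\<exists>\<phi> \<in> mult_ops. \<phi> a = \<one> \<and> (\<forall>b \<in> set as. \<phi> b = \<zero>)"
  using assms
proof (induction as arbitrary: a)
  case Nil
  then have a: "a \<in> carrier D" "a \<noteq> \<zero>" by (auto simp: independent_Cons_iff)
  then have "inv a \<in> carrier D" "inv a \<otimes> a = \<one>" using inv_props by auto
  then show ?case using mult_ops.lmult[OF mult_ops.ident] by force
next
  case (Cons b bs)
  have a: "a \<in> carrier D" and b: "b \<in> carrier D" and bs: "set bs \<subseteq> carrier D"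
    and nsp: "a \<notin> Span Z (b # bs)" and ind: "independent Z (b # bs)"
    using Cons.prems independent_in_carrier[of Z bs]
    by (simp_all add: independent_Cons_iff del: Span.simps)
  obtain \<phi>0 where \<phi>0: "\<phi>0 \<in> mult_ops" "\<phi>0 b = \<one>" "\<forall>c \<in> set bs. \<phi>0 c = \<zero>"
    using Cons.IH[OF ind] by blast
  show ?case
  proof (rule ccontr)
    assume no: "\<not> ?thesis"
    \<comment> \<open>Otherwise dividing by \<open>\<phi> a\<close> on the left would produce a
      separating operator.\<close>
    have vanish: "\<phi> a = \<zero>" if \<phi>: "\<phi> \<in> mult_ops" "\<forall>c \<in> set bs. \<phi> c = \<zero>" "\<phi> b = \<zero>" for \<phi>
    proof (rule ccontr)
      assume nz: "\<phi> a \<noteq> \<zero>"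
      have c: "\<phi> a \<in> carrier D" using mult_ops_closed \<phi>(1) a by blast
      note i = inv_props[OF c nz]
      have "(\<lambda>y. inv (\<phi> a) \<otimes> \<phi> y) \<in> mult_ops" using \<phi>(1) i(1) by (rule mult_ops.lmult)
      moreover have "\<forall>c \<in> set (b # bs). inv (\<phi> a) \<otimes> \<phi> c = \<zero>" using \<phi> i by simp
      ultimately have "\<exists>\<phi> \<in> mult_ops. \<phi> a = \<one> \<and> (\<forall>b \<in> set (b # bs). \<phi> b = \<zero>)" using i(3)
        by (intro bexI[where x = "\<lambda>y. inv (\<phi> a) \<otimes> \<phi> y"]) auto
      then show False using no by blast
    qed
    define z where "z = \<phi>0 a"
    have zc: "z \<in> carrier D" using mult_ops_closed \<phi>0(1) a z_def by blast
    \<comment> \<open>The operator \<open>y \<mapsto> x \<phi>0(y) - \<phi>0(y) x\<close> kills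
      \<open>bs\<close>, and it kills \<open>b\<close> because \<open>\<phi>0 b = \<one>\<close>; so
      it kills \<open>a\<close> too, which says that \<open>z\<close> commutes with
      \<open>x\<close>.\<close>
    have "z \<otimes> x = x \<otimes> z" if x: "x \<in> carrier D" for x
    proof -
      have m: "(\<lambda>y. x \<otimes> \<phi>0 y \<oplus> (\<ominus> \<one>) \<otimes> (\<phi>0 y \<otimes> x)) \<in> mult_ops"
        by (intro mult_ops_diff mult_ops.lmult mult_ops.rmult \<phi>0(1) x)
      have "x \<otimes> \<phi>0 a \<oplus> (\<ominus> \<one>) \<otimes> (\<phi>0 a \<otimes> x) = \<zero>"
        by (rule vanish[OF m]) (use x \<phi>0(2,3) in \<open>simp_all add: l_minus r_neg\<close>)
      then have "x \<otimes> z \<ominus> z \<otimes> x = \<zero>" using zc x unfolding z_def by (simp add: diff_eq)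
      then show ?thesis using zc x by (metis m_closed r_right_minus_eq)
    qed
    then have z: "z \<in> Z" using zc by (simp add: ring_center_def)
    \<comment> \<open>Subtracting \<open>\<phi> b\<close> times \<open>\<phi>0\<close> from
      \<open>\<phi>\<close> makes it vanish on \<open>b\<close> as well, so \<open>vanish\<close>
      applies.\<close>
    have key: "\<phi> a = \<phi> b \<otimes> z" if \<phi>: "\<phi> \<in> mult_ops" "\<forall>c \<in> set bs. \<phi> c = \<zero>" for \<phi>
    proof -
      have c: "\<phi> a \<in> carrier D" "\<phi> b \<in> carrier D" using mult_ops_closed \<phi>(1) a b by auto
      have m: "(\<lambda>y. \<phi> y \<oplus> (\<ominus> \<one>) \<otimes> (\<phi> b \<otimes> \<phi>0 y)) \<in> mult_ops"
        by (intro mult_ops_diff mult_ops.lmult \<phi>(1) \<phi>0(1) c)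
      have "\<phi> a \<oplus> (\<ominus> \<one>) \<otimes> (\<phi> b \<otimes> \<phi>0 a) = \<zero>"
        by (rule vanish[OF m]) (use c \<phi>(2) \<phi>0(2,3) in \<open>simp_all add: l_minus r_neg\<close>)
      then have "\<phi> a \<ominus> \<phi> b \<otimes> z = \<zero>" using c zc z_def by (simp add: diff_eq)
      then show ?thesis using zc c by (metis m_closed r_right_minus_eq)
    qed
    have zb: "z \<otimes> b \<in> carrier D" using zc b by simp
    have "a \<ominus> z \<otimes> b \<notin> Span Z bs"
    proof
      assume s: "a \<ominus> z \<otimes> b \<in> Span Z bs"
      have "a = z \<otimes> b \<oplus> (a \<ominus> z \<otimes> b)" using a zb by algebra
      then have "a \<in> Span Z (b # bs)" using s z Span_Cons_iff by blast
      then show False using nsp by blast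
    qed
    then have "independent Z ((a \<ominus> z \<otimes> b) # bs)"
      using ind a zb by (simp add: independent_Cons_iff del: Span.simps)
    then obtain \<phi> where \<phi>: "\<phi> \<in> mult_ops" "\<phi> (a \<ominus> z \<otimes> b) = \<one>" "\<forall>c \<in> set bs. \<phi> c = \<zero>"
      using Cons.IH by blast
    have c: "\<phi> b \<in> carrier D" using mult_ops_closed \<phi>(1) b by auto
    have "\<phi> (a \<ominus> z \<otimes> b) = \<phi> b \<otimes> z \<ominus> z \<otimes> \<phi> b"
      using mult_ops_minus[OF \<phi>(1) a zb] mult_ops_smult[OF \<phi>(1) z b] key[OF \<phi>(1,3)] by simp
    also have "\<dots> = \<zero>" using center_commute[OF z c] c zc by (simp add: a_minus_def r_neg)
    finally show False using \<phi>(2) one_not_zero by simp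
  qed
qed

section \<open>Orthogonal families over the center\<close>

declare Span.simps [simp del]

lemma Span_Nil: "Span K [] = {\<zero>}"
  by (simp add: Span.simps)

lemmas Span_closed = Span_subgroup_props[OF center_subfield]
lemmas Span_smult = Span_smult_closed[OF center_subfield]

text \<open>Orthogonality in the nonarchimedean sense: leading terms of a combination never cancel.
  Asking only that the tail \<open>y\<close> stays in the ball is enough, since
  \<open>z \<otimes> a\<close> then lies there as a difference. Quantifying over all balls avoids a
  case distinction for vanishing sums.\<close>

primrec orth :: "'a list \<Rightarrow> bool" where
  "orth [] \<longleftrightarrow> True"
| "orth (a # as) \<longleftrightarrow> a \<in> carrier D \<and> a \<noteq> \<zero> \<and> orth as \<and>
     (\<forall>n. \<forall>z \<in> Z. \<forall>y \<in> Span Z as. z \<otimes> a \<oplus> y \<in> ball n \<longrightarrow> y \<in> ball n)"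

lemma orth_carrier: "orth as \<Longrightarrow> set as \<subseteq> carrier D"
  by (induction as) auto

lemma orth_nonzero: "orth as \<Longrightarrow> \<zero> \<notin> set as"
  by (induction as) auto

text \<open>If \<open>a\<close> were in the span of the tail, the vanishing sum of \<open>a\<close>
  and \<open>\<ominus> a\<close> would lie in every ball, and orthogonality would force
  \<open>a\<close> into a ball below its own degree.\<close>

lemma orth_independent: "orth as \<Longrightarrow> independent Z as"
proof (induction as)
  case Nil then show ?case by simp
next
  case (Cons a as)
  then have a: "a \<in> carrier D" "a \<noteq> \<zero>" and as: "set as \<subseteq> carrier D"
    and o: "\<And>n z y. z \<in> Z \<Longrightarrow> y \<in> Span Z as \<Longrightarrow> z \<otimes> a \<oplus> y \<in> ball n \<Longrightarrow> y \<in> ball n"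
    using orth_carrier by auto
  have "a \<notin> Span Z as"
  proof
    assume "a \<in> Span Z as"
    then have "\<ominus> a \<in> Span Z as" using Span_closed(4)[OF as] by blast
    moreover have "\<one> \<otimes> a \<oplus> \<ominus> a \<in> ball (deg a - 1)" using a by (simp add: r_neg)
    ultimately have "\<ominus> a \<in> ball (deg a - 1)"
      using o[of \<one>] subringE(3)[OF center_subring] by blast
    then have "a \<in> ball (deg a - 1)" using ball_uminus a by (metis minus_minus)
    then show False using a by (auto simp: ball_def)
  qed
  then show ?case using Cons a by (simp add: independent_Cons_iff)
qed

text \<open>The span is dense, and an operator that vanishes on it but not everywhere would be
  continuous.\<close>

lemma approximating_spans:
  assumes ind: "independent Z as"
    and approx: "\<And>x. x \<in> carrier D \<Longrightarrow> x \<noteq> \<zero> \<Longrightarrow> \<exists>y \<in> Span Z as. x \<ominus> y \<in> ball (deg x - 1)"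
  shows "Span Z as = carrier D"
proof (rule ccontr)
  assume "Span Z as \<noteq> carrier D"
  have as: "set as \<subseteq> carrier D" using ind independent_in_carrier by blast
  obtain x where x: "x \<in> carrier D" "x \<notin> Span Z as"
    using \<open>Span Z as \<noteq> carrier D\<close> Span_closed(1)[OF as] by blast
  \<comment> \<open>Each correction lowers the degree of the remainder by at least one. No limit is
    taken; only arbitrarily good approximation is used.\<close>
  have dense: "\<exists>y \<in> Span Z as. x \<ominus> y \<in> ball (deg x - int k)" for k
  proof (induction k)
    case 0
    have "x \<ominus> \<zero> \<in> ball (deg x - int 0)" using x ball_deg by (simp add: a_minus_def)
    then show ?case using Span_closed(2)[OF as] by blast
  next
    case (Suc k)
    then obtain y where y: "y \<in> Span Z as" "x \<ominus> y \<in> ball (deg x - int k)" by blast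
    have yc: "y \<in> carrier D" using y as Span_carrier by blast
    show ?case
    proof (cases "x \<ominus> y = \<zero>")
      case True then show ?thesis using y(1) by force
    next
      case False
      then obtain y' where y': "y' \<in> Span Z as" "(x \<ominus> y) \<ominus> y' \<in> ball (deg (x \<ominus> y) - 1)"
        using approx[of "x \<ominus> y"] x yc by blast
      have y'c: "y' \<in> carrier D" using y' as Span_carrier by blast
      have "deg (x \<ominus> y) \<le> deg x - int k" using y(2) False by (auto simp: ball_def)
      then have "(x \<ominus> y) \<ominus> y' \<in> ball (deg x - int (Suc k))"
        by (intro ball_mono[OF y'(2)]) auto
      moreover have "(x \<ominus> y) \<ominus> y' = x \<ominus> (y \<oplus> y')" using x yc y'c by algebra
      ultimately show ?thesis using Span_closed(3)[OF as y(1) y'(1)] by auto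
    qed
  qed
  have "independent Z (x # as)" using x ind by (simp add: independent_Cons_iff)
  then obtain \<phi> where \<phi>: "\<phi> \<in> mult_ops" "\<phi> x = \<one>" "\<forall>b \<in> set as. \<phi> b = \<zero>"
    using mult_ops_separate by blast
  obtain C where C: "\<And>n x. x \<in> ball n \<Longrightarrow> \<phi> x \<in> ball (n + C)"
    using mult_ops_bounded[OF \<phi>(1)] by blast
  \<comment> \<open>The choice makes the image of the remainder \<open>x - y\<close> have negative
    degree, while \<open>\<phi>\<close> sends that remainder to \<open>\<one>\<close>, of degree
    0.\<close>
  define k where "k = nat (deg x + C + 1)"
  obtain y where y: "y \<in> Span Z as" "x \<ominus> y \<in> ball (deg x - int k)" using dense by blast
  have "\<phi> (x \<ominus> y) = \<one>"
    using mult_ops_minus[OF \<phi>(1) x(1)] Span_carrier[OF as y(1)] \<phi>(2)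
      mult_ops_Span_zero[OF \<phi>(1) as \<phi>(3) y(1)] by (simp add: a_minus_def)
  then have "\<one> \<in> ball (deg x - int k + C)" using C[OF y(2)] by simp
  moreover have "deg x - int k + C < 0" unfolding k_def by linarith
  ultimately show False using one_not_zero deg_one unfolding ball_def by auto
qed

text \<open>\<open>far\<close> says that no element of the span shares the leading term of
  \<open>a\<close>. Dividing a combination by its central coefficient \<open>z\<close> reduces any
  cancellation to this case.\<close>

lemma orth_extend:
  assumes as: "orth as" and a: "a \<in> carrier D" "a \<noteq> \<zero>"
    and far: "\<And>y. y \<in> Span Z as \<Longrightarrow> a \<ominus> y \<notin> ball (deg a - 1)"
  shows "orth (a # as)"
proof -
  have "y \<in> ball n" if zy: "z \<in> Z" "y \<in> Span Z as" "z \<otimes> a \<oplus> y \<in> ball n" for n z y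
  proof -
    have c: "z \<in> carrier D" "y \<in> carrier D"
      using zy(1) center_carrier Span_carrier[OF orth_carrier[OF as] zy(2)] by auto
    have za: "z \<otimes> a \<in> ball n"
    proof (rule ccontr)
      assume "z \<otimes> a \<notin> ball n"
      then have nz: "z \<otimes> a \<noteq> \<zero>" and gt: "deg (z \<otimes> a) > n" using a c not_ball_deg by auto
      have z: "z \<noteq> \<zero>" using nz a by auto
      note i = inv_props[OF c(1) z]
      have "z \<otimes> (a \<oplus> inv z \<otimes> y) = z \<otimes> a \<oplus> y"
        using a c i by (simp add: r_distr m_assoc[symmetric])
      then have "a \<oplus> inv z \<otimes> y \<in> ball (n - deg z)"
        using ball_unit_cancel[of z "a \<oplus> inv z \<otimes> y" n] zy(3) a c z i by simp
      then have "a \<oplus> inv z \<otimes> y \<in> ball (deg a - 1)"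
        using gt deg_mult[of z a] a z c by (auto intro: ball_mono)
      moreover have "a \<oplus> inv z \<otimes> y = a \<ominus> \<ominus> (inv z \<otimes> y)" using a c i by (simp add: a_minus_def)
      moreover have "\<ominus> (inv z \<otimes> y) \<in> Span Z as"
        using Span_closed(4) Span_smult center_inv[OF zy(1) z] zy(2) orth_carrier[OF as] by blast
      ultimately show False using far by auto
    qed
    have "y = (z \<otimes> a \<oplus> y) \<ominus> z \<otimes> a" using a c by algebra
    then show "y \<in> ball n" using ball_minus[OF zy(3) za] by simp
  qed
  then show ?thesis using as a by auto
qed

text \<open>Independence bounds the length of orthogonal families, so a longest one exists; by
  \<open>orth_extend\<close> its span approximates every element and hence is everything.\<close>

lemma orth_basis_exists:
  assumes dim: "dimension n Z (carrier D)"
  shows "\<exists>as. orth as \<and> length as = n \<and> Span Z as = carrier D"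
proof -
  have bound: "length as \<le> n" if "orth as" for as
    using independent_length_le_dimension[OF center_subfield dim orth_independent[OF that]]
      orth_carrier[OF that] by blast
  define N where "N = Max (length ` {as. orth as})"
  have fin: "finite (length ` {as. orth as})"
    by (rule finite_subset[of _ "{..n}"]) (use bound in auto)
  have "[] \<in> {as. orth as}" by simp
  then have "N \<in> length ` {as. orth as}" unfolding N_def using fin by (intro Max_in) blast+
  then obtain as where as: "orth as" "length as = N" by auto
  have maxi: "length bs \<le> N" if "orth bs" for bs
    unfolding N_def using fin that by (intro Max_ge) auto
  have "Span Z as = carrier D"
  proof (rule approximating_spans[OF orth_independent[OF as(1)]])
    fix x assume x: "x \<in> carrier D" "x \<noteq> \<zero>"
    show "\<exists>y\<in>Span Z as. x \<ominus> y \<in> ball (deg x - 1)"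
    proof (rule ccontr)
      assume "\<not> ?thesis"
      then have "orth (x # as)" using orth_extend[OF as(1) x] by blast
      then show False using maxi[of "x # as"] as(2) by simp
    qed
  qed
  moreover from this have "length as = n"
    using dimension_is_inj[OF center_subfield _ dim] dimensionI[OF center_subfield]
      orth_independent[OF as(1)] by blast
  ultimately show ?thesis using as by blast
qed

text \<open>Coordinates of an element are no larger than the element itself. This is what bounds the
  diagonal entries in the trace argument.\<close>

lemma orth_decomp:
  assumes "orth as" "x \<in> Span Z as"
  shows "\<exists>z. (\<forall>b. z b \<in> Z) \<and> x = (\<Oplus>b \<in> set as. z b \<otimes> b) \<and>
    (\<forall>n. x \<in> ball n \<longrightarrow> (\<forall>b \<in> set as. z b \<otimes> b \<in> ball n))"
  using assms
proof (induction as arbitrary: x)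
  case Nil
  then show ?case using subringE(2)[OF center_subring] by (auto simp: Span_Nil)
next
  case (Cons a as)
  then have a: "a \<in> carrier D" and as: "set as \<subseteq> carrier D" and oa: "orth as"
    and o: "\<And>n z y. z \<in> Z \<Longrightarrow> y \<in> Span Z as \<Longrightarrow> z \<otimes> a \<oplus> y \<in> ball n \<Longrightarrow> y \<in> ball n"
    using orth_carrier by auto
  have dist: "a \<notin> set as"
    using independent_distinct[OF center_subfield orth_independent[OF Cons.prems(1)]] by simp
  obtain c y where cy: "c \<in> Z" "y \<in> Span Z as" "x = c \<otimes> a \<oplus> y"
    using Cons.prems(2) Span_Cons_iff by blast
  obtain z where z: "\<forall>b. z b \<in> Z" "y = (\<Oplus>b \<in> set as. z b \<otimes> b)"
    "\<forall>n. y \<in> ball n \<longrightarrow> (\<forall>b \<in> set as. z b \<otimes> b \<in> ball n)"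
    using Cons.IH[OF oa cy(2)] by blast
  have cl: "(\<lambda>b. z b \<otimes> b) \<in> set as \<rightarrow> carrier D" using z(1) as center_carrier by auto
  define z' where "z' = z(a := c)"
  have "(\<Oplus>b \<in> set as. z' b \<otimes> b) = y"
    unfolding z(2) by (rule finsum_cong') (use dist cl in \<open>auto simp: z'_def\<close>)
  moreover have "(\<Oplus>b \<in> set (a # as). z' b \<otimes> b) = z' a \<otimes> a \<oplus> (\<Oplus>b \<in> set as. z' b \<otimes> b)"
  proof -
    have "(\<lambda>b. z' b \<otimes> b) \<in> set as \<rightarrow> carrier D"
      using z(1) cy(1) as center_carrier by (auto simp: z'_def)
    moreover have "z' a \<otimes> a \<in> carrier D" using a cy(1) center_carrier by (simp add: z'_def)
    ultimately show ?thesis using finsum_insert[OF _ dist] by simp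
  qed
  ultimately have x: "x = (\<Oplus>b \<in> set (a # as). z' b \<otimes> b)" using cy(3) by (simp add: z'_def)
  have "z' b \<otimes> b \<in> ball n" if xn: "x \<in> ball n" and b: "b \<in> set (a # as)" for n b
  proof -
    have yn: "y \<in> ball n" using o cy xn by blast
    have "c \<otimes> a = x \<ominus> y" unfolding cy(3)
      using a center_carrier[OF cy(1)] Span_carrier[OF as cy(2)] by algebra
    then have "c \<otimes> a \<in> ball n" using ball_minus[OF xn yn] by simp
    then show ?thesis using z(3) yn b unfolding z'_def by auto
  qed
  moreover have "\<forall>b. z' b \<in> Z" using z(1) cy(1) by (simp add: z'_def)
  ultimately show ?case using x by blast
qed

lemma mult_ops_finsum:
  assumes "\<phi> \<in> mult_ops" "finite B" "f \<in> B \<rightarrow> carrier D"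
  shows "\<phi> (\<Oplus>b \<in> B. f b) = (\<Oplus>b \<in> B. \<phi> (f b))"
  using assms(2,3)
proof (induction B rule: finite_induct)
  case empty then show ?case using mult_ops_zero[OF assms(1)] by simp
next
  case (insert b B)
  then have "\<phi> (\<Oplus>b \<in> insert b B. f b) = \<phi> (f b \<oplus> (\<Oplus>b \<in> B. f b))" by (subst finsum_insert) auto
  also have "\<dots> = \<phi> (f b) \<oplus> \<phi> (\<Oplus>b \<in> B. f b)"
    using insert.prems by (intro mult_ops_add[OF assms(1)]) auto
  also have "\<dots> = (\<Oplus>b \<in> insert b B. \<phi> (f b))"
    using insert mult_ops_closed[OF assms(1)] by (subst finsum_insert) auto
  finally show ?case .
qed

lemma finsum_swap:
  assumes "finite B" "finite C" "\<And>b c. b \<in> B \<Longrightarrow> c \<in> C \<Longrightarrow> f b c \<in> carrier D"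
  shows "(\<Oplus>b \<in> B. \<Oplus>c \<in> C. f b c) = (\<Oplus>c \<in> C. \<Oplus>b \<in> B. f b c)"
  using assms(1,3)
proof (induction B rule: finite_induct)
  case empty then show ?case by (simp add: finsum_zero)
next
  case (insert x B)
  have "(\<Oplus>b \<in> insert x B. \<Oplus>c \<in> C. f b c) = (\<Oplus>c \<in> C. f x c) \<oplus> (\<Oplus>b \<in> B. \<Oplus>c \<in> C. f b c)"
    using insert by (intro finsum_insert) (auto intro!: finsum_closed)
  also have "\<dots> = (\<Oplus>c \<in> C. f x c) \<oplus> (\<Oplus>c \<in> C. \<Oplus>b \<in> B. f b c)" using insert by simp
  also have "\<dots> = (\<Oplus>c \<in> C. f x c \<oplus> (\<Oplus>b \<in> B. f b c))"
    using insert by (intro finsum_addf[symmetric]) (auto intro!: finsum_closed)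
  also have "\<dots> = (\<Oplus>c \<in> C. \<Oplus>b \<in> insert x B. f b c)"
  proof (rule finsum_cong')
    show "f x c \<oplus> (\<Oplus>b\<in>B. f b c) = (\<Oplus>b\<in>insert x B. f b c)" if "c \<in> C" for c
      using insert that by (intro finsum_insert[symmetric]) auto
  qed (use insert in \<open>auto intro!: finsum_closed\<close>)
  finally show ?case .
qed

lemma finsum_ball:
  assumes "finite B" "\<And>b. b \<in> B \<Longrightarrow> f b \<in> ball n"
  shows "(\<Oplus>b \<in> B. f b) \<in> ball n"
  using assms
proof (induction B rule: finite_induct)
  case (insert b B)
  then have "(\<Oplus>b \<in> insert b B. f b) = f b \<oplus> (\<Oplus>b \<in> B. f b)"
    using ball_carrier by (intro finsum_insert) auto
  then show ?case using insert ball_add by auto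
qed simp

end

section \<open>Valuations for which commutators drop in degree\<close>

locale almost_commutative_division_ring = valued_division_ring +
  assumes deg_commutator: "\<lbrakk> x \<in> carrier D - {\<zero>}; y \<in> carrier D - {\<zero>};
          x \<otimes> y \<ominus> y \<otimes> x \<noteq> \<zero> \<rbrakk> \<Longrightarrow> deg (x \<otimes> y \<ominus> y \<otimes> x) < deg x + deg y"
begin

lemma ball_commutator:
  assumes "x \<in> ball m" "y \<in> ball n"
  shows "x \<otimes> y \<ominus> y \<otimes> x \<in> ball (m + n - 1)"
proof -
  have c: "x \<in> carrier D" "y \<in> carrier D" using assms by (auto simp: ball_carrier)
  show ?thesis
  proof (cases "x = \<zero> \<or> y = \<zero> \<or> x \<otimes> y \<ominus> y \<otimes> x = \<zero>")
    case True
    then have "x \<otimes> y \<ominus> y \<otimes> x = \<zero>" using c by (auto simp: a_minus_def)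
    then show ?thesis by simp
  next
    case False
    then show ?thesis using deg_commutator[of x y] c assms by (auto simp: ball_def)
  qed
qed

text \<open>If \<open>y = u w - w u \<noteq> 0\<close>, then \<open>b \<mapsto> y\<^sup>-\<^sup>1 b y\<close> is a commutator of operators, so its trace over
  the center vanishes; but it differs from the identity by an operator that lowers degrees, so
  its trace is also \<open>n\<close> up to terms of negative degree.\<close>

lemma commutative_of_dimension_unit:
  assumes dim: "dimension n Z (carrier D)"
    and n: "[n] \<cdot> \<one> \<notin> ball (-1)"
    and u: "u \<in> carrier D" and w: "w \<in> carrier D"
  shows "u \<otimes> w = w \<otimes> u"
proof (rule ccontr)
  assume ne: "u \<otimes> w \<noteq> w \<otimes> u"
  define y where "y = u \<otimes> w \<ominus> w \<otimes> u"
  have y: "y \<in> carrier D" "y \<noteq> \<zero>" using u w ne unfolding y_def by auto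
  define y' where "y' = inv y"
  have y': "y' \<in> carrier D" "y' \<otimes> y = \<one>" using inv_props[OF y] by (auto simp: y'_def)
  obtain as where as: "orth as" "length as = n" "Span Z as = carrier D"
    using orth_basis_exists[OF dim] by blast
  define B where "B = set as"
  have B: "finite B" "B \<subseteq> carrier D" "card B = n" "\<And>b. b \<in> B \<Longrightarrow> b \<noteq> \<zero>"
  proof -
    have "distinct as" using independent_distinct[OF center_subfield orth_independent[OF as(1)]] .
    then show "card B = n" using distinct_card as(2) unfolding B_def by metis
  qed (use orth_carrier[OF as(1)] orth_nonzero[OF as(1)] in \<open>auto simp: B_def\<close>)
  have Bc: "b \<in> carrier D" if "b \<in> B" for b using that B(2) by blast
  obtain z where z: "\<And>x b. x \<in> carrier D \<Longrightarrow> z x b \<in> Z"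
    "\<And>x. x \<in> carrier D \<Longrightarrow> x = (\<Oplus>b \<in> B. z x b \<otimes> b)"
    "\<And>x n b. x \<in> carrier D \<Longrightarrow> x \<in> ball n \<Longrightarrow> b \<in> B \<Longrightarrow> z x b \<otimes> b \<in> ball n"
  proof -
    have "\<forall>x \<in> carrier D. \<exists>z. (\<forall>b. z b \<in> Z) \<and> x = (\<Oplus>b \<in> B. z b \<otimes> b) \<and>
        (\<forall>n. x \<in> ball n \<longrightarrow> (\<forall>b \<in> B. z b \<otimes> b \<in> ball n))"
      using orth_decomp[OF as(1)] unfolding as(3) B_def by blast
    from bchoice[OF this] show ?thesis using that by blast
  qed
  \<comment> \<open>Moving \<open>b\<close> to the front of the basis lets the separation lemma
    realize its coordinate functional as a multiplication operator.\<close>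
  have "\<exists>\<phi> \<in> mult_ops. \<phi> b = \<one> \<and> (\<forall>c \<in> B - {b}. \<phi> c = \<zero>)" if b: "b \<in> B" for b
  proof -
    obtain xs ys where e: "as = xs @ b # ys" using b unfolding B_def by (meson split_list)
    have "independent Z (b # xs @ ys)"
      by (rule independent_same_set[OF center_subfield _ _ orth_independent[OF as(1)]]) (auto simp: e)
    from mult_ops_separate[OF this] show ?thesis by (auto simp: B_def e)
  qed
  then obtain l where l: "\<And>b. b \<in> B \<Longrightarrow> l b \<in> mult_ops" "\<And>b. b \<in> B \<Longrightarrow> l b b = \<one>"
    "\<And>b c. b \<in> B \<Longrightarrow> c \<in> B \<Longrightarrow> c \<noteq> b \<Longrightarrow> l b c = \<zero>" by (metis Diff_iff singletonD)
  have zc: "z x b \<in> carrier D" if "x \<in> carrier D" for x b using z(1) that center_carrier by blast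
  have expand: "\<phi> x = (\<Oplus>b \<in> B. z x b \<otimes> \<phi> b)" if \<phi>: "\<phi> \<in> mult_ops" and x: "x \<in> carrier D" for \<phi> x
  proof -
    have "\<phi> x = \<phi> (\<Oplus>b \<in> B. z x b \<otimes> b)" using z(2)[OF x] by simp
    also have "\<dots> = (\<Oplus>b \<in> B. \<phi> (z x b \<otimes> b))"
      using zc[OF x] B by (intro mult_ops_finsum[OF \<phi>]) auto
    also have "\<dots> = (\<Oplus>b \<in> B. z x b \<otimes> \<phi> b)"
      using B mult_ops_smult[OF \<phi>] z(1)[OF x] zc[OF x] mult_ops_closed[OF \<phi>]
      by (intro finsum_cong') auto
    finally show ?thesis .
  qed
  have lz: "l b x = z x b" if b: "b \<in> B" and x: "x \<in> carrier D" for b x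
  proof -
    have "l b x = (\<Oplus>c \<in> B. z x c \<otimes> l b c)" by (rule expand[OF l(1)[OF b] x])
    also have "\<dots> = (\<Oplus>c \<in> B. if b = c then z x c else \<zero>)"
      using l(2,3) b zc[OF x] by (intro finsum_cong') auto
    also have "\<dots> = z x b" using b B zc[OF x] by (intro finsum_singleton) auto
    finally show ?thesis .
  qed
  \<comment> \<open>Each \<open>l b\<close> reads off the coordinate at \<open>b\<close>, so this is
    the sum of the diagonal entries of the matrix of \<open>\<phi>\<close>.\<close>
  define tr where "tr \<phi> = (\<Oplus>b \<in> B. l b (\<phi> b))" for \<phi>
  have tr_comp: "tr (\<lambda>b. \<phi> (\<psi> b)) = (\<Oplus>b \<in> B. \<Oplus>c \<in> B. z (\<psi> b) c \<otimes> z (\<phi> c) b)"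
    if \<phi>: "\<phi> \<in> mult_ops" and \<psi>: "\<psi> \<in> mult_ops" for \<phi> \<psi>
    unfolding tr_def
  proof (rule finsum_cong')
    fix b assume b: "b \<in> B"
    have bc: "b \<in> carrier D" using b B by blast
    have "l b (\<phi> (\<psi> b)) = l b (\<Oplus>c \<in> B. z (\<psi> b) c \<otimes> \<phi> c)"
      using expand[OF \<phi>] mult_ops_closed[OF \<psi> bc] by simp
    also have "\<dots> = (\<Oplus>c \<in> B. l b (z (\<psi> b) c \<otimes> \<phi> c))"
      using B zc mult_ops_closed[OF \<psi> bc] mult_ops_closed[OF \<phi>]
      by (intro mult_ops_finsum[OF l(1)[OF b]]) auto
    also have "\<dots> = (\<Oplus>c \<in> B. z (\<psi> b) c \<otimes> z (\<phi> c) b)"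
    proof (rule finsum_cong')
      fix c assume "c \<in> B"
      then have "\<phi> c \<in> carrier D" using B mult_ops_closed[OF \<phi>] by blast
      then show "l b (z (\<psi> b) c \<otimes> \<phi> c) = z (\<psi> b) c \<otimes> z (\<phi> c) b"
        using mult_ops_smult[OF l(1)[OF b]] z(1) mult_ops_closed[OF \<psi> bc] lz[OF b] by simp
    qed (use Bc zc mult_ops_closed[OF \<psi> bc] mult_ops_closed[OF \<phi>] in auto)
    finally show "l b (\<phi> (\<psi> b)) = (\<Oplus>c \<in> B. z (\<psi> b) c \<otimes> z (\<phi> c) b)" .
  qed (use Bc zc mult_ops_closed[OF \<phi>] mult_ops_closed[OF \<psi>] in \<open>auto intro!: finsum_closed\<close>)
  \<comment> \<open>The matrix entries are central, so the factors in the double sum may be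
    exchanged although \<open>D\<close> is not commutative.\<close>
  have tr_sym: "tr (\<lambda>b. \<phi> (\<psi> b)) = tr (\<lambda>b. \<psi> (\<phi> b))"
    if \<phi>: "\<phi> \<in> mult_ops" and \<psi>: "\<psi> \<in> mult_ops" for \<phi> \<psi>
  proof -
    have c: "z (\<psi> b) c \<in> carrier D" "z (\<phi> b) c \<in> carrier D" if "b \<in> B" for b c
      using zc mult_ops_closed[OF \<phi>] mult_ops_closed[OF \<psi>] B that by auto
    have "tr (\<lambda>b. \<phi> (\<psi> b)) = (\<Oplus>c \<in> B. \<Oplus>b \<in> B. z (\<psi> b) c \<otimes> z (\<phi> c) b)"
      unfolding tr_comp[OF that] using c B(1) by (intro finsum_swap) auto
    also have "\<dots> = (\<Oplus>c \<in> B. \<Oplus>b \<in> B. z (\<phi> c) b \<otimes> z (\<psi> b) c)"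
      using c center_commute z(1) mult_ops_closed[OF \<psi>] B
      by (intro finsum_cong' finsum_closed) (auto intro!: finsum_closed)
    also have "\<dots> = tr (\<lambda>b. \<psi> (\<phi> b))" unfolding tr_comp[OF \<psi> \<phi>] ..
    finally show ?thesis .
  qed
  \<comment> \<open>Chosen so that \<open>P Q - Q P\<close> sends \<open>b\<close> to
    \<open>y' b (u w - w u) = y' b y\<close>, which is \<open>b\<close> plus \<open>y'\<close> times
    the commutator of \<open>b\<close> and \<open>y\<close>.\<close>
  define P where "P = (\<lambda>b. b \<otimes> w)"
  define Q where "Q = (\<lambda>b. y' \<otimes> (b \<otimes> u))"
  have P: "P \<in> mult_ops" unfolding P_def by (intro mult_ops.rmult mult_ops.ident w)
  have Q: "Q \<in> mult_ops" unfolding Q_def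
    by (intro mult_ops.lmult mult_ops.rmult[OF mult_ops.ident] u y')
  have lc: "l b x \<in> carrier D" if "b \<in> B" "x \<in> carrier D" for b x
    using mult_ops_closed l(1) that by blast
  have Pc: "P x \<in> carrier D" "Q x \<in> carrier D" if "x \<in> carrier D" for x
    using P Q mult_ops_closed that by auto
  have T: "P (Q b) \<ominus> Q (P b) = b \<oplus> y' \<otimes> (b \<otimes> y \<ominus> y \<otimes> b)" if b: "b \<in> B" for b
  proof -
    have bc: "b \<in> carrier D" using b B by blast
    have "P (Q b) \<ominus> Q (P b) = y' \<otimes> (b \<otimes> y)"
      unfolding P_def Q_def y_def a_minus_def using bc u w y'(1)
      by (simp add: m_assoc r_distr r_minus)
    also have "b \<otimes> y = y \<otimes> b \<oplus> (b \<otimes> y \<ominus> y \<otimes> b)" using bc y by algebra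
    also have "y' \<otimes> \<dots> = (y' \<otimes> y) \<otimes> b \<oplus> y' \<otimes> (b \<otimes> y \<ominus> y \<otimes> b)"
      using bc y y'(1) by (simp add: r_distr m_assoc)
    finally show ?thesis using y' bc by simp
  qed
  define N where "N b = l b (y' \<otimes> (b \<otimes> y \<ominus> y \<otimes> b))" for b
  have lN: "l b (P (Q b)) = l b (Q (P b)) \<oplus> (\<one> \<oplus> N b)" if b: "b \<in> B" for b
  proof -
    have bc: "b \<in> carrier D" using b B by blast
    have "P (Q b) = Q (P b) \<oplus> (P (Q b) \<ominus> Q (P b))" using Pc bc by algebra
    also have "\<dots> = Q (P b) \<oplus> (b \<oplus> y' \<otimes> (b \<otimes> y \<ominus> y \<otimes> b))" using T[OF b] by simp
    finally show ?thesis unfolding N_def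
      using mult_ops_add[OF l(1)[OF b]] Pc bc y y' l(2)[OF b] by simp
  qed
  \<comment> \<open>The correction to \<open>b\<close> has degree at most \<open>deg b - 1\<close>.
    Its \<open>b\<close>-term obeys the same bound, and dividing by \<open>b\<close> leaves a
    coordinate of negative degree.\<close>
  have Nb: "N b \<in> ball (-1)" if b: "b \<in> B" for b
  proof -
    have bc: "b \<in> carrier D" and b0: "b \<noteq> \<zero>" using b B by auto
    define x where "x = y' \<otimes> (b \<otimes> y \<ominus> y \<otimes> b)"
    have xc: "x \<in> carrier D" using bc y y' by (simp add: x_def)
    have "b \<otimes> y \<ominus> y \<otimes> b \<in> ball (deg b + deg y - 1)"
      by (rule ball_commutator) (use bc y ball_deg in auto)
    from ball_mult[OF ball_deg[OF y'(1)] this]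
    have "x \<in> ball (deg b - 1)" unfolding x_def y'_def using deg_inv[OF y] by simp
    then have "b \<otimes> z x b \<in> ball (deg b - 1)"
      using z(3)[OF xc _ b] center_commute[OF z(1)[OF xc] bc] by simp
    then have "z x b \<in> ball (deg b - 1 - deg b)" using ball_unit_cancel bc b0 zc[OF xc] by blast
    then show ?thesis unfolding N_def x_def[symmetric] using lz[OF b xc] by simp
  qed
  have Nc: "N b \<in> carrier D" if "b \<in> B" for b using Nb[OF that] ball_carrier by blast
  have tc: "tr (\<lambda>b. Q (P b)) \<in> carrier D" unfolding tr_def using Pc B lc by (intro finsum_closed) auto
  have "tr (\<lambda>b. P (Q b)) = (\<Oplus>b \<in> B. l b (Q (P b)) \<oplus> (\<one> \<oplus> N b))"
    unfolding tr_def using lN Nc lc Pc B by (intro finsum_cong') auto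
  also have "\<dots> = tr (\<lambda>b. Q (P b)) \<oplus> ((\<Oplus>b \<in> B. \<one>) \<oplus> (\<Oplus>b \<in> B. N b))"
  proof -
    have f: "(\<lambda>b. l b (Q (P b))) \<in> B \<rightarrow> carrier D" "N \<in> B \<rightarrow> carrier D"
      "(\<lambda>b. \<one>) \<in> B \<rightarrow> carrier D" "(\<lambda>b. \<one> \<oplus> N b) \<in> B \<rightarrow> carrier D"
      using lc Pc Bc Nc by auto
    show ?thesis unfolding tr_def finsum_addf[OF f(1,4)] finsum_addf[OF f(3,2)] ..
  qed
  also have "(\<Oplus>b \<in> B. \<one>) = [n] \<cdot> \<one>" using add.finprod_const[of \<one> B] B(3) by simp
  finally have "tr (\<lambda>b. Q (P b)) = tr (\<lambda>b. Q (P b)) \<oplus> ([n] \<cdot> \<one> \<oplus> (\<Oplus>b \<in> B. N b))"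
    using tr_sym[OF P Q] by simp
  moreover have Nsum: "(\<Oplus>b \<in> B. N b) \<in> ball (-1)" using finsum_ball B(1) Nb by blast
  ultimately have "[n] \<cdot> \<one> \<oplus> (\<Oplus>b \<in> B. N b) = \<zero>"
    using tc ball_carrier[OF Nsum] add.r_cancel_one'[of "tr (\<lambda>b. Q (P b))" "[n] \<cdot> \<one> \<oplus> (\<Oplus>b \<in> B. N b)"]
    by (simp add: a_comm)
  then have "[n] \<cdot> \<one> = \<ominus> (\<Oplus>b \<in> B. N b)" using ball_carrier[OF Nsum]
    by (intro minus_equality[symmetric]) auto
  then show False using ball_uminus[OF Nsum] n by simp
qed

end

section \<open>Powers in characteristic \<open>p\<close>\<close>

context almost_commutative_division_ring
begin

text \<open>\<open>N\<close> is the guaranteed loss of degree in commutators with \<open>x\<close>,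
  relative to the bound for a product. It is uniform in \<open>y\<close>, so the commutators
  produced by one estimate can be fed back into it.\<close>

definition near_central :: "int \<Rightarrow> 'a \<Rightarrow> bool"
  where "near_central N x \<longleftrightarrow> (\<forall>n. \<forall>y \<in> ball n. x \<otimes> y \<ominus> y \<otimes> x \<in> ball (deg x + n - N))"

lemma near_central_1: "x \<in> carrier D \<Longrightarrow> near_central 1 x"
  unfolding near_central_def using ball_commutator ball_deg by blast

text \<open>By the Leibniz rule the commutator of \<open>x^(i+1)\<close> with \<open>y\<close> is
  \<open>x^i [x, y] + [x^i, y] x\<close>, and both terms lose at least \<open>N\<close>.\<close>

lemma near_central_pow:
  assumes x: "x \<in> carrier D" "x \<noteq> \<zero>" and N: "near_central N x"
  shows "near_central N (x [^] (i :: nat))"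
proof (induction i)
  case 0
  show ?case unfolding near_central_def using ball_carrier by (auto simp: a_minus_def r_neg)
next
  case (Suc i)
  have "x [^] Suc i \<otimes> y \<ominus> y \<otimes> x [^] Suc i \<in> ball (deg (x [^] Suc i) + n - N)" if y: "y \<in> ball n" for n y
  proof -
    have yc: "y \<in> carrier D" using y ball_carrier by blast
    have e: "x [^] Suc i \<otimes> y \<ominus> y \<otimes> x [^] Suc i =
        x [^] i \<otimes> (x \<otimes> y \<ominus> y \<otimes> x) \<oplus> (x [^] i \<otimes> y \<ominus> y \<otimes> x [^] i) \<otimes> x"
    proof -
      have "x [^] i \<in> carrier D" using x by simp
      then show ?thesis unfolding nat_pow_Suc using x yc by algebra
    qed
    have d: "deg (x [^] Suc i) = deg (x [^] i) + deg x"
      unfolding deg_pow[OF x] by (simp add: algebra_simps)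
    have "x [^] i \<otimes> (x \<otimes> y \<ominus> y \<otimes> x) \<in> ball (deg (x [^] i) + (deg x + n - N))"
      using N y x unfolding near_central_def by (intro ball_mult ball_deg) auto
    moreover have "(x [^] i \<otimes> y \<ominus> y \<otimes> x [^] i) \<otimes> x \<in> ball (deg (x [^] i) + n - N + deg x)"
      using Suc y x unfolding near_central_def by (intro ball_mult ball_deg) auto
    ultimately show ?thesis unfolding e d
      by (intro ball_add) (auto elim!: ball_mono)
  qed
  then show ?case unfolding near_central_def by blast
qed

text \<open>With \<open>w = x y - y x\<close> one has \<open>x\<^sup>p y - y x\<^sup>p = \<Sum> x\<^sup>i w x\<^sup>p\<^sup>-\<^sup>1\<^sup>-\<^sup>i\<close>, and moving \<open>w\<close> to the left in
  every summand gives \<open>p w x\<^sup>p\<^sup>-\<^sup>1 = 0\<close> up to commutators of \<open>w\<close> with powers of \<open>x\<close>.\<close>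

lemma near_central_char_pow:
  assumes x: "x \<in> carrier D" "x \<noteq> \<zero>" and N: "near_central N x"
    and p: "p > 0" "[p] \<cdot> \<one> = \<zero>"
  shows "near_central (2 * N) (x [^] (p :: nat))"
proof -
  have "x [^] p \<otimes> y \<ominus> y \<otimes> x [^] p \<in> ball (deg (x [^] p) + n - 2 * N)" if y: "y \<in> ball n" for n y
  proof -
    have yc: "y \<in> carrier D" using y ball_carrier by blast
    define w where "w = x \<otimes> y \<ominus> y \<otimes> x"
    have w: "w \<in> ball (deg x + n - N)" using N y unfolding near_central_def w_def by blast
    have wc: "w \<in> carrier D" using x yc by (simp add: w_def)
    have pc: "x [^] i \<in> carrier D" for i :: nat using x by simp
    \<comment> \<open>Stated for every exponent so that induction applies. The new error is the
      commutator of \<open>w\<close> with a power of \<open>x\<close>: \<open>w\<close> has already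
      lost \<open>N\<close>, and commuting loses \<open>N\<close> again. At exponent
      \<open>p\<close> the main term carries the factor \<open>p\<close> and disappears.\<close>
    have main: "(x [^] Suc i \<otimes> y \<ominus> y \<otimes> x [^] Suc i) \<ominus> [Suc i] \<cdot> \<one> \<otimes> (w \<otimes> x [^] i)
        \<in> ball (int (Suc i) * deg x + n - 2 * N)" for i
    proof (induction i)
      case 0
      have "(x [^] Suc 0 \<otimes> y \<ominus> y \<otimes> x [^] Suc 0) \<ominus> [Suc 0] \<cdot> \<one> \<otimes> (w \<otimes> x [^] (0 :: nat)) = \<zero>"
        using x yc by (simp add: w_def a_minus_def r_neg)
      then show ?case by simp
    next
      case (Suc i)
      define c where "c = [Suc i] \<cdot> \<one>"
      define a where "a = x [^] i"
      define b where "b = x [^] Suc i"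
      have cc: "c \<in> carrier D" "a \<in> carrier D" "b \<in> carrier D" "b = a \<otimes> x"
        using x by (auto simp: c_def a_def b_def)
      have e: "(x [^] Suc (Suc i) \<otimes> y \<ominus> y \<otimes> x [^] Suc (Suc i)) \<ominus> [Suc (Suc i)] \<cdot> \<one> \<otimes> (w \<otimes> x [^] Suc i)
        = (b \<otimes> w \<ominus> w \<otimes> b) \<oplus> ((b \<otimes> y \<ominus> y \<otimes> b) \<ominus> c \<otimes> (w \<otimes> a)) \<otimes> x"
      proof -
        have "x [^] Suc (Suc i) = b \<otimes> x" "[Suc (Suc i)] \<cdot> \<one> = c \<oplus> \<one>" by (simp_all add: b_def c_def)
        moreover have "(b \<otimes> x \<otimes> y \<ominus> y \<otimes> (b \<otimes> x)) \<ominus> (c \<oplus> \<one>) \<otimes> (w \<otimes> b)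
          = (b \<otimes> w \<ominus> w \<otimes> b) \<oplus> ((b \<otimes> y \<ominus> y \<otimes> b) \<ominus> c \<otimes> (w \<otimes> a)) \<otimes> x"
        proof -
          have wa: "w \<otimes> a \<otimes> x = w \<otimes> b" using cc wc x by (simp add: m_assoc)
          have "((b \<otimes> y \<ominus> y \<otimes> b) \<ominus> c \<otimes> (w \<otimes> a)) \<otimes> x
            = (b \<otimes> y \<otimes> x \<ominus> y \<otimes> b \<otimes> x) \<ominus> c \<otimes> (w \<otimes> a \<otimes> x)"
            using cc(1-3) wc x(1) yc by algebra
          moreover have "b \<otimes> w = b \<otimes> x \<otimes> y \<ominus> b \<otimes> y \<otimes> x"
            using cc(3) x(1) yc unfolding w_def by algebra
          ultimately show ?thesis unfolding wa using cc(1,3) wc x(1) yc by algebra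
        qed
        ultimately show ?thesis by (simp add: b_def)
      qed
      have "b \<otimes> w \<ominus> w \<otimes> b \<in> ball (deg b + (deg x + n - N) - N)"
        using near_central_pow[OF x N, of "Suc i"] w unfolding near_central_def b_def by blast
      moreover have "((b \<otimes> y \<ominus> y \<otimes> b) \<ominus> c \<otimes> (w \<otimes> a)) \<otimes> x \<in> ball (int (Suc i) * deg x + n - 2 * N + deg x)"
        using Suc x by (intro ball_mult ball_deg) (auto simp: a_def b_def c_def)
      moreover have "deg b = int (Suc i) * deg x" unfolding b_def by (rule deg_pow[OF x])
      ultimately show ?case unfolding e
        by (intro ball_add) (auto elim!: ball_mono simp: algebra_simps)
    qed
    obtain i where i: "p = Suc i" using p(1) gr0_implies_Suc by blast
    have "x [^] p \<otimes> y \<ominus> y \<otimes> x [^] p \<in> ball (int p * deg x + n - 2 * N)"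
      using main[of i] p(2) x yc wc unfolding i[symmetric] by (simp add: a_minus_def)
    then show ?thesis using deg_pow[OF x] by simp
  qed
  then show ?thesis unfolding near_central_def by blast
qed

lemma near_central_char_pow_iter:
  assumes x: "x \<in> carrier D" "x \<noteq> \<zero>" and p: "p > 0" "[p] \<cdot> \<one> = \<zero>"
  shows "near_central (2 ^ k) (x [^] ((p :: nat) ^ k))"
proof (induction k)
  case 0 then show ?case using near_central_1 x by simp
next
  case (Suc k)
  have "near_central (2 * 2 ^ k) ((x [^] (p ^ k)) [^] p)"
    by (rule near_central_char_pow[OF _ _ Suc p]) (use x pow_nonzero in auto)
  moreover have "(x [^] (p ^ k)) [^] p = x [^] (p ^ Suc k)"
    using x by (simp add: nat_pow_pow mult.commute)
  ultimately show ?case by simp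
qed

text \<open>A nearly central \<open>x\<close> can be moved to the far left of each summand
  \<open>b x c\<close> at the cost of its commutator with \<open>b\<close>. Right factors cost
  nothing beyond their degree, and \<open>C\<close> is independent of both \<open>x\<close> and
  \<open>N\<close>.\<close>

lemma mult_ops_near_central:
  "\<phi> \<in> mult_ops \<Longrightarrow> \<exists>C. \<forall>N. \<forall>x \<in> carrier D. near_central N x \<longrightarrow> \<phi> x \<ominus> x \<otimes> \<phi> \<one> \<in> ball (deg x + C - N)"
proof (induction rule: mult_ops.induct)
  case ident
  show ?case by (auto simp: a_minus_def r_neg)
next
  case (lmult \<phi> b)
  then obtain C where C: "\<And>N x. x \<in> carrier D \<Longrightarrow> near_central N x \<Longrightarrow> \<phi> x \<ominus> x \<otimes> \<phi> \<one> \<in> ball (deg x + C - N)"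
    by blast
  define f where "f = \<phi> \<one>"
  have f: "f \<in> carrier D" using mult_ops_closed[OF lmult.hyps(1)] by (simp add: f_def)
  have b: "b \<in> carrier D" using lmult by blast
  have "b \<otimes> \<phi> x \<ominus> x \<otimes> (b \<otimes> f) \<in> ball (deg x + max (deg b + C) (deg b + deg f) - N)"
    if x: "x \<in> carrier D" "near_central N x" for N x
  proof -
    have \<phi>x: "\<phi> x \<in> carrier D" using mult_ops_closed[OF lmult.hyps(1)] x by blast
    have e: "b \<otimes> \<phi> x \<ominus> x \<otimes> (b \<otimes> f) = b \<otimes> (\<phi> x \<ominus> x \<otimes> f) \<ominus> (x \<otimes> b \<ominus> b \<otimes> x) \<otimes> f"
      using \<phi>x x(1) b f by algebra
    have "b \<otimes> (\<phi> x \<ominus> x \<otimes> f) \<in> ball (deg b + (deg x + C - N))"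
      using C[OF x] b unfolding f_def by (intro ball_mult ball_deg)
    moreover have "(x \<otimes> b \<ominus> b \<otimes> x) \<otimes> f \<in> ball ((deg x + deg b - N) + deg f)"
      using x(2) b f ball_deg unfolding near_central_def by (intro ball_mult) auto
    ultimately show ?thesis unfolding e by (intro ball_minus) (auto elim!: ball_mono)
  qed
  then show ?case unfolding f_def by blast
next
  case (rmult \<phi> c)
  then obtain C where C: "\<And>N x. x \<in> carrier D \<Longrightarrow> near_central N x \<Longrightarrow> \<phi> x \<ominus> x \<otimes> \<phi> \<one> \<in> ball (deg x + C - N)"
    by blast
  define f where "f = \<phi> \<one>"
  have f: "f \<in> carrier D" using mult_ops_closed[OF rmult.hyps(1)] by (simp add: f_def)
  have c: "c \<in> carrier D" using rmult by blast
  have "\<phi> x \<otimes> c \<ominus> x \<otimes> (f \<otimes> c) \<in> ball (deg x + (C + deg c) - N)"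
    if x: "x \<in> carrier D" "near_central N x" for N x
  proof -
    have \<phi>x: "\<phi> x \<in> carrier D" using mult_ops_closed[OF rmult.hyps(1)] x by blast
    have e: "\<phi> x \<otimes> c \<ominus> x \<otimes> (f \<otimes> c) = (\<phi> x \<ominus> x \<otimes> f) \<otimes> c"
      using \<phi>x x(1) c f by algebra
    have "(\<phi> x \<ominus> x \<otimes> f) \<otimes> c \<in> ball ((deg x + C - N) + deg c)"
      using C[OF x] c unfolding f_def by (intro ball_mult ball_deg)
    then show ?thesis unfolding e by (auto elim!: ball_mono)
  qed
  then show ?case unfolding f_def by blast
next
  case (plus \<phi> \<psi>)
  then obtain C C' where C: "\<And>N x. x \<in> carrier D \<Longrightarrow> near_central N x \<Longrightarrow> \<phi> x \<ominus> x \<otimes> \<phi> \<one> \<in> ball (deg x + C - N)"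
    "\<And>N x. x \<in> carrier D \<Longrightarrow> near_central N x \<Longrightarrow> \<psi> x \<ominus> x \<otimes> \<psi> \<one> \<in> ball (deg x + C' - N)"
    by blast
  define f g where "f = \<phi> \<one>" and "g = \<psi> \<one>"
  have fg: "f \<in> carrier D" "g \<in> carrier D"
    using mult_ops_closed plus.hyps by (auto simp: f_def g_def)
  have "\<phi> x \<oplus> \<psi> x \<ominus> x \<otimes> (f \<oplus> g) \<in> ball (deg x + max C C' - N)"
    if x: "x \<in> carrier D" "near_central N x" for N x
  proof -
    have c: "\<phi> x \<in> carrier D" "\<psi> x \<in> carrier D" using mult_ops_closed plus.hyps x by auto
    have e: "\<phi> x \<oplus> \<psi> x \<ominus> x \<otimes> (f \<oplus> g) = (\<phi> x \<ominus> x \<otimes> f) \<oplus> (\<psi> x \<ominus> x \<otimes> g)"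
      using c x(1) fg by algebra
    show ?thesis unfolding e unfolding f_def g_def
      by (intro ball_add ball_mono[OF C(1)[OF x]] ball_mono[OF C(2)[OF x]]) auto
  qed
  then show ?case unfolding f_def g_def by blast
qed

text \<open>The coordinate of \<open>\<one>\<close> in a basis that contains \<open>\<one>\<close>,
  realized as a multiplication operator by separation.\<close>

lemma central_projection_exists:
  assumes dim: "dimension n Z (carrier D)"
  shows "\<exists>\<phi> \<in> mult_ops. \<phi> \<one> = \<one> \<and> (\<forall>x \<in> carrier D. \<phi> x \<in> Z)"
proof -
  have i1: "independent Z [\<one>]" using one_not_zero by (simp add: independent_Cons_iff Span_Nil)
  obtain Vs where Vs: "length (Vs @ [\<one>]) = n" "independent Z (Vs @ [\<one>])"
      "Span Z (Vs @ [\<one>]) = carrier D"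
    using complete_base[OF center_subfield dim i1] by auto
  have ind: "independent Z (\<one> # Vs)"
    by (rule independent_same_set[OF center_subfield _ _ Vs(2)]) auto
  have sp: "Span Z (\<one> # Vs) = carrier D"
    using independent_length_eq_dimension[OF center_subfield dim ind] Vs(1)
      independent_in_carrier[OF ind] by simp
  obtain \<phi> where \<phi>: "\<phi> \<in> mult_ops" "\<phi> \<one> = \<one>" "\<forall>b \<in> set Vs. \<phi> b = \<zero>"
    using mult_ops_separate[OF ind] by blast
  have V: "set Vs \<subseteq> carrier D" using independent_in_carrier[OF ind] by simp
  have "\<phi> x \<in> Z" if x: "x \<in> carrier D" for x
  proof -
    obtain z y where zy: "z \<in> Z" "y \<in> Span Z Vs" "x = z \<otimes> \<one> \<oplus> y"
      using x Span_Cons_iff[of x \<one> Vs] sp by blast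
    have "\<phi> x = z \<otimes> \<phi> \<one> \<oplus> \<phi> y" unfolding zy(3)
      using mult_ops_add[OF \<phi>(1)] mult_ops_smult[OF \<phi>(1) zy(1)] center_carrier[OF zy(1)]
        Span_carrier[OF V zy(2)] by (metis m_closed one_closed)
    then show ?thesis using \<phi>(2) mult_ops_Span_zero[OF \<phi>(1) V \<phi>(3) zy(2)] zy(1) center_carrier by simp
  qed
  then show ?thesis using \<phi> by blast
qed

text \<open>Because \<open>\<phi> \<one> = \<one>\<close>, a sufficiently central \<open>w\<close>
  is close to the central element \<open>\<phi> w\<close>. One projection serves all
  \<open>x\<close>, so the exponent is uniform.\<close>

lemma power_near_center:
  assumes dim: "dimension n Z (carrier D)" and p: "p > 0" "[p] \<cdot> \<one> = \<zero>"
  shows "\<exists>k. \<forall>x \<in> carrier D - {\<zero>}. \<exists>z \<in> Z. x [^] ((p :: nat) ^ k) \<ominus> z \<in> ball (deg (x [^] (p ^ k)) - 1)"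
proof -
  obtain \<phi> where \<phi>: "\<phi> \<in> mult_ops" "\<phi> \<one> = \<one>" "\<And>x. x \<in> carrier D \<Longrightarrow> \<phi> x \<in> Z"
    using central_projection_exists[OF dim] by blast
  obtain C where C: "\<And>N x. x \<in> carrier D \<Longrightarrow> near_central N x \<Longrightarrow> \<phi> x \<ominus> x \<otimes> \<phi> \<one> \<in> ball (deg x + C - N)"
    using mult_ops_near_central[OF \<phi>(1)] by blast
  \<comment> \<open>Ensures \<open>2^k > C + 1\<close>, so that the error bound
    \<open>deg w + C - 2^k\<close> falls below \<open>deg w\<close>.\<close>
  define k where "k = nat (C + 1)"
  have "C + 1 \<le> int k" by (simp add: k_def)
  also have "int k < 2 ^ k" using of_nat_less_two_power by blast
  finally have k: "C + 1 < 2 ^ k" .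
  have "\<exists>z \<in> Z. x [^] (p ^ k) \<ominus> z \<in> ball (deg (x [^] (p ^ k)) - 1)" if x: "x \<in> carrier D - {\<zero>}" for x
  proof -
    define w where "w = x [^] (p ^ k)"
    have w: "w \<in> carrier D" "near_central (2 ^ k) w"
      using x near_central_char_pow_iter[OF _ _ p] by (auto simp: w_def)
    have wz: "\<phi> w \<in> Z" "\<phi> w \<in> carrier D" using \<phi>(3)[OF w(1)] center_carrier by auto
    have "\<phi> w \<ominus> w \<in> ball (deg w - 1)"
      using C[OF w] \<phi>(2) w(1) k by (auto elim!: ball_mono)
    moreover have "w \<ominus> \<phi> w = \<ominus> (\<phi> w \<ominus> w)" using w wz by algebra
    ultimately have "w \<ominus> \<phi> w \<in> ball (deg w - 1)" using ball_uminus by simp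
    then show ?thesis using wz unfolding w_def[symmetric] by blast
  qed
  then show ?thesis by blast
qed

end

section \<open>The residue field\<close>

context almost_commutative_division_ring
begin

definition valuation_ring :: "('a, 'b) ring_scheme"
  where "valuation_ring = D\<lparr>carrier := ball 0\<rparr>"

text \<open>Degrees are integers, so \<open>ball (-1)\<close> consists of zero and the elements of
  negative degree.\<close>

definition residue_field :: "'a set ring"
  where "residue_field = valuation_ring Quot ball (-1)"

definition res :: "'a \<Rightarrow> 'a set"
  where "res x = ball (-1) +>\<^bsub>valuation_ring\<^esub> x"

text \<open>The residue field of the center for the restricted valuation, seen inside the residue
  field of \<open>D\<close>; the residue degree is taken over it.\<close>

definition residue_center :: "'a set set"
  where "residue_center = res ` (Z \<inter> ball 0)"

lemma valuation_subring: "subring (ball 0) D"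
proof (rule subringI)
  show "h1 \<otimes> h2 \<in> ball 0" if "h1 \<in> ball 0" "h2 \<in> ball 0" for h1 h2
    using ball_mult[OF that] by simp
  show "ball 0 \<subseteq> carrier D" using ball_carrier by blast
  show "\<one> \<in> ball 0" by (simp add: ball_def deg_one)
qed (intro ball_uminus ball_add; assumption)+

lemma valuation_ring_ring: "ring valuation_ring"
  unfolding valuation_ring_def by (rule subring_is_ring[OF valuation_subring])

lemma valuation_ring_sel [simp]:
  "carrier valuation_ring = ball 0" "monoid.mult valuation_ring = (\<otimes>)" "monoid.one valuation_ring = \<one>"
  "ring.zero valuation_ring = \<zero>" "ring.add valuation_ring = (\<oplus>)"
  by (simp_all add: valuation_ring_def)

lemma valuation_ring_a_inv:
  assumes "x \<in> ball 0"
  shows "\<ominus>\<^bsub>valuation_ring\<^esub> x = \<ominus> x"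
proof -
  interpret V: ring valuation_ring by (rule valuation_ring_ring)
  show ?thesis
    using V.minus_equality[of "\<ominus> x" x] assms ball_uminus[OF assms] ball_carrier[OF assms] by (simp add: l_neg)
qed

lemma residue_ideal: "ideal (ball (-1)) valuation_ring"
proof (rule idealI[OF valuation_ring_ring])
  interpret V: ring valuation_ring by (rule valuation_ring_ring)
  show "subgroup (ball (-1)) (add_monoid valuation_ring)"
  proof (rule group.subgroupI[OF V.add.group_axioms])
    show "ball (-1) \<subseteq> carrier (add_monoid valuation_ring)" using ball_mono by fastforce
    show "ball (-1) \<noteq> {}" using zero_ball by blast
    show "inv\<^bsub>add_monoid valuation_ring\<^esub> a \<in> ball (-1)" if "a \<in> ball (-1)" for a
      using valuation_ring_a_inv[of a] ball_uminus[OF that] ball_mono[OF that, of 0] unfolding a_inv_def by simp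
  qed (use ball_add in auto)
  show "x \<otimes>\<^bsub>valuation_ring\<^esub> a \<in> ball (-1)" "a \<otimes>\<^bsub>valuation_ring\<^esub> x \<in> ball (-1)"
    if "a \<in> ball (-1)" "x \<in> carrier valuation_ring" for a x
    using that ball_mult[of x 0 a "-1"] ball_mult[of a "-1" x 0] by auto
qed

lemma residue_ring_hom: "ring_hom_ring valuation_ring residue_field res"
  unfolding residue_field_def res_def[abs_def] by (rule ideal.rcos_ring_hom_ring[OF residue_ideal])

lemma res_closed:
  assumes "x \<in> ball 0"
  shows "res x \<in> carrier residue_field"
proof -
  interpret h: ring_hom_ring valuation_ring residue_field res by (rule residue_ring_hom)
  show ?thesis using assms h.hom_closed by simp
qed

lemma res_mult:
  assumes "x \<in> ball 0" "y \<in> ball 0"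
  shows "res (x \<otimes> y) = res x \<otimes>\<^bsub>residue_field\<^esub> res y"
proof -
  interpret h: ring_hom_ring valuation_ring residue_field res by (rule residue_ring_hom)
  show ?thesis using assms h.hom_mult by simp
qed

lemma res_add:
  assumes "x \<in> ball 0" "y \<in> ball 0"
  shows "res (x \<oplus> y) = res x \<oplus>\<^bsub>residue_field\<^esub> res y"
proof -
  interpret h: ring_hom_ring valuation_ring residue_field res by (rule residue_ring_hom)
  show ?thesis using assms h.hom_add by simp
qed

lemma res_one: "res \<one> = \<one>\<^bsub>residue_field\<^esub>"
proof -
  interpret h: ring_hom_ring valuation_ring residue_field res by (rule residue_ring_hom)
  show ?thesis using h.hom_one by simp
qed

lemma res_zero: "res \<zero> = \<zero>\<^bsub>residue_field\<^esub>"
proof -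
  interpret h: ring_hom_ring valuation_ring residue_field res by (rule residue_ring_hom)
  show ?thesis using h.hom_zero by simp
qed

lemma res_eq_iff:
  assumes "x \<in> ball 0" "y \<in> ball 0"
  shows "res x = res y \<longleftrightarrow> x \<ominus> y \<in> ball (-1)"
proof -
  interpret V: ring valuation_ring by (rule valuation_ring_ring)
  have "x \<ominus>\<^bsub>valuation_ring\<^esub> y = x \<ominus> y" using assms by (simp add: a_minus_def valuation_ring_a_inv)
  then show ?thesis unfolding res_def
    using V.quotient_eq_iff_same_a_r_cos[OF residue_ideal, of x y] assms by simp
qed

lemma res_eq_zero_iff: "x \<in> ball 0 \<Longrightarrow> res x = \<zero>\<^bsub>residue_field\<^esub> \<longleftrightarrow> x \<in> ball (-1)"
  using res_eq_iff[of x \<zero>] by (simp add: res_zero ball_carrier a_minus_def)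

lemma res_surj: "a \<in> carrier residue_field \<Longrightarrow> \<exists>x \<in> ball 0. a = res x"
  unfolding residue_field_def FactRing_def A_RCOSETS_def' res_def by auto

lemma ball_0_not_ball: "x \<in> ball 0 \<Longrightarrow> x \<notin> ball (-1) \<Longrightarrow> x \<noteq> \<zero> \<and> deg x = 0"
  by (auto simp: ball_def)

lemma deg_0_inv: "x \<in> carrier D \<Longrightarrow> x \<noteq> \<zero> \<Longrightarrow> deg x = 0 \<Longrightarrow> inv x \<in> ball 0"
  using inv_props deg_inv by (simp add: ball_def)

text \<open>Commutativity is inherited from the degree drop: commutators of elements of
  \<open>ball 0\<close> lie in \<open>ball (-1)\<close>. A nonzero residue lifts to an element of
  degree 0, whose inverse again lies in \<open>ball 0\<close>.\<close>

lemma residue_field_field: "field residue_field"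
proof -
  interpret h: ring_hom_ring valuation_ring residue_field res by (rule residue_ring_hom)
  have "cring residue_field"
  proof (rule cring.intro[OF h.S.ring_axioms comm_monoid.intro[OF h.S.monoid_axioms comm_monoid_axioms.intro]])
    fix a b assume "a \<in> carrier residue_field" "b \<in> carrier residue_field"
    then obtain x y where xy: "x \<in> ball 0" "y \<in> ball 0" "a = res x" "b = res y" using res_surj by blast
    have "x \<otimes> y \<ominus> y \<otimes> x \<in> ball (-1)" using ball_commutator[OF xy(1,2)] by simp
    then show "a \<otimes>\<^bsub>residue_field\<^esub> b = b \<otimes>\<^bsub>residue_field\<^esub> a"
      using res_eq_iff[of "x \<otimes> y" "y \<otimes> x"] ball_mult[of x 0 y 0] ball_mult[of y 0 x 0] xy res_mult by simp
  qed
  then show ?thesis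
  proof (rule cring.cring_fieldI2)
    show "\<zero>\<^bsub>residue_field\<^esub> \<noteq> \<one>\<^bsub>residue_field\<^esub>"
      using res_eq_zero_iff[of \<one>] one_not_zero deg_one res_one by (auto simp: ball_def)
    fix a assume a: "a \<in> carrier residue_field" "a \<noteq> \<zero>\<^bsub>residue_field\<^esub>"
    then obtain x where x: "x \<in> ball 0" "a = res x" using res_surj by blast
    then have x0: "x \<noteq> \<zero>" "deg x = 0" "x \<in> carrier D"
      using res_eq_zero_iff a ball_0_not_ball ball_carrier by auto
    have "a \<otimes>\<^bsub>residue_field\<^esub> res (inv x) = \<one>\<^bsub>residue_field\<^esub>"
      using res_mult[OF x(1) deg_0_inv[OF x0(3,1,2)]] inv_props(4)[OF x0(3,1)] res_one x(2) by simp
    then show "\<exists>b\<in>carrier residue_field. a \<otimes>\<^bsub>residue_field\<^esub> b = \<one>\<^bsub>residue_field\<^esub>"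
      using res_closed deg_0_inv x0 by blast
  qed
qed

lemma residue_center_subfield: "subfield residue_center residue_field"
proof -
  interpret k: field residue_field by (rule residue_field_field)
  interpret h: ring_hom_ring valuation_ring residue_field res by (rule residue_ring_hom)
  note Zr = subringE[OF center_subring]
  have "subring (Z \<inter> ball 0) valuation_ring"
  proof (rule ring.subringI[OF valuation_ring_ring])
    show "\<ominus>\<^bsub>valuation_ring\<^esub> x \<in> Z \<inter> ball 0" if "x \<in> Z \<inter> ball 0" for x
      using that Zr(5) ball_uminus valuation_ring_a_inv by auto
    show "\<one>\<^bsub>valuation_ring\<^esub> \<in> Z \<inter> ball 0" using Zr(3) subringE(3)[OF valuation_subring] by simp
  qed (use Zr subringE[OF valuation_subring] in auto)
  then have "subring residue_center residue_field"
    unfolding residue_center_def by (rule h.img_is_subring)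
  then show ?thesis
  proof (rule k.subfieldI')
    fix a assume "a \<in> residue_center - {\<zero>\<^bsub>residue_field\<^esub>}"
    then obtain x where x: "x \<in> Z" "x \<in> ball 0" "a = res x" and a0: "a \<noteq> \<zero>\<^bsub>residue_field\<^esub>"
      unfolding residue_center_def by auto
    have x0: "x \<noteq> \<zero>" "deg x = 0" "x \<in> carrier D"
      using res_eq_zero_iff[OF x(2)] a0 x ball_0_not_ball ball_carrier by auto
    have i: "inv x \<in> Z" "inv x \<in> ball 0" using center_inv x x0 deg_0_inv by auto
    have "a \<otimes>\<^bsub>residue_field\<^esub> res (inv x) = \<one>\<^bsub>residue_field\<^esub>"
      using res_mult[OF x(2) i(2)] inv_props(4)[OF x0(3,1)] res_one x(3) by simp
    then have "inv\<^bsub>residue_field\<^esub> a = res (inv x)"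
      using k.comm_inv_char res_closed x i by simp
    then show "inv\<^bsub>residue_field\<^esub> a \<in> residue_center" using i by (simp add: residue_center_def)
  qed
qed

section \<open>Spans in the residue field and orthogonal lifts\<close>

abbreviation residue_Span :: "'a set list \<Rightarrow> 'a set set"
  where "residue_Span \<equiv> ring.Span residue_field residue_center"

lemma residue_Span_Cons:
  "t \<in> residue_Span (a # as) \<longleftrightarrow> (\<exists>c \<in> residue_center. \<exists>y \<in> residue_Span as.
     t = c \<otimes>\<^bsub>residue_field\<^esub> a \<oplus>\<^bsub>residue_field\<^esub> y)"
proof -
  interpret k: field residue_field by (rule residue_field_field)
  show ?thesis using k.line_extension_mem_iff[of t residue_center a] by simp
qed

lemma residue_Span_Nil: "residue_Span [] = {\<zero>\<^bsub>residue_field\<^esub>}"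
proof -
  interpret k: field residue_field by (rule residue_field_field)
  show ?thesis by simp
qed

text \<open>Orthogonality keeps each term of an integral combination integral, and since the vectors
  have degree 0 the coefficients are integral as well, so they can be reduced one by one.\<close>

lemma res_Span:
  assumes "orth us" "\<forall>u \<in> set us. deg u = 0" "y \<in> Span Z us" "y \<in> ball 0"
  shows "res y \<in> residue_Span (map res us)"
  using assms
proof (induction us arbitrary: y)
  case Nil then show ?case by (simp add: Span_Nil residue_Span_Nil res_zero)
next
  case (Cons u us)
  have u: "u \<in> carrier D" "u \<noteq> \<zero>" "u \<in> ball 0" and ous: "orth us" using Cons.prems by (auto simp: ball_def)
  obtain z x where zx: "z \<in> Z" "x \<in> Span Z us" "y = z \<otimes> u \<oplus> x" using Cons.prems(3) Span_Cons_iff by blast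
  have x: "x \<in> ball 0" using Cons.prems(1,4) zx by auto
  have "z \<otimes> u = y \<ominus> x" unfolding zx(3) using center_carrier[OF zx(1)] u ball_carrier[OF x] by algebra
  then have "u \<otimes> z \<in> ball 0" using ball_minus[OF Cons.prems(4) x] center_commute[OF zx(1) u(1)] by simp
  then have z: "z \<in> ball 0" using ball_unit_cancel[of u z 0] u center_carrier[OF zx(1)] Cons.prems(2) by simp
  have "res y = res z \<otimes>\<^bsub>residue_field\<^esub> res u \<oplus>\<^bsub>residue_field\<^esub> res x"
    unfolding zx(3) using res_add[OF _ x] res_mult[OF z u(3)] ball_mult[OF z u(3)] by simp
  moreover have "res x \<in> residue_Span (map res us)" using Cons.IH[OF ous _ zx(2) x] Cons.prems(2) by simp
  moreover have "res z \<in> residue_center" using zx(1) z by (simp add: residue_center_def)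
  ultimately show ?case by (simp only: list.map residue_Span_Cons) blast
qed

lemma residue_Span_lift:
  assumes "set us \<subseteq> ball 0" "t \<in> residue_Span (map res us)"
  shows "\<exists>y \<in> Span Z us. y \<in> ball 0 \<and> t = res y"
  using assms
proof (induction us arbitrary: t)
  case Nil then show ?case by (simp add: Span_Nil residue_Span_Nil res_zero)
next
  case (Cons u us)
  then obtain c s where cs: "c \<in> residue_center" "s \<in> residue_Span (map res us)"
      "t = c \<otimes>\<^bsub>residue_field\<^esub> res u \<oplus>\<^bsub>residue_field\<^esub> s" by (auto simp only: list.map residue_Span_Cons)
  obtain z where z: "z \<in> Z" "z \<in> ball 0" "c = res z" using cs(1) by (auto simp: residue_center_def)
  obtain x where x: "x \<in> Span Z us" "x \<in> ball 0" "s = res x" using Cons.IH[OF _ cs(2)] Cons.prems(1) by auto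
  have u: "u \<in> ball 0" using Cons.prems(1) by simp
  have "z \<otimes> u \<oplus> x \<in> Span Z (u # us)" using z x Span_Cons_iff by blast
  moreover have zu: "z \<otimes> u \<in> ball 0" using ball_mult[OF z(2) u] by simp
  moreover have "t = res (z \<otimes> u \<oplus> x)" using cs(3) res_add[OF zu x(2)] res_mult[OF z(2) u] z x by simp
  ultimately show ?case using ball_add[OF zu x(2)] by blast
qed

text \<open>A cancellation of leading terms among lifts of degree 0 would reduce to a linear
  relation between their residues.\<close>

lemma residue_independent_orth:
  assumes "ring.independent residue_field residue_center (map res us)" "set us \<subseteq> ball 0"
  shows "orth us \<and> (\<forall>u \<in> set us. deg u = 0)"
  using assms
proof (induction us)
  case Nil then show ?case by simp
next
  case (Cons u us)
  interpret k: field residue_field by (rule residue_field_field)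
  have ind: "k.independent residue_center (map res us)" "res u \<notin> residue_Span (map res us)"
    using k.independent_backwards[of residue_center "res u" "map res us"] Cons.prems(1) by auto
  have us: "orth us" "\<forall>u \<in> set us. deg u = 0" and usb: "set us \<subseteq> ball 0"
    using Cons.IH[OF ind(1)] Cons.prems(2) by auto
  have u: "u \<in> ball 0" "u \<in> carrier D" using Cons.prems(2) ball_carrier by auto
  have rus: "set (map res us) \<subseteq> carrier residue_field" using usb res_closed by auto
  have "res u \<noteq> \<zero>\<^bsub>residue_field\<^esub>"
    using k.Span_subgroup_props(2)[OF residue_center_subfield rus] ind(2) by metis
  then have u0: "u \<noteq> \<zero>" "deg u = 0" using res_eq_zero_iff[OF u(1)] ball_0_not_ball[OF u(1)] by auto
  have "orth (u # us)"
  proof (rule orth_extend[OF us(1) u(2) u0(1)])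
    fix y assume y: "y \<in> Span Z us"
    show "u \<ominus> y \<notin> ball (deg u - 1)"
    proof
      assume b: "u \<ominus> y \<in> ball (deg u - 1)"
      have yc: "y \<in> carrier D" using Span_carrier[OF orth_carrier[OF us(1)] y] .
      have b': "u \<ominus> y \<in> ball (-1)" using b u0 by simp
      have "y = u \<ominus> (u \<ominus> y)" using u yc by algebra
      then have yb: "y \<in> ball 0" using ball_minus[OF u(1) ball_mono[OF b', of 0]] by simp
      then have "res u = res y" using res_eq_iff[OF u(1)] b' by simp
      then show False using ind(2) res_Span[OF us y yb] by simp
    qed
  qed
  then show ?case using us(2) u0 by simp
qed

end

text \<open>For the residue field: its finite dimension is not known beforehand, but lifting bounds
  the length of independent lists. A longest list spans.\<close>

lemma (in ring) dimension_of_bounded_independent: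
  assumes K: "subfield K R" and bound: "\<And>Us. independent K Us \<Longrightarrow> length Us \<le> n"
  shows "\<exists>Us. independent K Us \<and> Span K Us = carrier R"
proof -
  define N where "N = Max (length ` {Us. independent K Us})"
  have fin: "finite (length ` {Us. independent K Us})"
    by (rule finite_subset[of _ "{..n}"]) (use bound in auto)
  have "[] \<in> {Us. independent K Us}" by simp
  then have "N \<in> length ` {Us. independent K Us}" unfolding N_def using fin by (intro Max_in) blast+
  then obtain Us where Us: "independent K Us" "length Us = N" by auto
  have "x \<in> Span K Us" if x: "x \<in> carrier R" for x
  proof (rule ccontr)
    assume "x \<notin> Span K Us"
    then have "independent K (x # Us)" using Us x by (intro li_Cons)
    then have "length (x # Us) \<in> length ` {Us. independent K Us}" by blast
    then have "length (x # Us) \<le> N" unfolding N_def using fin by (intro Max_ge)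
    then show False using Us by simp
  qed
  then have "Span K Us = carrier R"
    using Span_subgroup_props(1)[OF K independent_in_carrier[OF Us(1)]] by blast
  then show ?thesis using Us by blast
qed

section \<open>Ramification index and residue degree\<close>

lemma int_subgroup_mult:
  fixes G :: "int set"
  assumes "0 \<in> G" "\<And>a b. a \<in> G \<Longrightarrow> b \<in> G \<Longrightarrow> a - b \<in> G" "g \<in> G"
  shows "k * g \<in> G"
proof -
  have neg: "- a \<in> G" if "a \<in> G" for a using assms(2)[OF assms(1) that] by simp
  have pos: "int n * g \<in> G" for n
  proof (induction n)
    case (Suc n)
    then have "int n * g - (- g) \<in> G" using assms(2) neg assms(3) by blast
    then show ?case by (simp add: algebra_simps)
  qed (use assms(1) in simp)
  show ?thesis
  proof (cases "k \<ge> 0")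
    case True
    then show ?thesis using pos[of "nat k"] by simp
  next
    case False
    then show ?thesis using neg[OF pos[of "nat (- k)"]] by simp
  qed
qed

lemma int_subgroup_generator:
  fixes G :: "int set"
  assumes "0 \<in> G" "\<And>a b. a \<in> G \<Longrightarrow> b \<in> G \<Longrightarrow> a - b \<in> G"
  shows "\<exists>g \<in> G. \<forall>x \<in> G. g dvd x"
proof (cases "\<exists>x \<in> G. x > 0")
  case False
  have "x = 0" if "x \<in> G" for x
  proof -
    have "0 - x \<in> G" using assms(2)[OF assms(1) that] .
    then have "\<not> x > 0" "\<not> 0 - x > 0" using False that by blast+
    then show ?thesis by simp
  qed
  then show ?thesis using assms(1) by fastforce
next
  case True
  then obtain x where "x \<in> G" "x > 0" by blast
  then have ex: "int (nat x) \<in> G \<and> nat x > 0" by simp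
  define m where "m = (LEAST m. int m \<in> G \<and> m > 0)"
  have m: "int m \<in> G" "m > 0" using LeastI[of "\<lambda>m. int m \<in> G \<and> m > 0", OF ex] by (auto simp: m_def)
  have "int m dvd y" if y: "y \<in> G" for y
  proof (rule ccontr)
    assume "\<not> int m dvd y"
    then have "y mod int m \<noteq> 0" by auto
    moreover have "y mod int m \<ge> 0" using m(2) by simp
    ultimately have "y mod int m > 0" by linarith
    moreover have "y mod int m = y - (y div int m) * int m" by (simp add: minus_div_mult_eq_mod)
    moreover have "(y div int m) * int m \<in> G" by (rule int_subgroup_mult[OF assms(1,2) m(1)])
    ultimately have "int (nat (y mod int m)) \<in> G \<and> nat (y mod int m) > 0" using assms(2)[OF y] by simp
    then have "m \<le> nat (y mod int m)" unfolding m_def by (rule Least_le)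
    moreover have "y mod int m < int m" using m(2) by simp
    ultimately show False using m(2) by linarith
  qed
  then show ?thesis using m(1) by blast
qed

section \<open>Scaling and concatenating orthogonal families\<close>

context almost_commutative_division_ring
begin

text \<open>Right multiplication by \<open>c\<close> shifts all degrees by \<open>deg c\<close> and
  does not disturb central coefficients on the left.\<close>

lemma orth_map_mult:
  assumes "orth us" and c: "c \<in> carrier D" "c \<noteq> \<zero>"
  shows "orth (map (\<lambda>u. u \<otimes> c) us) \<and> Span Z (map (\<lambda>u. u \<otimes> c) us) = (\<lambda>y. y \<otimes> c) ` Span Z us"
  using assms(1)
proof (induction us)
  case Nil then show ?case using c by (simp add: Span_Nil)
next
  case (Cons u us)
  have u: "u \<in> carrier D" "u \<noteq> \<zero>" and ous: "orth us"
    and o: "\<And>n z y. z \<in> Z \<Longrightarrow> y \<in> Span Z us \<Longrightarrow> z \<otimes> u \<oplus> y \<in> ball n \<Longrightarrow> y \<in> ball n"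
    using Cons.prems by auto
  have IH: "orth (map (\<lambda>u. u \<otimes> c) us)" "Span Z (map (\<lambda>u. u \<otimes> c) us) = (\<lambda>y. y \<otimes> c) ` Span Z us"
    using Cons.IH[OF ous] by auto
  have yc: "y \<in> carrier D" if "y \<in> Span Z us" for y using Span_carrier[OF orth_carrier[OF ous] that] .
  have dist: "z \<otimes> (u \<otimes> c) \<oplus> y \<otimes> c = (z \<otimes> u \<oplus> y) \<otimes> c" if "z \<in> Z" "y \<in> Span Z us" for z y
    using that yc u c center_carrier by (simp add: l_distr m_assoc)
  have cancel: "x \<in> ball n" if "x \<otimes> c \<in> ball (n + deg c)" "x \<in> carrier D" for x n
    using that deg_mult[of x c] mult_nonzero[of x c] c by (auto simp: ball_def)
  have sp: "Span Z (map (\<lambda>u. u \<otimes> c) (u # us)) = (\<lambda>y. y \<otimes> c) ` Span Z (u # us)"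
  proof -
    have "x \<in> Span Z (map (\<lambda>u. u \<otimes> c) (u # us)) \<longleftrightarrow>
        (\<exists>z \<in> Z. \<exists>y \<in> Span Z us. x = (z \<otimes> u \<oplus> y) \<otimes> c)" for x
      using dist by (simp add: Span_Cons_iff IH(2))
    moreover have "x \<in> (\<lambda>y. y \<otimes> c) ` Span Z (u # us) \<longleftrightarrow>
        (\<exists>z \<in> Z. \<exists>y \<in> Span Z us. x = (z \<otimes> u \<oplus> y) \<otimes> c)" for x
      unfolding image_iff Bex_def Span_Cons_iff by blast
    ultimately show ?thesis by blast
  qed
  have "y' \<in> ball n" if h: "z \<in> Z" "y' \<in> Span Z (map (\<lambda>u. u \<otimes> c) us)" "z \<otimes> (u \<otimes> c) \<oplus> y' \<in> ball n" for n z y'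
  proof -
    obtain y where y: "y \<in> Span Z us" "y' = y \<otimes> c" using h(2) IH(2) by blast
    have "(z \<otimes> u \<oplus> y) \<otimes> c \<in> ball ((n - deg c) + deg c)" using h(3) dist[OF h(1) y(1)] y(2) by simp
    then have "z \<otimes> u \<oplus> y \<in> ball (n - deg c)"
      using cancel h(1) center_carrier yc[OF y(1)] u by simp
    then have "y \<in> ball (n - deg c)" using o h(1) y(1) by blast
    then show ?thesis using ball_mult[OF _ ball_deg[OF c(1)], of y "n - deg c"] y(2) by simp
  qed
  then have "orth (map (\<lambda>u. u \<otimes> c) (u # us))" using IH(1) u c mult_nonzero[of u c] by simp
  then show ?case using sp by blast
qed

text \<open>The hypothesis is the clause of \<open>orth\<close> with a whole span in place of the
  multiples of one vector.\<close>

lemma orth_append: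
  assumes "orth as" "orth bs"
    and "\<And>n x y. x \<in> Span Z as \<Longrightarrow> y \<in> Span Z bs \<Longrightarrow> x \<oplus> y \<in> ball n \<Longrightarrow> y \<in> ball n"
  shows "orth (as @ bs)"
  using assms(1,3)
proof (induction as)
  case Nil then show ?case using assms(2) by simp
next
  case (Cons a as)
  have a: "a \<in> carrier D" "a \<noteq> \<zero>" and oas: "orth as" and as: "set as \<subseteq> carrier D"
    and o: "\<And>n z y. z \<in> Z \<Longrightarrow> y \<in> Span Z as \<Longrightarrow> z \<otimes> a \<oplus> y \<in> ball n \<Longrightarrow> y \<in> ball n"
    using Cons.prems(1) orth_carrier by auto
  have bs: "set bs \<subseteq> carrier D" using assms(2) orth_carrier by blast
  have sub: "Span Z as \<subseteq> Span Z (a # as)" by (rule mono_Span[OF center_subfield as a(1)])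
  have IH: "orth (as @ bs)" using Cons.IH[OF oas] Cons.prems(2) sub by blast
  have "w \<in> ball n" if z: "z \<in> Z" and w: "w \<in> Span Z (as @ bs)" "z \<otimes> a \<oplus> w \<in> ball n" for n z w
  proof -
    obtain x y where xy: "x \<in> Span Z as" "y \<in> Span Z bs" "w = x \<oplus> y"
      using w(1) unfolding Span_append_eq_set_add[OF center_subfield as bs] set_add_def' by auto
    have c: "x \<in> carrier D" "y \<in> carrier D" "z \<otimes> a \<in> carrier D"
      using Span_carrier[OF as xy(1)] Span_carrier[OF bs xy(2)] center_carrier[OF z] a by auto
    have s: "(z \<otimes> a \<oplus> x) \<oplus> y \<in> ball n" using w(2) xy(3) c by (simp add: a_assoc)
    have zx: "z \<otimes> a \<oplus> x \<in> Span Z (a # as)" using Span_Cons_iff z xy(1) by blast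
    have y: "y \<in> ball n" by (rule Cons.prems(2)[OF zx xy(2) s])
    have "z \<otimes> a \<oplus> x = ((z \<otimes> a \<oplus> x) \<oplus> y) \<ominus> y" using c by algebra
    then have "z \<otimes> a \<oplus> x \<in> ball n" using ball_minus[OF s y] by simp
    then have "x \<in> ball n" using o[OF z xy(1)] by blast
    then show ?thesis using y xy(3) ball_add by blast
  qed
  then show ?case using IH a by simp
qed

text \<open>Since leading terms do not cancel, some single term of the combination attains its
  degree.\<close>

lemma orth_Span_deg:
  assumes "orth as" "x \<in> Span Z as" "x \<noteq> \<zero>"
  shows "\<exists>z \<in> Z - {\<zero>}. \<exists>a \<in> set as. deg x = deg z + deg a"
  using assms
proof (induction as arbitrary: x)
  case Nil then show ?case by (simp add: Span_Nil)
next
  case (Cons a as)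
  have a: "a \<in> carrier D" "a \<noteq> \<zero>" and oas: "orth as" and as: "set as \<subseteq> carrier D"
    and o: "\<And>n z y. z \<in> Z \<Longrightarrow> y \<in> Span Z as \<Longrightarrow> z \<otimes> a \<oplus> y \<in> ball n \<Longrightarrow> y \<in> ball n"
    using Cons.prems(1) orth_carrier by auto
  obtain z y where zy: "z \<in> Z" "y \<in> Span Z as" "x = z \<otimes> a \<oplus> y" using Cons.prems(2) Span_Cons_iff by blast
  have c: "z \<in> carrier D" "y \<in> carrier D" using center_carrier zy Span_carrier[OF as] by auto
  have xc: "x \<in> carrier D" using zy c a by simp
  show ?case
  proof (cases "z = \<zero>")
    case True
    then have "x = y" using zy c a by simp
    then obtain z' b where "z' \<in> Z - {\<zero>}" "b \<in> set as" "deg x = deg z' + deg b"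
      using Cons.IH[OF oas zy(2)] Cons.prems(3) by blast
    then show ?thesis by (intro bexI[of _ z'] bexI[of _ b]) auto
  next
    case z: False
    have za: "z \<otimes> a \<noteq> \<zero>" "deg (z \<otimes> a) = deg z + deg a" using mult_nonzero deg_mult z a c by auto
    have y: "y \<in> ball (deg x)" using o[OF zy(1,2)] ball_deg[OF xc] zy(3) by metis
    have "z \<otimes> a = x \<ominus> y" unfolding zy(3) using c a by algebra
    then have "z \<otimes> a \<in> ball (deg x)" using ball_minus[OF ball_deg[OF xc] y] by simp
    then have le: "deg (z \<otimes> a) \<le> deg x" using za by (simp add: ball_def)
    show ?thesis
    proof (cases "deg (z \<otimes> a) = deg x")
      case True
      then have "deg x = deg z + deg a" using za(2) by simp
      then show ?thesis using z zy(1) by (intro bexI[of _ z] bexI[of _ a]) auto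
    next
      case False
      have y0: "y \<noteq> \<zero>"
      proof
        assume "y = \<zero>"
        then have "x = z \<otimes> a" using zy(3) c a by simp
        then show False using False by simp
      qed
      then have "deg x \<le> max (deg (z \<otimes> a)) (deg y)"
        using deg_add[of "z \<otimes> a" y] za(1) Cons.prems(3) c a zy(3) by simp
      moreover have "deg y \<le> deg x" using y y0 by (simp add: ball_def)
      ultimately have "deg y = deg x" using False le by simp
      moreover obtain z' b where "z' \<in> Z - {\<zero>}" "b \<in> set as" "deg y = deg z' + deg b"
        using Cons.IH[OF oas zy(2) y0] by blast
      ultimately show ?thesis by (intro bexI[of _ z'] bexI[of _ b]) auto
    qed
  qed
qed

lemma sum_distinct_deg:
  assumes "x \<in> carrier D" "y \<in> carrier D" "x \<noteq> \<zero>" "y \<noteq> \<zero>" "deg x \<noteq> deg y" "x \<oplus> y \<in> ball n"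
  shows "y \<in> ball n"
proof (rule ccontr)
  assume "y \<notin> ball n"
  then have n: "n < deg y" using not_ball_deg assms by blast
  have e: "y = (x \<oplus> y) \<ominus> x" "x = (x \<oplus> y) \<ominus> y" using assms(1,2) by algebra+
  show False
  proof (cases "deg x < deg y")
    case True
    have "(x \<oplus> y) \<ominus> x \<in> ball (deg y - 1)"
      by (rule ball_minus[OF ball_mono[OF assms(6)] ball_mono[OF ball_deg[OF assms(1)]]]) (use n True in auto)
    then show False using e(1) assms(4) by (auto simp: ball_def)
  next
    case False
    have "(x \<oplus> y) \<ominus> y \<in> ball (deg x - 1)"
      by (rule ball_minus[OF ball_mono[OF assms(6)] ball_mono[OF ball_deg[OF assms(2)]]]) (use n False assms(5) in auto)
    then show False using e(2) assms(3) by (auto simp: ball_def)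
  qed
qed

text \<open>The products \<open>u t\<^sup>j\<close> with \<open>j < e\<close> form a basis to leading order: for different \<open>j\<close> their
  degrees differ modulo the degrees of central elements.\<close>

lemma dimension_eq_ramification_inertia:
  assumes dim: "dimension n Z (carrier D)"
    and us: "orth us" "set us \<subseteq> ball 0" "\<forall>u \<in> set us. deg u = 0"
      "residue_Span (map res us) = carrier residue_field"
    and t: "t \<in> carrier D" "t \<noteq> \<zero>" "\<And>x. x \<in> carrier D \<Longrightarrow> x \<noteq> \<zero> \<Longrightarrow> deg t dvd deg x"
    and e: "e > 0" "\<exists>z \<in> Z - {\<zero>}. deg z = int e * deg t"
      "\<And>i. 0 < i \<Longrightarrow> i < e \<Longrightarrow> \<not> (\<exists>z \<in> Z - {\<zero>}. deg z = int i * deg t)"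
  shows "n = e * length us"
proof -
  \<comment> \<open>The value group of the center; the blocks \<open>u t^j\<close> are told apart by
    the classes of their degrees modulo \<open>G\<close>.\<close>
  define G where "G = deg ` (Z - {\<zero>})"
  have G: "0 \<in> G" "\<And>a b. a \<in> G \<Longrightarrow> b \<in> G \<Longrightarrow> a - b \<in> G"
  proof -
    have "\<one> \<in> Z - {\<zero>}" using subringE(3)[OF center_subring] one_not_zero by blast
    then show "0 \<in> G" unfolding G_def using deg_one by (intro image_eqI[of _ _ \<one>]) auto
    fix a b assume "a \<in> G" "b \<in> G"
    then obtain x y where xy: "x \<in> Z" "x \<noteq> \<zero>" "y \<in> Z" "y \<noteq> \<zero>" "a = deg x" "b = deg y" unfolding G_def by auto
    have c: "x \<in> carrier D" "y \<in> carrier D" using xy(1,3) center_carrier by blast+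
    have i: "inv y \<in> Z" "inv y \<in> carrier D" "inv y \<noteq> \<zero>" "deg (inv y) = - deg y"
      using center_inv[OF xy(3,4)] inv_props[OF c(2) xy(4)] deg_inv[OF c(2) xy(4)] by blast+
    have "x \<otimes> inv y \<in> Z - {\<zero>}"
      using subringE(6)[OF center_subring xy(1) i(1)] mult_nonzero[OF c(1) i(2) xy(2) i(3)] by blast
    moreover have "a - b = deg (x \<otimes> inv y)" using deg_mult[of x "inv y"] xy c i by simp
    ultimately show "a - b \<in> G" unfolding G_def by (intro image_eqI)
  qed
  have usc: "set us \<subseteq> carrier D" using us(2) ball_carrier by blast
  have tp: "t [^] j \<in> carrier D" "t [^] j \<noteq> \<zero>" "deg (t [^] j) = int j * deg t" for j :: nat
    using t(1) pow_nonzero[OF t(1,2)] deg_pow[OF t(1,2)] by simp_all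
  define os where "os j = map (\<lambda>u. u \<otimes> t [^] j) us" for j :: nat
  have os: "orth (os j)" "Span Z (os j) = (\<lambda>y. y \<otimes> t [^] j) ` Span Z us" for j
    using orth_map_mult[OF us(1) tp(1,2)] by (auto simp: os_def)
  have osdeg: "deg x - int j * deg t \<in> G" if x: "x \<in> Span Z (os j)" "x \<noteq> \<zero>" for x j
  proof -
    obtain z a where za: "z \<in> Z - {\<zero>}" "a \<in> set (os j)" "deg x = deg z + deg a"
      using orth_Span_deg[OF os(1) x] by blast
    obtain u where u: "u \<in> set us" "a = u \<otimes> t [^] j" using za(2) by (auto simp: os_def)
    have "u \<noteq> \<zero>" using orth_nonzero[OF us(1)] u(1) by blast
    then have "deg a = int j * deg t" unfolding u(2) using deg_mult[of u "t [^] j"] tp[of j] u(1) usc us(3) by auto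
    then have "deg x - int j * deg t = deg z" using za(3) by simp
    then show ?thesis using za(1) unfolding G_def by (intro image_eqI)
  qed
  \<comment> \<open>A degree belonging to two blocks would put \<open>(j - i) deg t\<close> into
    \<open>G\<close>, against the minimality of \<open>e\<close>.\<close>
  have distinct: False if "i < j" "j < e" "d - int i * deg t \<in> G" "d - int j * deg t \<in> G" for i j d
  proof -
    have "int (j - i) * deg t \<in> G" using G(2)[OF that(3,4)] that(1) by (simp add: algebra_simps of_nat_diff)
    then obtain z where "z \<in> Z - {\<zero>}" "deg z = int (j - i) * deg t" unfolding G_def by fastforce
    then show False using e(3)[of "j - i"] \<open>i < j\<close> \<open>j < e\<close> by auto
  qed
  define bs where "bs m = concat (map os [0..<m])" for m
  have bs: "orth (bs m) \<and> (\<forall>x \<in> Span Z (bs m). x \<noteq> \<zero> \<longrightarrow> (\<exists>i < m. deg x - int i * deg t \<in> G))" if "m \<le> e" for m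
    using that
  proof (induction m)
    case 0 then show ?case by (simp add: bs_def Span_Nil)
  next
    case (Suc m)
    have IH: "orth (bs m)" "\<And>x. x \<in> Span Z (bs m) \<Longrightarrow> x \<noteq> \<zero> \<Longrightarrow> \<exists>i < m. deg x - int i * deg t \<in> G"
      using Suc by auto
    have eq: "bs (Suc m) = bs m @ os m" by (simp add: bs_def)
    have o: "orth (bs (Suc m))" unfolding eq
    proof (rule orth_append[OF IH(1) os(1)])
      fix n x y assume xy: "x \<in> Span Z (bs m)" "y \<in> Span Z (os m)" "x \<oplus> y \<in> ball n"
      have c: "x \<in> carrier D" "y \<in> carrier D"
        using Span_carrier[OF orth_carrier[OF IH(1)] xy(1)] Span_carrier[OF orth_carrier[OF os(1)] xy(2)] by auto
      show "y \<in> ball n"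
      proof (cases "x = \<zero> \<or> y = \<zero>")
        case True then show ?thesis using xy(3) c by auto
      next
        case False
        then obtain i where i: "i < m" "deg x - int i * deg t \<in> G" using IH(2)[OF xy(1)] by blast
        have "deg x \<noteq> deg y" using distinct[OF i(1) _ i(2)] osdeg[OF xy(2)] False Suc.prems by auto
        then show ?thesis using sum_distinct_deg[OF c _ _ _ xy(3)] False by blast
      qed
    qed
    have "\<exists>i < Suc m. deg x - int i * deg t \<in> G" if x: "x \<in> Span Z (bs (Suc m))" "x \<noteq> \<zero>" for x
    proof -
      obtain z a where za: "z \<in> Z - {\<zero>}" "a \<in> set (bs (Suc m))" "deg x = deg z + deg a"
        using orth_Span_deg[OF o x] by blast
      obtain i where i: "i < Suc m" "a \<in> set (os i)" using za(2) by (auto simp: bs_def simp del: upt_Suc)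
      obtain u where u: "i < Suc m" "u \<in> set us" "a = u \<otimes> t [^] i" using i by (auto simp: os_def)
      have "u \<noteq> \<zero>" using orth_nonzero[OF us(1)] u(2) by blast
      then have "deg a = int i * deg t" unfolding u(3) using deg_mult[of u "t [^] i"] tp[of i] u(2) usc us(3) by auto
      then have "deg x - int i * deg t = deg z" using za(3) by simp
      then have "deg x - int i * deg t \<in> G" using za(1) unfolding G_def by (intro image_eqI)
      then show ?thesis using u(1) by blast
    qed
    then show ?case using o by blast
  qed
  define B where "B = bs e"
  have B: "orth B" using bs[of e] by (simp add: B_def)
  have len: "length B = e * length us"
    by (simp add: B_def bs_def length_concat os_def comp_def sum_list_triv)
  have "Span Z B = carrier D"
  proof (rule approximating_spans[OF orth_independent[OF B]])
    fix x assume x: "x \<in> carrier D" "x \<noteq> \<zero>"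
    \<comment> \<open>Dividing \<open>i\<close> by \<open>e\<close> splits the degree of
      \<open>x\<close> into a part realized by a central \<open>z\<close> and a remainder
      \<open>j < e\<close> realized by \<open>t^j\<close>. Stripping both leaves \<open>x'\<close>
      of degree 0, which is approximated through its residue.\<close>
    obtain i where i: "deg x = i * deg t" using t(3)[OF x] by (metis dvdE mult.commute)
    define j where "j = nat (i mod int e)"
    have j: "int j = i mod int e" "j < e" using e(1) by (auto simp: j_def nat_less_iff)
    have eG: "int e * deg t \<in> G" using e(2) unfolding G_def by (metis image_eqI)
    have "(i div int e) * (int e * deg t) \<in> G" by (rule int_subgroup_mult[OF G eG])
    then obtain z where "z \<in> Z - {\<zero>}" "(i div int e) * (int e * deg t) = deg z" unfolding G_def by blast
    then have z: "z \<in> Z" "z \<noteq> \<zero>" "deg z = (i div int e) * (int e * deg t)" by auto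
    have ij: "i = (i div int e) * int e + int j" unfolding j(1) by simp
    have "deg x = ((i div int e) * int e + int j) * deg t" unfolding i using ij by presburger
    then have dx: "deg x = deg z + int j * deg t" unfolding z(3) by (simp only: distrib_right mult.assoc)
    have zc: "z \<in> carrier D" using z center_carrier by blast
    note iz = inv_props[OF zc z(2)] and it = inv_props[OF tp(1,2)[of j]]
    define x' where "x' = inv z \<otimes> x \<otimes> inv (t [^] j)"
    have x': "x' \<in> carrier D" "x' \<noteq> \<zero>" using iz it x mult_nonzero by (auto simp: x'_def)
    have "deg x' = deg (inv z) + deg x + deg (inv (t [^] j))"
      unfolding x'_def using deg_mult[of "inv z" x] deg_mult[of "inv z \<otimes> x"] mult_nonzero[of "inv z" x] iz it x by simp
    then have "deg x' = 0" using deg_inv[OF zc z(2)] deg_inv[OF tp(1,2)[of j]] tp(3)[of j] dx by simp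
    then have x'b: "x' \<in> ball 0" using x' by (simp add: ball_def)
    obtain y where y: "y \<in> Span Z us" "y \<in> ball 0" "res x' = res y"
      using residue_Span_lift[OF us(2), of "res x'"] us(4) res_closed[OF x'b] by auto
    have yc: "y \<in> carrier D" using y ball_carrier by blast
    have "x' \<ominus> y \<in> ball (-1)" using res_eq_iff[OF x'b y(2)] y(3) by simp
    then have b: "z \<otimes> (x' \<ominus> y) \<otimes> t [^] j \<in> ball (deg z + (-1) + deg (t [^] j))"
      by (intro ball_mult ball_deg zc tp)
    have "z \<otimes> x' \<otimes> t [^] j = (z \<otimes> inv z) \<otimes> x \<otimes> (inv (t [^] j) \<otimes> t [^] j)"
      unfolding x'_def using iz(1) it(1) zc x tp(1)[of j] by (simp add: m_assoc)
    then have xe: "z \<otimes> x' \<otimes> t [^] j = x" using iz it x by simp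
    have "z \<otimes> (x' \<ominus> y) \<otimes> t [^] j = z \<otimes> x' \<otimes> t [^] j \<ominus> z \<otimes> (y \<otimes> t [^] j)"
      using zc x' yc tp(1)[of j] by algebra
    then have "x \<ominus> z \<otimes> (y \<otimes> t [^] j) \<in> ball (deg x - 1)" using b xe dx tp(3)[of j] by (simp add: algebra_simps)
    moreover have "z \<otimes> (y \<otimes> t [^] j) \<in> Span Z B"
    proof (rule Span_smult[OF orth_carrier[OF B] z(1)])
      have "y \<otimes> t [^] j \<in> Span Z (os j)" using os(2) y(1) by blast
      moreover have "set (os j) \<subseteq> set B" using j(2) by (auto simp: B_def bs_def)
      ultimately show "y \<otimes> t [^] j \<in> Span Z B"
        using mono_Span_sublist[OF center_subfield _ orth_carrier[OF B]] by blast
    qed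
    ultimately show "\<exists>y\<in>Span Z B. x \<ominus> y \<in> ball (deg x - 1)" by blast
  qed
  then have "dimension (length B) Z (carrier D)"
    using dimensionI[OF center_subfield orth_independent[OF B]] by blast
  then show ?thesis using dimension_is_inj[OF center_subfield dim] len by simp
qed

text \<open>The same exponent \<open>N\<close> is used for both factors of \<open>e f\<close>: the
  central element near \<open>t^(p^N)\<close> makes \<open>e\<close> divide \<open>p^N\<close>, and
  the central elements near the \<open>p^N\<close>-th powers of elements of degree 0 make the
  residue extension purely inseparable.\<close>

theorem dimension_prime_power:
  assumes dim: "dimension n Z (carrier D)" and p: "Factorial_Ring.prime (p :: nat)" "[p] \<cdot> \<one> = \<zero>"
  shows "\<exists>k. n = p ^ k"
proof -
  interpret k: field residue_field by (rule residue_field_field)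
  have ppos: "p > 0" using prime_gt_0_nat[OF p(1)] .
  obtain N where N: "\<And>x. x \<in> carrier D - {\<zero>} \<Longrightarrow> \<exists>z \<in> Z. x [^] (p ^ N) \<ominus> z \<in> ball (deg (x [^] (p ^ N)) - 1)"
    using power_near_center[OF dim ppos p(2)] by blast
  have Ndeg: "\<exists>z \<in> Z - {\<zero>}. x [^] (p ^ N) \<ominus> z \<in> ball (deg (x [^] (p ^ N)) - 1) \<and> deg z = int (p ^ N) * deg x"
    if x: "x \<in> carrier D" "x \<noteq> \<zero>" for x
  proof -
    obtain z where z: "z \<in> Z" "x [^] (p ^ N) \<ominus> z \<in> ball (deg (x [^] (p ^ N)) - 1)" using N x by blast
    have "z \<noteq> \<zero>" "deg z = deg (x [^] (p ^ N))"
      using deg_approx[OF _ _ center_carrier[OF z(1)] z(2)] pow_nonzero x by auto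
    then show ?thesis using z deg_pow[OF x, of "p ^ N"] by auto
  qed
  \<comment> \<open>Independent residues lift to an orthogonal, hence independent, family over
    \<open>Z\<close>.\<close>
  have "length Us \<le> n" if Us: "k.independent residue_center Us" for Us
  proof -
    have "\<forall>t \<in> set Us. \<exists>x \<in> ball 0. t = res x" using k.independent_in_carrier[OF Us] res_surj by blast
    then obtain l where l: "\<And>t. t \<in> set Us \<Longrightarrow> l t \<in> ball 0 \<and> t = res (l t)" by metis
    have "map res (map l Us) = Us" using l by (auto simp: map_idI)
    then have "orth (map l Us)" using residue_independent_orth[of "map l Us"] Us l by auto
    then show ?thesis
      using independent_length_le_dimension[OF center_subfield dim orth_independent] orth_carrier by fastforce
  qed
  then obtain Us where Us: "k.independent residue_center Us" "k.Span residue_center Us = carrier residue_field"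
    using k.dimension_of_bounded_independent[OF residue_center_subfield] by blast
  have "\<forall>t \<in> set Us. \<exists>x \<in> ball 0. t = res x" using k.independent_in_carrier[OF Us(1)] res_surj by blast
  then obtain l where l: "\<And>t. t \<in> set Us \<Longrightarrow> l t \<in> ball 0 \<and> t = res (l t)" by metis
  define us where "us = map l Us"
  have res_us: "map res us = Us" using l by (auto simp: us_def map_idI)
  have us0: "set us \<subseteq> ball 0" using l by (auto simp: us_def)
  have us: "orth us" "\<forall>u \<in> set us. deg u = 0" using residue_independent_orth[of us] res_us Us(1) us0 by auto
  have kp: "[m] \<cdot>\<^bsub>residue_field\<^esub> \<one>\<^bsub>residue_field\<^esub> = res ([m] \<cdot> \<one>) \<and> [m] \<cdot> \<one> \<in> ball 0" for m :: nat
    by (induction m) (use res_zero res_one res_add ball_add subringE(3)[OF valuation_subring] in auto)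
  have "\<exists>f. length us = p ^ f"
  proof (rule k.purely_inseparable_dimension[OF p(1) _ residue_center_subfield])
    show "[p] \<cdot>\<^bsub>residue_field\<^esub> \<one>\<^bsub>residue_field\<^esub> = \<zero>\<^bsub>residue_field\<^esub>" using kp[of p] p(2) res_zero by simp
    show "k.dimension (length us) residue_center (carrier residue_field)"
      using k.dimensionI[OF residue_center_subfield Us] unfolding us_def by simp
    show "\<forall>a \<in> carrier residue_field. a [^]\<^bsub>residue_field\<^esub> (p ^ N) \<in> residue_center"
    proof
      fix a assume "a \<in> carrier residue_field"
      then obtain x where x: "x \<in> ball 0" "a = res x" using res_surj by blast
      have pw: "x [^] i \<in> ball 0 \<and> a [^]\<^bsub>residue_field\<^esub> i = res (x [^] i)" for i :: nat
        by (induction i) (use x res_one res_mult subringE(3,6)[OF valuation_subring] in auto)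
      show "a [^]\<^bsub>residue_field\<^esub> (p ^ N) \<in> residue_center"
      proof (cases "x \<in> ball (-1)")
        case True
        then have "a = \<zero>\<^bsub>residue_field\<^esub>" using x res_eq_zero_iff by simp
        then have "a [^]\<^bsub>residue_field\<^esub> (p ^ N) = \<zero>\<^bsub>residue_field\<^esub>" using ppos by (simp add: k.nat_pow_zero)
        then show ?thesis using subringE(2)[OF subfieldE(1)[OF residue_center_subfield]] by simp
      next
        case False
        then have x0: "x \<noteq> \<zero>" "deg x = 0" "x \<in> carrier D" using ball_0_not_ball x ball_carrier by auto
        obtain z where z: "z \<in> Z - {\<zero>}" "x [^] (p ^ N) \<ominus> z \<in> ball (deg (x [^] (p ^ N)) - 1)" "deg z = int (p ^ N) * deg x"
          using Ndeg[OF x0(3,1)] by blast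
        have zb: "z \<in> ball 0" using z center_carrier x0 by (simp add: ball_def)
        have "x [^] (p ^ N) \<ominus> z \<in> ball (-1)" using z(2) deg_pow[OF x0(3,1)] x0(2) by simp
        then have "a [^]\<^bsub>residue_field\<^esub> (p ^ N) = res z" using pw[of "p ^ N"] res_eq_iff zb by blast
        then show ?thesis using z(1) zb by (simp add: residue_center_def)
      qed
    qed
  qed
  then obtain f where f: "length us = p ^ f" by blast
  have "\<exists>g \<in> deg ` (carrier D - {\<zero>}). \<forall>x \<in> deg ` (carrier D - {\<zero>}). g dvd x"
  proof (rule int_subgroup_generator)
    show "0 \<in> deg ` (carrier D - {\<zero>})" using deg_one one_not_zero one_closed by (metis Diff_iff image_iff singletonD)
    fix a b assume "a \<in> deg ` (carrier D - {\<zero>})" "b \<in> deg ` (carrier D - {\<zero>})"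
    then obtain x y where xy: "x \<in> carrier D" "x \<noteq> \<zero>" "y \<in> carrier D" "y \<noteq> \<zero>" "a = deg x" "b = deg y" by auto
    note i = inv_props[OF xy(3,4)]
    have "x \<otimes> inv y \<in> carrier D - {\<zero>}" using m_closed[OF xy(1) i(1)] mult_nonzero[OF xy(1) i(1) xy(2) i(2)] by blast
    moreover have "a - b = deg (x \<otimes> inv y)" using deg_mult[of x "inv y"] xy i(1,2) deg_inv[OF xy(3,4)] by simp
    ultimately show "a - b \<in> deg ` (carrier D - {\<zero>})" by (intro image_eqI)
  qed
  then obtain t where t: "t \<in> carrier D" "t \<noteq> \<zero>" "\<And>x. x \<in> carrier D \<Longrightarrow> x \<noteq> \<zero> \<Longrightarrow> deg t dvd deg x" by blast
  \<comment> \<open>If \<open>deg t = 0\<close>, all degrees vanish; then \<open>\<one>\<close>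
    witnesses \<open>P 1\<close> and the ramification index is 1.\<close>
  define P where "P i \<longleftrightarrow> 0 < i \<and> (\<exists>z \<in> Z - {\<zero>}. deg z = int i * deg t)" for i
  have PN: "P (p ^ N)" unfolding P_def using Ndeg[OF t(1,2)] zero_less_power[OF ppos] by blast
  define e where "e = (LEAST i. P i)"
  have Pe: "P e" unfolding e_def using PN by (rule LeastI)
  have least: "\<not> P i" if "i < e" for i using not_less_Least that unfolding e_def by blast
  \<comment> \<open>Otherwise a quotient of central elements realizes the remainder of
    \<open>p^N\<close> modulo \<open>e\<close>, contradicting the minimality of
    \<open>e\<close>.\<close>
  have "e dvd p ^ N"
  proof (rule ccontr)
    assume nd: "\<not> e dvd p ^ N"
    define r where "r = p ^ N mod e"
    have r: "0 < r" "r < e" using nd Pe by (auto simp: r_def P_def dvd_eq_mod_eq_0)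
    obtain z w where z: "z \<in> Z" "z \<noteq> \<zero>" "deg z = int (p ^ N) * deg t" and w: "w \<in> Z" "w \<noteq> \<zero>" "deg w = int e * deg t"
      using PN Pe unfolding P_def by blast
    have wq: "w [^] q \<in> Z" for q :: nat
      by (induction q) (use w subringE(3,6)[OF center_subring] in auto)
    define v where "v = w [^] (p ^ N div e)"
    have v: "v \<in> Z" "v \<in> carrier D" "v \<noteq> \<zero>" "deg v = int (p ^ N div e) * (int e * deg t)"
      using wq center_carrier[OF wq] pow_nonzero[OF center_carrier[OF w(1)] w(2)]
        deg_pow[OF center_carrier[OF w(1)] w(2)] unfolding v_def w(3) by blast+
    have zc: "z \<in> carrier D" using z center_carrier by blast
    have i: "inv v \<in> Z" "inv v \<in> carrier D" "inv v \<noteq> \<zero>" "deg (inv v) = - deg v"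
      using center_inv[OF v(1,3)] inv_props[OF v(2,3)] deg_inv[OF v(2,3)] by blast+
    have "z \<otimes> inv v \<in> Z - {\<zero>}"
      using subringE(6)[OF center_subring z(1) i(1)] mult_nonzero[OF zc i(2) z(2) i(3)] by blast
    moreover have "deg (z \<otimes> inv v) = int r * deg t"
    proof -
      have "int (p ^ N) = int (p ^ N div e) * int e + int r"
        unfolding r_def by (metis div_mult_mod_eq of_nat_add of_nat_mult)
      moreover have "deg (z \<otimes> inv v) = deg z - deg v" using deg_mult[of z "inv v"] zc z(2) i by simp
      ultimately show ?thesis unfolding z(3) v(4) by (simp add: algebra_simps)
    qed
    ultimately have "P r" using r(1) unfolding P_def by blast
    then show False using least r(2) by blast
  qed
  then obtain g where g: "e = p ^ g" using divides_primepow_nat[OF p(1)] by blast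
  have "n = e * length us"
  proof (rule dimension_eq_ramification_inertia[OF dim us(1) us0 us(2) _ t])
    show "residue_Span (map res us) = carrier residue_field" using Us(2) res_us by simp
    show "e > 0" "\<exists>z \<in> Z - {\<zero>}. deg z = int e * deg t" using Pe by (auto simp: P_def)
    show "\<not> (\<exists>z \<in> Z - {\<zero>}. deg z = int i * deg t)" if "0 < i" "i < e" for i using least[OF that(2)] that(1) by (simp add: P_def)
  qed
  then show ?thesis using f g by (metis power_add)
qed

end

section \<open>Extending a degree function to fractions\<close>

text \<open>\<open>S\<close> stands for the image of \<open>A\<close> in its quotient division ring
  and \<open>g\<close> for the transported degree, so that fractions are handled inside the single
  ring \<open>D\<close>.\<close>

locale fraction_degree = skew_field D for D (structure) +
  fixes S :: "'a set" and g :: "'a \<Rightarrow> int"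
  assumes S: "subring S D"
    and right_fraction: "x \<in> carrier D \<Longrightarrow> \<exists>a \<in> S. \<exists>s \<in> S - {\<zero>}. x = a \<otimes> inv s"
    and g_mult: "\<lbrakk> x \<in> S - {\<zero>}; y \<in> S - {\<zero>} \<rbrakk> \<Longrightarrow> g (x \<otimes> y) = g x + g y"
    and g_add: "\<lbrakk> x \<in> S - {\<zero>}; y \<in> S - {\<zero>}; x \<oplus> y \<noteq> \<zero> \<rbrakk> \<Longrightarrow> g (x \<oplus> y) \<le> max (g x) (g y)"
    and g_commutator: "\<lbrakk> x \<in> S - {\<zero>}; y \<in> S - {\<zero>}; x \<otimes> y \<ominus> y \<otimes> x \<noteq> \<zero> \<rbrakk> \<Longrightarrow>
      g (x \<otimes> y \<ominus> y \<otimes> x) < g x + g y"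
begin

lemmas Sr = subringE[OF S]

lemma Sc: "x \<in> S \<Longrightarrow> x \<in> carrier D" using Sr(1) by blast

text \<open>The Ore condition is read off from a right fraction for
  \<open>inv s \<otimes> b\<close>. It supplies common denominators and moves an inverse past a
  numerator.\<close>

lemma ore:
  assumes s: "s \<in> S" "s \<noteq> \<zero>" and b: "b \<in> S"
  shows "\<exists>c \<in> S. \<exists>u \<in> S - {\<zero>}. inv s \<otimes> b = c \<otimes> inv u \<and> b \<otimes> u = s \<otimes> c"
proof -
  note i = inv_props[OF Sc[OF s(1)] s(2)]
  obtain c u where cu: "c \<in> S" "u \<in> S - {\<zero>}" "inv s \<otimes> b = c \<otimes> inv u"
    using right_fraction[of "inv s \<otimes> b"] i Sc[OF b] by blast
  have u: "u \<in> carrier D" "u \<noteq> \<zero>" using cu Sc by auto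
  have c: "c \<in> carrier D" using cu Sc by blast
  have "s \<otimes> (inv s \<otimes> b) \<otimes> u = s \<otimes> (c \<otimes> inv u) \<otimes> u" using cu(3) by simp
  moreover have "s \<otimes> (inv s \<otimes> b) \<otimes> u = (s \<otimes> inv s) \<otimes> b \<otimes> u"
    using i(1) Sc[OF s(1)] Sc[OF b] u by (simp add: m_assoc[symmetric])
  moreover have "s \<otimes> (c \<otimes> inv u) \<otimes> u = s \<otimes> c \<otimes> (inv u \<otimes> u)"
    using inv_props(1)[OF u] Sc[OF s(1)] c u by (simp add: m_assoc)
  ultimately have "b \<otimes> u = s \<otimes> c" using i(4) inv_props(3)[OF u] Sc[OF s(1)] Sc[OF b] c by simp
  then show ?thesis using cu by blast
qed

text \<open>With the common multiple \<open>t u = s d\<close>, equality of the fractions becomes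
  \<open>a d = b u\<close>, and the degrees of these two equations are subtracted.\<close>

lemma fraction_degree_unique:
  assumes a: "a \<in> S - {\<zero>}" and s: "s \<in> S - {\<zero>}" and b: "b \<in> S - {\<zero>}" and t: "t \<in> S - {\<zero>}"
    and eq: "a \<otimes> inv s = b \<otimes> inv t"
  shows "g a - g s = g b - g t"
proof -
  have c: "a \<in> carrier D" "s \<in> carrier D" "b \<in> carrier D" "t \<in> carrier D"
    and n: "a \<noteq> \<zero>" "s \<noteq> \<zero>" "b \<noteq> \<zero>" "t \<noteq> \<zero>" using assms Sc by auto
  note js = inv_props[OF c(2) n(2)] and it = inv_props[OF c(4) n(4)]
  obtain d u where du: "d \<in> S" "u \<in> S - {\<zero>}" "t \<otimes> u = s \<otimes> d" using ore[of s t] s t by blast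
  have uc: "u \<in> carrier D" "u \<noteq> \<zero>" "d \<in> carrier D" using du Sc by auto
  have "t \<otimes> u \<noteq> \<zero>" using mult_nonzero c n uc by blast
  then have d0: "d \<noteq> \<zero>" using du(3) c by auto
  have "a \<otimes> d = a \<otimes> (inv s \<otimes> s) \<otimes> d" using js c by simp
  also have "\<dots> = (a \<otimes> inv s) \<otimes> (s \<otimes> d)" using js(1) c uc by (simp add: m_assoc)
  also have "\<dots> = (b \<otimes> inv t) \<otimes> (t \<otimes> u)" using eq du(3) by simp
  also have "\<dots> = b \<otimes> (inv t \<otimes> t) \<otimes> u" using it(1) c uc by (simp add: m_assoc)
  also have "\<dots> = b \<otimes> u" using it c by simp
  finally have "g a + g d = g b + g u" using g_mult[of a d] g_mult[of b u] a b du d0 by auto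
  moreover have "g t + g u = g s + g d" using g_mult[of t u] g_mult[of s d] s t du d0 by auto
  ultimately show ?thesis by simp
qed

text \<open>Any representation may be chosen by \<open>fraction_degree_unique\<close>. At
  \<open>\<zero>\<close> there is none with a nonzero numerator, so the value there is
  arbitrary.\<close>

definition frac_deg :: "'a \<Rightarrow> int"
  where "frac_deg x = (SOME v. \<exists>a \<in> S - {\<zero>}. \<exists>s \<in> S - {\<zero>}. x = a \<otimes> inv s \<and> v = g a - g s)"

lemma frac_deg_eq:
  assumes a: "a \<in> S - {\<zero>}" and s: "s \<in> S - {\<zero>}"
  shows "frac_deg (a \<otimes> inv s) = g a - g s"
  unfolding frac_deg_def
proof (rule some_equality)
  show "\<exists>b\<in>S - {\<zero>}. \<exists>t\<in>S - {\<zero>}. a \<otimes> inv s = b \<otimes> inv t \<and> g a - g s = g b - g t" using a s by blast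
qed (use fraction_degree_unique[OF a s] in auto)

lemma fraction_cases:
  assumes "x \<in> carrier D - {\<zero>}"
  obtains a s where "a \<in> S - {\<zero>}" "s \<in> S - {\<zero>}" "x = a \<otimes> inv s"
proof -
  obtain a s where as: "a \<in> S" "s \<in> S - {\<zero>}" "x = a \<otimes> inv s" using right_fraction assms by blast
  then have "a \<noteq> \<zero>" using assms inv_props(1)[of s] Sc by auto
  then show ?thesis using that as by blast
qed

lemma frac_deg_mult:
  assumes x: "x \<in> carrier D - {\<zero>}" and y: "y \<in> carrier D - {\<zero>}"
  shows "frac_deg (x \<otimes> y) = frac_deg x + frac_deg y"
proof -
  obtain a s where as: "a \<in> S - {\<zero>}" "s \<in> S - {\<zero>}" "x = a \<otimes> inv s" using fraction_cases[OF x] .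
  obtain b t where bt: "b \<in> S - {\<zero>}" "t \<in> S - {\<zero>}" "y = b \<otimes> inv t" using fraction_cases[OF y] .
  have c: "a \<in> carrier D" "s \<in> carrier D" "b \<in> carrier D" "t \<in> carrier D"
    and n: "a \<noteq> \<zero>" "s \<noteq> \<zero>" "b \<noteq> \<zero>" "t \<noteq> \<zero>" using as bt Sc by auto
  note js = inv_props[OF c(2) n(2)] and it = inv_props[OF c(4) n(4)]
  obtain d u where du: "d \<in> S" "u \<in> S - {\<zero>}" "inv s \<otimes> b = d \<otimes> inv u" "b \<otimes> u = s \<otimes> d"
    using ore[of s b] as bt by blast
  have uc: "u \<in> carrier D" "u \<noteq> \<zero>" "d \<in> carrier D" using du Sc by auto
  note iu = inv_props[OF uc(1,2)]
  have "b \<otimes> u \<noteq> \<zero>" using mult_nonzero c n uc by blast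
  then have d0: "d \<noteq> \<zero>" using du(4) c by auto
  have ad: "a \<otimes> d \<in> S - {\<zero>}" "t \<otimes> u \<in> S - {\<zero>}"
    using Sr(6) mult_nonzero as bt du d0 c n uc by auto
  have "x \<otimes> y = a \<otimes> (inv s \<otimes> b) \<otimes> inv t" using as bt js(1) it(1) c by (simp add: m_assoc)
  also have "\<dots> = (a \<otimes> d) \<otimes> (inv u \<otimes> inv t)" unfolding du(3) using it(1) iu(1) c uc by (simp add: m_assoc)
  also have "\<dots> = (a \<otimes> d) \<otimes> inv (t \<otimes> u)" using inv_prod[OF c(4) n(4) uc(1,2)] by simp
  finally have "frac_deg (x \<otimes> y) = g (a \<otimes> d) - g (t \<otimes> u)" using frac_deg_eq[OF ad] by simp
  moreover have "g (a \<otimes> d) = g a + g d" "g (t \<otimes> u) = g t + g u" "g b + g u = g s + g d"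
    using g_mult[of a d] g_mult[of t u] g_mult[of b u] g_mult[of s d] as bt du d0 by auto
  ultimately show ?thesis using frac_deg_eq[OF as(1,2)] frac_deg_eq[OF bt(1,2)] as(3) bt(3) by simp
qed

lemma frac_deg_add:
  assumes x: "x \<in> carrier D - {\<zero>}" and y: "y \<in> carrier D - {\<zero>}" and xy: "x \<oplus> y \<noteq> \<zero>"
  shows "frac_deg (x \<oplus> y) \<le> max (frac_deg x) (frac_deg y)"
proof -
  obtain a s where as: "a \<in> S - {\<zero>}" "s \<in> S - {\<zero>}" "x = a \<otimes> inv s" using fraction_cases[OF x] .
  obtain b t where bt: "b \<in> S - {\<zero>}" "t \<in> S - {\<zero>}" "y = b \<otimes> inv t" using fraction_cases[OF y] .
  have c: "a \<in> carrier D" "s \<in> carrier D" "b \<in> carrier D" "t \<in> carrier D"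
    and n: "a \<noteq> \<zero>" "s \<noteq> \<zero>" "b \<noteq> \<zero>" "t \<noteq> \<zero>" using as bt Sc by auto
  note js = inv_props[OF c(2) n(2)] and it = inv_props[OF c(4) n(4)]
  obtain d u where du: "d \<in> S" "u \<in> S - {\<zero>}" "t \<otimes> u = s \<otimes> d" using ore[of s t] as bt by blast
  have uc: "u \<in> carrier D" "u \<noteq> \<zero>" "d \<in> carrier D" using du Sc by auto
  have w0: "t \<otimes> u \<noteq> \<zero>" using mult_nonzero c n uc by blast
  then have d0: "d \<noteq> \<zero>" using du(3) c by auto
  note iu = inv_props[OF uc(1,2)] and jd = inv_props[OF uc(3) d0]
  define w where "w = t \<otimes> u"
  have w: "w \<in> S - {\<zero>}" using Sr(6)[of t u] bt(2) du(2) w0 unfolding w_def by blast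
  have wc: "w \<in> carrier D" "w \<noteq> \<zero>" using w Sc by auto
  note iw = inv_props[OF wc]
  have ad: "a \<otimes> d \<in> S - {\<zero>}" "b \<otimes> u \<in> S - {\<zero>}" using Sr(6) mult_nonzero as bt du d0 c n uc by auto
  have "(a \<otimes> d) \<otimes> inv w = a \<otimes> (d \<otimes> inv d) \<otimes> inv s"
    unfolding w_def du(3) inv_prod[OF c(2) n(2) uc(3) d0] using c uc jd(1) js(1) by (simp add: m_assoc)
  then have xw: "x = (a \<otimes> d) \<otimes> inv w" using as jd c by simp
  have "(b \<otimes> u) \<otimes> inv w = b \<otimes> (u \<otimes> inv u) \<otimes> inv t"
    unfolding w_def inv_prod[OF c(4) n(4) uc(1,2)] using c uc iu(1) it(1) by (simp add: m_assoc)
  then have yw: "y = (b \<otimes> u) \<otimes> inv w" using bt iu c by simp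
  have sum: "x \<oplus> y = (a \<otimes> d \<oplus> b \<otimes> u) \<otimes> inv w" unfolding xw yw using c uc iw(1) by (simp add: l_distr)
  have nz: "a \<otimes> d \<oplus> b \<otimes> u \<noteq> \<zero>" using xy iw(1) unfolding sum by auto
  have "a \<otimes> d \<oplus> b \<otimes> u \<in> S - {\<zero>}" using nz ad Sr(7) by auto
  then have "frac_deg (x \<oplus> y) = g (a \<otimes> d \<oplus> b \<otimes> u) - g w" using frac_deg_eq[OF _ w] sum by simp
  moreover have "frac_deg x = g (a \<otimes> d) - g w" "frac_deg y = g (b \<otimes> u) - g w"
    using frac_deg_eq[OF ad(1) w] frac_deg_eq[OF ad(2) w] xw yw by auto
  ultimately show ?thesis using g_add[OF ad nz] by simp
qed

sublocale valued_division_ring D frac_deg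
  by unfold_locales (use one_not_zero Units_eq frac_deg_mult frac_deg_add in auto)

lemma frac_deg_extends: "a \<in> S - {\<zero>} \<Longrightarrow> frac_deg a = g a"
  using frac_deg_eq[of a \<one>] g_mult[of \<one> \<one>] one_not_zero Sr(3) Sc by auto

text \<open>Commuting to leading order is inherited by inverses and products, hence passes from the
  subring to all fractions.\<close>

definition almost_commute :: "'a \<Rightarrow> 'a \<Rightarrow> bool"
  where "almost_commute x y \<longleftrightarrow> x \<otimes> y \<ominus> y \<otimes> x \<in> ball (frac_deg x + frac_deg y - 1)"

lemma almost_commute_sym:
  assumes "x \<in> carrier D" "y \<in> carrier D" "almost_commute x y"
  shows "almost_commute y x"
proof -
  have "y \<otimes> x \<ominus> x \<otimes> y = \<ominus> (x \<otimes> y \<ominus> y \<otimes> x)" using assms(1,2) by algebra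
  then show ?thesis using assms(3) ball_uminus unfolding almost_commute_def by (simp add: add.commute)
qed

lemma almost_commute_inv:
  assumes x: "x \<in> carrier D" "x \<noteq> \<zero>" and y: "y \<in> carrier D" and xy: "almost_commute x y"
  shows "almost_commute (inv x) y"
proof -
  note i = inv_props[OF x]
  have "inv x \<otimes> (x \<otimes> y \<ominus> y \<otimes> x) \<otimes> inv x = (inv x \<otimes> x) \<otimes> y \<otimes> inv x \<ominus> inv x \<otimes> y \<otimes> (x \<otimes> inv x)"
    using i(1) x(1) y by algebra
  also have "\<dots> = y \<otimes> inv x \<ominus> inv x \<otimes> y" using i y by simp
  finally have e: "inv x \<otimes> (x \<otimes> y \<ominus> y \<otimes> x) \<otimes> inv x = y \<otimes> inv x \<ominus> inv x \<otimes> y" .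
  have "inv x \<otimes> (x \<otimes> y \<ominus> y \<otimes> x) \<otimes> inv x
      \<in> ball (frac_deg (inv x) + (frac_deg x + frac_deg y - 1) + frac_deg (inv x))"
    using xy i unfolding almost_commute_def by (intro ball_mult ball_deg)
  then have "almost_commute y (inv x)" unfolding e almost_commute_def using deg_inv[OF x] by (simp add: algebra_simps)
  then show ?thesis using almost_commute_sym y i by blast
qed

lemma almost_commute_mult:
  assumes x: "x \<in> carrier D" "x \<noteq> \<zero>" and y: "y \<in> carrier D" "y \<noteq> \<zero>" and z: "z \<in> carrier D"
    and xz: "almost_commute x z" and yz: "almost_commute y z"
  shows "almost_commute (x \<otimes> y) z"
proof -
  have e: "x \<otimes> y \<otimes> z \<ominus> z \<otimes> (x \<otimes> y) = x \<otimes> (y \<otimes> z \<ominus> z \<otimes> y) \<oplus> (x \<otimes> z \<ominus> z \<otimes> x) \<otimes> y"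
    using x(1) y(1) z by algebra
  have "x \<otimes> (y \<otimes> z \<ominus> z \<otimes> y) \<in> ball (frac_deg x + (frac_deg y + frac_deg z - 1))"
    using x yz unfolding almost_commute_def by (intro ball_mult ball_deg)
  moreover have "(x \<otimes> z \<ominus> z \<otimes> x) \<otimes> y \<in> ball ((frac_deg x + frac_deg z - 1) + frac_deg y)"
    using y xz unfolding almost_commute_def by (intro ball_mult ball_deg)
  moreover have "frac_deg (x \<otimes> y) = frac_deg x + frac_deg y" using frac_deg_mult x y by simp
  ultimately show ?thesis unfolding almost_commute_def e
    by (intro ball_add) (auto elim!: ball_mono)
qed

lemma almost_commute_all:
  assumes x: "x \<in> carrier D - {\<zero>}" and y: "y \<in> carrier D - {\<zero>}"
  shows "almost_commute x y"
proof -
  have base: "almost_commute a b" if a: "a \<in> S - {\<zero>}" and b: "b \<in> S - {\<zero>}" for a b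
  proof (cases "a \<otimes> b \<ominus> b \<otimes> a = \<zero>")
    case True then show ?thesis by (simp add: almost_commute_def)
  next
    case False
    have c: "a \<otimes> b \<ominus> b \<otimes> a \<in> S - {\<zero>}" using False Sr(5,6,7) a b by (simp add: a_minus_def)
    show ?thesis
      unfolding almost_commute_def using g_commutator[OF a b False] frac_deg_extends[OF a]
        frac_deg_extends[OF b] frac_deg_extends[OF c] c Sc by (auto simp: ball_def)
  qed
  have S': "a \<in> carrier D \<and> a \<noteq> \<zero>" if "a \<in> S - {\<zero>}" for a using that Sc by blast
  \<comment> \<open>Used twice: for \<open>b\<close> in \<open>S\<close> it extends the first
    argument from \<open>S\<close> to \<open>D\<close>; after exchanging the arguments, with
    \<open>b = x\<close>, it extends the other one.\<close>
  have frac: "almost_commute z b"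
    if h: "z \<in> carrier D - {\<zero>}" "b \<in> carrier D" "\<And>a. a \<in> S - {\<zero>} \<Longrightarrow> almost_commute a b" for z b
  proof -
    obtain a s where as: "a \<in> S - {\<zero>}" "s \<in> S - {\<zero>}" "z = a \<otimes> inv s" using fraction_cases[OF h(1)] .
    have "almost_commute (inv s) b" using almost_commute_inv[of s b] S'[OF as(2)] h(2,3) as(2) by blast
    then show ?thesis unfolding as(3)
      using almost_commute_mult[of a "inv s" b] S'[OF as(1)] inv_props(1,2)[of s] S'[OF as(2)] h(2,3) as(1) by blast
  qed
  have "almost_commute x b" if b: "b \<in> S - {\<zero>}" for b using frac[OF x] base b S' by blast
  then have "almost_commute b x" if b: "b \<in> S - {\<zero>}" for b using almost_commute_sym b S' x by blast
  then have "almost_commute y x" using frac[OF y] x by blast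
  then show ?thesis using almost_commute_sym x y by blast
qed

sublocale almost_commutative_division_ring D frac_deg
proof
  fix x y assume xy: "x \<in> carrier D - {\<zero>}" "y \<in> carrier D - {\<zero>}" "x \<otimes> y \<ominus> y \<otimes> x \<noteq> \<zero>"
  then show "frac_deg (x \<otimes> y \<ominus> y \<otimes> x) < frac_deg x + frac_deg y"
    using almost_commute_all[OF xy(1,2)] unfolding almost_commute_def by (auto simp: ball_def)
qed

end

section \<open>The degree function of a filtered ring\<close>

locale filtered_ring = ring A for A :: "('f, 'b) module" (structure) +
  fixes Fil :: "nat \<Rightarrow> 'b set"
  assumes Fil_subgroup: "subgroup (Fil i) (add_monoid A)"
    and Fil_Suc: "Fil i \<subseteq> Fil (Suc i)"
    and Fil_one: "\<one> \<in> Fil 0"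
    and Fil_mult: "\<lbrakk> x \<in> Fil i; y \<in> Fil j \<rbrakk> \<Longrightarrow> x \<otimes> y \<in> Fil (i + j)"
    and Fil_exhaustive: "(\<Union>i. Fil i) = carrier A"
begin

abbreviation prev :: "nat \<Rightarrow> 'b set" where "prev \<equiv> Fil_prev A Fil"

lemma Fil_carrier: "x \<in> Fil i \<Longrightarrow> x \<in> carrier A"
  using Fil_exhaustive by blast

lemma Fil_mono: "i \<le> j \<Longrightarrow> x \<in> Fil i \<Longrightarrow> x \<in> Fil j"
  using lift_Suc_mono_le[of Fil i j] Fil_Suc by blast

lemma Fil_closed:
  shows "\<zero> \<in> Fil i" "x \<in> Fil i \<Longrightarrow> y \<in> Fil i \<Longrightarrow> x \<oplus> y \<in> Fil i" "x \<in> Fil i \<Longrightarrow> \<ominus> x \<in> Fil i"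
  using subgroup.one_closed[OF Fil_subgroup[of i]] subgroup.m_closed[OF Fil_subgroup[of i], of x y]
    subgroup.m_inv_closed[OF Fil_subgroup[of i], of x] by (auto simp: a_inv_def)

lemma prev_0: "prev 0 = {\<zero>}" and prev_Suc: "prev (Suc n) = Fil n"
  by (simp_all add: Fil_prev_def)

lemma prev_Fil: "x \<in> prev n \<Longrightarrow> x \<in> Fil n"
  using Fil_closed(1) Fil_Suc by (cases n) (auto simp: prev_0 prev_Suc)

lemma prev_closed:
  shows "\<zero> \<in> prev i" "x \<in> prev i \<Longrightarrow> y \<in> prev i \<Longrightarrow> x \<oplus> y \<in> prev i" "x \<in> prev i \<Longrightarrow> \<ominus> x \<in> prev i"
  using Fil_closed by (cases i; auto simp: prev_0 prev_Suc)+

lemma prev_mult_left: "x \<in> prev i \<Longrightarrow> y \<in> Fil j \<Longrightarrow> x \<otimes> y \<in> prev (i + j)"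
  using Fil_mult Fil_carrier prev_closed(1) by (cases i) (auto simp: prev_0 prev_Suc)

lemma prev_mult_right: "x \<in> Fil i \<Longrightarrow> y \<in> prev j \<Longrightarrow> x \<otimes> y \<in> prev (i + j)"
  using Fil_mult Fil_carrier prev_closed(1) by (cases j) (auto simp: prev_0 prev_Suc)

section \<open>Cosets, graded pieces and their products\<close>

lemma coset_mem: "a \<in> prev n +> x \<longleftrightarrow> (\<exists>h \<in> prev n. a = h \<oplus> x)"
  by (simp add: a_r_coset_def')

lemma coset_eq:
  assumes x: "x \<in> carrier A" and y: "y \<in> carrier A"
  shows "prev n +> x = prev n +> y \<longleftrightarrow> x \<ominus> y \<in> prev n"
proof
  assume "prev n +> x = prev n +> y"
  moreover have "x \<in> prev n +> x" using prev_closed(1) x unfolding coset_mem by force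
  ultimately obtain h where h: "h \<in> prev n" "x = h \<oplus> y" using coset_mem by blast
  have "h \<in> carrier A" using h prev_Fil Fil_carrier by blast
  then have "x \<ominus> y = h" unfolding h(2) using y by algebra
  then show "x \<ominus> y \<in> prev n" using h by simp
next
  have sub: "prev n +> x \<subseteq> prev n +> y" if "x \<in> carrier A" "y \<in> carrier A" "x \<ominus> y \<in> prev n" for x y
  proof
    fix a assume "a \<in> prev n +> x"
    then obtain h where h: "h \<in> prev n" "a = h \<oplus> x" using coset_mem by blast
    have "h \<in> carrier A" using h prev_Fil Fil_carrier by blast
    then have "a = (h \<oplus> (x \<ominus> y)) \<oplus> y" unfolding h(2) using that(1,2) by algebra
    then show "a \<in> prev n +> y" using prev_closed(2)[OF h(1) that(3)] coset_mem by blast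
  qed
  assume d: "x \<ominus> y \<in> prev n"
  have "y \<ominus> x = \<ominus> (x \<ominus> y)" using x y by algebra
  then have "y \<ominus> x \<in> prev n" using prev_closed(3)[OF d] by simp
  then show "prev n +> x = prev n +> y" using sub[OF x y d] sub[OF y x] by blast
qed

lemma coset_zero: "x \<in> prev n \<Longrightarrow> prev n +> x = prev n"
proof -
  assume x: "x \<in> prev n"
  have xc: "x \<in> carrier A" using x prev_Fil Fil_carrier by blast
  have "prev n +> x = prev n +> \<zero>" using coset_eq[OF xc, of \<zero>] x xc by (simp add: a_minus_def)
  also have "\<dots> = prev n"
  proof -
    have "h \<oplus> \<zero> = h" if "h \<in> prev n" for h using prev_Fil[OF that] Fil_carrier by simp
    then show ?thesis using coset_mem by auto
  qed
  finally show ?thesis .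
qed

lemma gr_piece_carrier: "carrier (gr_piece A Fil n) = {prev n +> x | x. x \<in> Fil n}"
  unfolding gr_piece_def A_FactGroup_def' A_RCOSETS_def' by (auto simp: a_r_coset_def')

lemma gr_piece_one: "\<one>\<^bsub>gr_piece A Fil n\<^esub> = prev n"
  unfolding gr_piece_def A_FactGroup_def' by simp

lemma gr_piece_group: "comm_group (gr_piece A Fil n)"
proof -
  have "abelian_subgroup (prev n) (A\<lparr>carrier := Fil n\<rparr>)"
  proof (rule abelian_subgroupI2)
    have sg: "subgroup (Fil n) (add_monoid A)" by (rule Fil_subgroup)
    have eq: "add_monoid (A\<lparr>carrier := Fil n\<rparr>) = (add_monoid A)\<lparr>carrier := Fil n\<rparr>" by simp
    have "comm_group ((add_monoid A)\<lparr>carrier := Fil n\<rparr>)"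
    proof (rule group.group_comm_groupI[OF subgroup.subgroup_is_group[OF sg add.group_axioms]])
    qed (use Fil_carrier a_comm in auto)
    then show cg: "comm_group (add_monoid (A\<lparr>carrier := Fil n\<rparr>))" unfolding eq .
    have "subgroup (prev n) (add_monoid A)"
    proof (rule add.subgroupI)
      show "prev n \<noteq> {}" using prev_closed(1)[of n] by blast
    qed (use prev_Fil Fil_carrier prev_closed in \<open>auto simp: a_inv_def[symmetric]\<close>)
    then show "subgroup (prev n) (add_monoid (A\<lparr>carrier := Fil n\<rparr>))"
      unfolding eq using group.subgroup_incl[OF add.group_axioms _ sg] prev_Fil by blast
  qed
  then show ?thesis unfolding gr_piece_def by (rule abelian_subgroup.a_factorgroup_is_comm_group)
qed

text \<open>\<open>rcoset_mult\<close> is a union over all pairs of representatives; it collapses to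
  one coset once all products agree modulo the previous step.\<close>

lemma rcoset_mult_const:
  assumes "U \<noteq> {}" "V \<noteq> {}" "w \<in> carrier A"
    and "\<And>a b. a \<in> U \<Longrightarrow> b \<in> V \<Longrightarrow> a \<otimes> b \<in> carrier A \<and> a \<otimes> b \<ominus> w \<in> prev n"
  shows "rcoset_mult A (prev n) U V = prev n +> w"
proof -
  have "prev n +> (a \<otimes> b) = prev n +> w" if "a \<in> U" "b \<in> V" for a b
    using coset_eq assms(3) assms(4)[OF that] by blast
  then show ?thesis unfolding rcoset_mult_def using assms(1,2) by auto
qed

text \<open>The homogeneous element of degree \<open>i\<close> defined by the class of
  \<open>x\<close>. The degree is an argument because \<open>x\<close> may lie in a smaller step,
  where its class in degree \<open>i\<close> vanishes.\<close>

definition symbol :: "nat \<Rightarrow> 'b \<Rightarrow> nat \<Rightarrow> 'b set"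
  where "symbol i x = (\<lambda>m. if m = i then prev i +> x else prev m)"

lemma symbol_carrier: "x \<in> Fil i \<Longrightarrow> symbol i x \<in> carrier (gr_algebra A Fil)"
proof -
  assume x: "x \<in> Fil i"
  have "symbol i x m \<in> carrier (gr_piece A Fil m)" for m
  proof -
    have "prev m = prev m +> \<zero>" using coset_zero prev_closed(1) by simp
    then show ?thesis using x Fil_closed(1) unfolding gr_piece_carrier symbol_def by auto
  qed
  moreover have "finite {m. symbol i x m \<noteq> \<one>\<^bsub>gr_piece A Fil m\<^esub>}"
    by (rule finite_subset[of _ "{i}"]) (auto simp: symbol_def gr_piece_one)
  ultimately show ?thesis by (simp add: gr_algebra_def)
qed

text \<open>In the convolution every term except the one of index \<open>i\<close> in total degree
  \<open>i + j\<close> has a factor from the previous filtration step and vanishes.\<close>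

lemma symbol_mult:
  assumes x: "x \<in> Fil i" and y: "y \<in> Fil j"
  shows "symbol i x \<otimes>\<^bsub>gr_algebra A Fil\<^esub> symbol j y = symbol (i + j) (x \<otimes> y)"
proof
  fix n
  interpret P: comm_group "gr_piece A Fil n" by (rule gr_piece_group)
  define f where "f k = rcoset_mult A (prev n) (symbol i x k) (symbol j y (n - k))" for k
  have e: "(symbol i x \<otimes>\<^bsub>gr_algebra A Fil\<^esub> symbol j y) n = finprod (gr_piece A Fil n) f {..n}"
    unfolding gr_algebra_def f_def by simp
  have c: "x \<in> carrier A" "y \<in> carrier A" using x y Fil_carrier by auto
  have ne: "symbol i x k \<noteq> {}" "symbol j y k \<noteq> {}" for k
    using prev_closed(1)[of k] coset_mem unfolding symbol_def by auto
  have sub: "a \<in> symbol i x k \<Longrightarrow> a \<in> Fil k" "a \<in> symbol j y k \<Longrightarrow> a \<in> Fil k" for a k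
    using prev_Fil Fil_closed(2) x y unfolding symbol_def by (auto simp: coset_mem split: if_splits)
  have prevs: "a \<in> symbol i x k \<Longrightarrow> k \<noteq> i \<Longrightarrow> a \<in> prev k" "a \<in> symbol j y k \<Longrightarrow> k \<noteq> j \<Longrightarrow> a \<in> prev k" for a k
    unfolding symbol_def by auto
  have triv: "f k = \<one>\<^bsub>gr_piece A Fil n\<^esub>" if k: "k \<le> n" "\<not> (k = i \<and> n - k = j)" for k
  proof -
    have "f k = prev n +> \<zero>" unfolding f_def
    proof (rule rcoset_mult_const[OF ne zero_closed])
      fix a b assume ab: "a \<in> symbol i x k" "b \<in> symbol j y (n - k)"
      have F: "a \<in> Fil k" "b \<in> Fil (n - k)" using sub ab by auto
      have "a \<otimes> b \<in> prev (k + (n - k))"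
      proof (cases "k = i")
        case True
        then show ?thesis using prev_mult_right[OF F(1)] prevs(2)[OF ab(2)] k(2) by blast
      next
        case False
        then show ?thesis using prev_mult_left[OF _ F(2)] prevs(1)[OF ab(1)] by blast
      qed
      then show "a \<otimes> b \<in> carrier A \<and> a \<otimes> b \<ominus> \<zero> \<in> prev n"
        using k(1) F Fil_carrier by (simp add: a_minus_def)
    qed
    then show ?thesis using coset_zero prev_closed(1) gr_piece_one by simp
  qed
  have main: "f i = prev n +> (x \<otimes> y)" if n: "n = i + j"
    unfolding f_def
  proof (rule rcoset_mult_const[OF ne])
    show "x \<otimes> y \<in> carrier A" using c by simp
    fix a b assume ab: "a \<in> symbol i x i" "b \<in> symbol j y (n - i)"
    then obtain h l where h: "h \<in> prev i" "a = h \<oplus> x" and l: "l \<in> prev j" "b = l \<oplus> y"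
      using n unfolding symbol_def by (auto simp: coset_mem)
    have hl: "h \<in> carrier A" "l \<in> carrier A" using h l prev_Fil Fil_carrier by auto
    have F: "a \<in> Fil i" "b \<in> Fil j" using sub ab n by auto
    have "a \<otimes> b \<ominus> x \<otimes> y = h \<otimes> b \<oplus> x \<otimes> l" unfolding h(2) l(2) using c hl by algebra
    moreover have "h \<otimes> b \<oplus> x \<otimes> l \<in> prev n"
      unfolding n by (intro prev_closed(2) prev_mult_left prev_mult_right h l x F)
    ultimately show "a \<otimes> b \<in> carrier A \<and> a \<otimes> b \<ominus> x \<otimes> y \<in> prev n" using F Fil_carrier by simp
  qed
  show "(symbol i x \<otimes>\<^bsub>gr_algebra A Fil\<^esub> symbol j y) n = symbol (i + j) (x \<otimes> y) n"
  proof (cases "n = i + j")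
    case True
    have fc: "f i \<in> carrier (gr_piece A Fil n)"
      unfolding main[OF True] gr_piece_carrier using Fil_mult[OF x y] True by blast
    have "finprod (gr_piece A Fil n) f {..n} =
        finprod (gr_piece A Fil n) (\<lambda>k. if i = k then f i else \<one>\<^bsub>gr_piece A Fil n\<^esub>) {..n}"
    proof (rule P.finprod_cong')
      show "(\<lambda>k. if i = k then f i else \<one>\<^bsub>gr_piece A Fil n\<^esub>) \<in> {..n} \<rightarrow> carrier (gr_piece A Fil n)"
        using fc P.one_closed by auto
    qed (use triv True in auto)
    also have "\<dots> = f i" using P.finprod_singleton[of i "{..n}" "\<lambda>k. f i"] fc True by simp
    finally show ?thesis unfolding e main[OF True] using True by (simp add: symbol_def[of "i + j"])
  next
    case False
    have "finprod (gr_piece A Fil n) f {..n} = finprod (gr_piece A Fil n) (\<lambda>k. \<one>\<^bsub>gr_piece A Fil n\<^esub>) {..n}"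
    proof (rule P.finprod_cong')
      show "f k = \<one>\<^bsub>gr_piece A Fil n\<^esub>" if "k \<in> {..n}" for k
        by (rule triv) (use that False in auto)
    qed auto
    also have "\<dots> = \<one>\<^bsub>gr_piece A Fil n\<^esub>" by simp
    finally show ?thesis unfolding e gr_piece_one using False by (simp add: symbol_def[of "i + j"])
  qed
qed

lemma symbol_eq_iff: 
  assumes "x \<in> carrier A" "y \<in> carrier A"
  shows "symbol i x = symbol i y \<longleftrightarrow> x \<ominus> y \<in> prev i"
  using coset_eq[OF assms, of i] unfolding symbol_def by metis

lemma symbol_zero_iff: "x \<in> carrier A \<Longrightarrow> symbol i x = prev \<longleftrightarrow> x \<in> prev i"
proof -
  assume "x \<in> carrier A"
  moreover have "symbol i \<zero> = prev" unfolding symbol_def using coset_zero[OF prev_closed(1), of i]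
    by (intro ext) auto
  ultimately show ?thesis using symbol_eq_iff[of x \<zero> i] by (simp add: a_minus_def)
qed

end

section \<open>The degree function when the graded ring is a commutative domain\<close>

locale filtered_ring_gr_domain = filtered_ring A Fil
  for A :: "('f, 'b) module" (structure) and Fil +
  fixes A0 :: "('f, 'a) module" and h :: "(nat \<Rightarrow> 'b set) \<Rightarrow> 'a"
  assumes A0: "domain A0" and h: "h \<in> ring_iso (gr_algebra A Fil) A0"
begin

lemma h_hom: "u \<in> carrier (gr_algebra A Fil) \<Longrightarrow> v \<in> carrier (gr_algebra A Fil) \<Longrightarrow>
    h (u \<otimes>\<^bsub>gr_algebra A Fil\<^esub> v) = h u \<otimes>\<^bsub>A0\<^esub> h v"
  and h_carrier: "u \<in> carrier (gr_algebra A Fil) \<Longrightarrow> h u \<in> carrier A0"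
  and h_inj: "inj_on h (carrier (gr_algebra A Fil))"
  using h unfolding ring_iso_def ring_hom_def bij_betw_def by auto

lemma prev_in_gr: "prev \<in> carrier (gr_algebra A Fil)"
  using symbol_carrier[OF Fil_closed(1), of 0] symbol_zero_iff[of \<zero> 0] prev_closed(1) by simp

text \<open>\<open>prev\<close> is the zero of \<open>gr_algebra\<close>. Its image equals its own
  double in \<open>A0\<close>, which settles the claim without the ring axioms for
  \<open>gr_algebra\<close>.\<close>

lemma h_prev: "h prev = \<zero>\<^bsub>A0\<^esub>"
proof -
  interpret A0: domain A0 by (rule A0)
  have "prev \<oplus>\<^bsub>gr_algebra A Fil\<^esub> prev = prev"
  proof
    fix n
    interpret P: comm_group "gr_piece A Fil n" by (rule gr_piece_group)
    have "(prev \<oplus>\<^bsub>gr_algebra A Fil\<^esub> prev) n = prev n \<otimes>\<^bsub>gr_piece A Fil n\<^esub> prev n"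
      unfolding gr_algebra_def by simp
    also have "\<dots> = prev n" using P.l_one[OF P.one_closed] unfolding gr_piece_one .
    finally show "(prev \<oplus>\<^bsub>gr_algebra A Fil\<^esub> prev) n = prev n" .
  qed
  moreover have "h (prev \<oplus>\<^bsub>gr_algebra A Fil\<^esub> prev) = h prev \<oplus>\<^bsub>A0\<^esub> h prev"
    using h prev_in_gr unfolding ring_iso_def ring_hom_def by auto
  ultimately have "h prev = h prev \<oplus>\<^bsub>A0\<^esub> h prev" by simp
  then show ?thesis using h_carrier[OF prev_in_gr] A0.add.r_cancel_one' by metis
qed

text \<open>The products in both orders have the same symbol in degree \<open>i + j\<close>, because
  \<open>h\<close> carries them to equal products in \<open>A0\<close>.\<close>

lemma gr_commute:
  assumes x: "x \<in> Fil i" and y: "y \<in> Fil j"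
  shows "x \<otimes> y \<ominus> y \<otimes> x \<in> prev (i + j)"
proof -
  interpret A0: domain A0 by (rule A0)
  have c: "x \<in> carrier A" "y \<in> carrier A" using x y Fil_carrier by auto
  have yx: "y \<otimes> x \<in> Fil (i + j)" using Fil_mult[OF y x] by (simp add: add.commute)
  have "h (symbol (i + j) (x \<otimes> y)) = h (symbol i x) \<otimes>\<^bsub>A0\<^esub> h (symbol j y)"
    using h_hom symbol_carrier x y unfolding symbol_mult[OF x y, symmetric] by simp
  also have "\<dots> = h (symbol j y) \<otimes>\<^bsub>A0\<^esub> h (symbol i x)"
    using h_carrier symbol_carrier x y A0.m_comm by simp
  also have "\<dots> = h (symbol (j + i) (y \<otimes> x))"
    using h_hom symbol_carrier x y unfolding symbol_mult[OF y x, symmetric] by simp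
  finally have "h (symbol (i + j) (x \<otimes> y)) = h (symbol (i + j) (y \<otimes> x))" by (simp add: add.commute)
  then have "symbol (i + j) (x \<otimes> y) = symbol (i + j) (y \<otimes> x)"
    using inj_onD[OF h_inj] symbol_carrier Fil_mult[OF x y] yx by blast
  then show ?thesis using symbol_eq_iff c by simp
qed

lemma gr_integral:
  assumes x: "x \<in> Fil i" "x \<notin> prev i" and y: "y \<in> Fil j" "y \<notin> prev j"
  shows "x \<otimes> y \<notin> prev (i + j)"
proof
  interpret A0: domain A0 by (rule A0)
  assume p: "x \<otimes> y \<in> prev (i + j)"
  have c: "x \<in> carrier A" "y \<in> carrier A" using x y Fil_carrier by auto
  have "h (symbol i x) \<otimes>\<^bsub>A0\<^esub> h (symbol j y) = h (symbol (i + j) (x \<otimes> y))"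
    using h_hom symbol_carrier x(1) y(1) unfolding symbol_mult[OF x(1) y(1), symmetric] by simp
  also have "symbol (i + j) (x \<otimes> y) = prev" using symbol_zero_iff p c by simp
  finally have "h (symbol i x) = \<zero>\<^bsub>A0\<^esub> \<or> h (symbol j y) = \<zero>\<^bsub>A0\<^esub>"
    using A0.integral h_carrier symbol_carrier x(1) y(1) h_prev by metis
  then have "symbol i x = prev \<or> symbol j y = prev"
    using inj_onD[OF h_inj] symbol_carrier x(1) y(1) prev_in_gr h_prev by metis
  then show False using symbol_zero_iff c x(2) y(2) by blast
qed

definition fdeg :: "'b \<Rightarrow> nat" where "fdeg x = (LEAST n. x \<in> Fil n)"

lemma fdeg_le_iff: "x \<in> carrier A \<Longrightarrow> fdeg x \<le> n \<longleftrightarrow> x \<in> Fil n"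
proof -
  assume "x \<in> carrier A"
  then obtain m where "x \<in> Fil m" using Fil_exhaustive by blast
  then have "x \<in> Fil (fdeg x)" unfolding fdeg_def by (rule LeastI)
  then show ?thesis using Fil_mono Least_le[of "\<lambda>n. x \<in> Fil n" n] unfolding fdeg_def by blast
qed

text \<open>Zero is excluded because it lies in \<open>prev 0\<close> although its degree is not
  below 0.\<close>

lemma prev_iff:
  assumes "x \<in> carrier A" "x \<noteq> \<zero>"
  shows "x \<in> prev n \<longleftrightarrow> fdeg x < n"
  using assms fdeg_le_iff[OF assms(1)] by (cases n) (auto simp: prev_0 prev_Suc less_Suc_eq_le)

lemma fdeg_mult:
  assumes x: "x \<in> carrier A" "x \<noteq> \<zero>" and y: "y \<in> carrier A" "y \<noteq> \<zero>"
  shows "fdeg (x \<otimes> y) = fdeg x + fdeg y"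
proof -
  have xF: "x \<in> Fil (fdeg x)" "x \<notin> prev (fdeg x)" and yF: "y \<in> Fil (fdeg y)" "y \<notin> prev (fdeg y)"
    using fdeg_le_iff prev_iff x y by auto
  have n: "x \<otimes> y \<notin> prev (fdeg x + fdeg y)" by (rule gr_integral[OF xF yF])
  then have "x \<otimes> y \<noteq> \<zero>" using prev_closed(1) by metis
  then have "\<not> fdeg (x \<otimes> y) < fdeg x + fdeg y" using n prev_iff x y by simp
  moreover have "fdeg (x \<otimes> y) \<le> fdeg x + fdeg y" using fdeg_le_iff Fil_mult[OF xF(1) yF(1)] x y by simp
  ultimately show ?thesis by simp
qed

lemma fdeg_add:
  assumes x: "x \<in> carrier A" and y: "y \<in> carrier A"
  shows "fdeg (x \<oplus> y) \<le> max (fdeg x) (fdeg y)"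
proof -
  have "x \<in> Fil (max (fdeg x) (fdeg y))" "y \<in> Fil (max (fdeg x) (fdeg y))"
    using fdeg_le_iff x y max.cobounded1 max.cobounded2 by blast+
  then show ?thesis using Fil_closed(2) fdeg_le_iff x y by simp
qed

lemma fdeg_commutator:
  assumes x: "x \<in> carrier A" and y: "y \<in> carrier A" and n: "x \<otimes> y \<ominus> y \<otimes> x \<noteq> \<zero>"
  shows "fdeg (x \<otimes> y \<ominus> y \<otimes> x) < fdeg x + fdeg y"
proof -
  have "x \<in> Fil (fdeg x)" "y \<in> Fil (fdeg y)" using fdeg_le_iff x y by auto
  then have "x \<otimes> y \<ominus> y \<otimes> x \<in> prev (fdeg x + fdeg y)" by (rule gr_commute)
  then show ?thesis using prev_iff[OF _ n] x y by simp
qed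

end

section \<open>The PI degree\<close>

lemma (in ring) nat_mult_one_eq_zero_iff: "[(n :: nat)] \<cdot> \<one> = \<zero> \<longleftrightarrow> ring_char R dvd n"
  using group.pow_eq_id[OF a_group, of \<one> n] by (simp add: ring_char_def add_pow_def)

lemma (in domain) prime_ring_char:
  assumes "ring_char R > 0"
  shows "Factorial_Ring.prime (ring_char R)"
proof -
  have "prime_elem (ring_char R)"
  proof (rule prime_elemI)
    show "ring_char R \<noteq> 0" using assms by simp
    show "\<not> ring_char R dvd 1" using nat_mult_one_eq_zero_iff[of 1] one_not_zero by simp
    fix a b assume "ring_char R dvd a * b"
    then have "[(a * b)] \<cdot> \<one> = \<zero>" using nat_mult_one_eq_zero_iff by blast
    moreover have "[(a * b)] \<cdot> \<one> = [a] \<cdot> \<one> \<otimes> [b] \<cdot> \<one>"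
      using add.nat_pow_pow[of \<one> a b] add_pow_ldistr[of \<one> "[b] \<cdot> \<one>" a] by (simp add: mult.commute)
    ultimately show "ring_char R dvd a \<or> ring_char R dvd b"
      using integral nat_mult_one_eq_zero_iff by (metis add.nat_pow_closed one_closed)
  qed
  then show ?thesis by simp
qed

lemma ring_hom_nat_mult_one:
  assumes "ring A" "ring D" "\<iota> \<in> ring_hom A D"
  shows "\<iota> ([(n :: nat)] \<cdot>\<^bsub>A\<^esub> \<one>\<^bsub>A\<^esub>) = [n] \<cdot>\<^bsub>D\<^esub> \<one>\<^bsub>D\<^esub>"
proof -
  interpret h: ring_hom_ring A D \<iota> using assms by (intro ring_hom_ringI2)
  show ?thesis by (induction n) (auto simp: h.hom_zero h.hom_one h.hom_add)
qed

lemma (in module) smult_nat_mult_one: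
  assumes x: "x \<in> carrier M"
  shows "([(n :: nat)] \<cdot>\<^bsub>R\<^esub> \<one>\<^bsub>R\<^esub>) \<odot>\<^bsub>M\<^esub> x = [n] \<cdot>\<^bsub>M\<^esub> x"
proof (induction n)
  case 0 then show ?case using x by (simp add: smult_l_null)
next
  case (Suc n)
  then show ?case using x by (simp add: smult_l_distr)
qed

theorem corollary3p2:
  fixes F :: "'f ring" and A0 :: "('f, 'a) module" and A :: "('f, 'b) module"
    and Fil :: "nat \<Rightarrow> 'b set" and d :: nat
  assumes "algebraically_closed F"
    and "algebra F A0" and "domain A0"
    and "filtered_deformation F A0 A Fil"
    and "PI_degree F A d"
  shows "(ring_char F = 0 \<longrightarrow>
            d = 1 \<and> (\<forall>x \<in> carrier A. \<forall>y \<in> carrier A. x \<otimes>\<^bsub>A\<^esub> y = y \<otimes>\<^bsub>A\<^esub> x)) \<and>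
         (\<forall>p. ring_char F = p \<and> p > 0 \<longrightarrow> (\<exists>k. d = p ^ k))"
proof -
  interpret F: field F using assms(1) by (rule algebraically_closed.axioms(1))
  have fa: "filtered_algebra F A Fil" using assms(4) by (simp add: filtered_deformation_def)
  obtain h where h: "h \<in> ring_iso (gr_algebra A Fil) A0"
    using assms(4) unfolding filtered_deformation_def algebra_iso_def by blast
  have aa: "assoc_algebra F A" using fa by (rule filtered_algebra.axioms(1))
  interpret M: module F A using aa by (rule assoc_algebra.axioms(1))
  interpret A: ring A using aa by (rule assoc_algebra.axioms(2))
  have "filtered_ring A Fil"
  proof (rule filtered_ring.intro[OF A.ring_axioms filtered_ring_axioms.intro])
    show "subgroup (Fil i) (add_monoid A)" for i
      using filtered_algebra.Fil_submodule[OF fa, of i] by (rule submodule.axioms(1))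
  qed (use filtered_algebra.Fil_Suc[OF fa] filtered_algebra.Fil_one[OF fa]
      filtered_algebra.Fil_mult[OF fa] filtered_algebra.Fil_exhaustive[OF fa] in auto)
  then interpret G: filtered_ring_gr_domain A Fil A0 h
    by (intro filtered_ring_gr_domain.intro filtered_ring_gr_domain_axioms.intro assms(3) h)
  obtain D :: "('b \<times> 'b) set ring" and \<iota> where q: "quotient_division_ring A D \<iota>"
    and dim: "ring.dimension D (d\<^sup>2) (ring_center D) (carrier D)"
    using assms(5) unfolding PI_degree_def by blast
  have D: "ring D" "\<one>\<^bsub>D\<^esub> \<noteq> \<zero>\<^bsub>D\<^esub>" "Units D = carrier D - {\<zero>\<^bsub>D\<^esub>}"
    and \<iota>: "\<iota> \<in> ring_hom A D" "inj_on \<iota> (carrier A)"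
    and frac: "\<And>x. x \<in> carrier D \<Longrightarrow> \<exists>a \<in> carrier A. \<exists>s \<in> carrier A - {\<zero>\<^bsub>A\<^esub>}. x = \<iota> a \<otimes>\<^bsub>D\<^esub> inv\<^bsub>D\<^esub> (\<iota> s)"
    using q unfolding quotient_division_ring_def division_ring_rec_def by blast+
  interpret D: ring D by (rule D(1))
  interpret i: ring_hom_ring A D \<iota> using A.ring_axioms D(1) \<iota>(1) by (intro ring_hom_ringI2)
  have \<iota>0: "\<iota> a = \<zero>\<^bsub>D\<^esub> \<longleftrightarrow> a = \<zero>\<^bsub>A\<^esub>" if "a \<in> carrier A" for a
    using inj_onD[OF \<iota>(2), of a "\<zero>\<^bsub>A\<^esub>"] i.hom_zero that by auto
  define S where "S = \<iota> ` carrier A"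
  \<comment> \<open>The natural-number degree on \<open>A\<close> is read as an integer so that
    fractions can have negative degree.\<close>
  define g where "g = (\<lambda>x. int (G.fdeg (inv_into (carrier A) \<iota> x)))"
  have g: "g (\<iota> a) = int (G.fdeg a)" if "a \<in> carrier A" for a using \<iota>(2) that by (simp add: g_def)
  have S: "\<exists>a. a \<in> carrier A \<and> a \<noteq> \<zero>\<^bsub>A\<^esub> \<and> x = \<iota> a" if "x \<in> S - {\<zero>\<^bsub>D\<^esub>}" for x
    using that \<iota>0 unfolding S_def by blast
  have "fraction_degree D S g"
  proof (rule fraction_degree.intro[OF skew_field.intro[OF D(1) skew_field_axioms.intro[OF D(2,3)]]
        fraction_degree_axioms.intro])
    show "subring S D" unfolding S_def by (rule i.img_is_subring[OF A.carrier_is_subring])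
    show "\<exists>a \<in> S. \<exists>s \<in> S - {\<zero>\<^bsub>D\<^esub>}. x = a \<otimes>\<^bsub>D\<^esub> inv\<^bsub>D\<^esub> s" if x: "x \<in> carrier D" for x
    proof -
      obtain a s where as: "a \<in> carrier A" "s \<in> carrier A - {\<zero>\<^bsub>A\<^esub>}" "x = \<iota> a \<otimes>\<^bsub>D\<^esub> inv\<^bsub>D\<^esub> (\<iota> s)"
        using frac[OF x] by blast
      then have "\<iota> a \<in> S" "\<iota> s \<in> S - {\<zero>\<^bsub>D\<^esub>}" using \<iota>0 by (auto simp: S_def)
      then show ?thesis using as(3) by blast
    qed
    fix x y assume "x \<in> S - {\<zero>\<^bsub>D\<^esub>}" "y \<in> S - {\<zero>\<^bsub>D\<^esub>}"
    then obtain a b where a: "a \<in> carrier A" "a \<noteq> \<zero>\<^bsub>A\<^esub>" "x = \<iota> a" and b: "b \<in> carrier A" "b \<noteq> \<zero>\<^bsub>A\<^esub>" "y = \<iota> b"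
      using S by metis
    have m: "x \<otimes>\<^bsub>D\<^esub> y = \<iota> (a \<otimes>\<^bsub>A\<^esub> b)" "x \<oplus>\<^bsub>D\<^esub> y = \<iota> (a \<oplus>\<^bsub>A\<^esub> b)"
      "x \<otimes>\<^bsub>D\<^esub> y \<ominus>\<^bsub>D\<^esub> y \<otimes>\<^bsub>D\<^esub> x = \<iota> (a \<otimes>\<^bsub>A\<^esub> b \<ominus>\<^bsub>A\<^esub> b \<otimes>\<^bsub>A\<^esub> a)"
      using a b by (simp_all add: a_minus_def)
    show "g (x \<otimes>\<^bsub>D\<^esub> y) = g x + g y" 
      unfolding m(1) unfolding a(3) b(3) using a(1,2) b(1,2) G.fdeg_mult[of a b] by (simp add: g del: i.hom_mult)
    show "g (x \<oplus>\<^bsub>D\<^esub> y) \<le> max (g x) (g y)" 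
      unfolding m(2) unfolding a(3) b(3) using a(1) b(1) G.fdeg_add[OF a(1) b(1)] by (simp add: g del: i.hom_add)
    show "g (x \<otimes>\<^bsub>D\<^esub> y \<ominus>\<^bsub>D\<^esub> y \<otimes>\<^bsub>D\<^esub> x) < g x + g y" if "x \<otimes>\<^bsub>D\<^esub> y \<ominus>\<^bsub>D\<^esub> y \<otimes>\<^bsub>D\<^esub> x \<noteq> \<zero>\<^bsub>D\<^esub>"
    proof -
      have c: "a \<otimes>\<^bsub>A\<^esub> b \<ominus>\<^bsub>A\<^esub> b \<otimes>\<^bsub>A\<^esub> a \<in> carrier A" using a b by simp
      have "a \<otimes>\<^bsub>A\<^esub> b \<ominus>\<^bsub>A\<^esub> b \<otimes>\<^bsub>A\<^esub> a \<noteq> \<zero>\<^bsub>A\<^esub>" using that \<iota>0[OF c] unfolding m(3) by blast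
      then have "G.fdeg (a \<otimes>\<^bsub>A\<^esub> b \<ominus>\<^bsub>A\<^esub> b \<otimes>\<^bsub>A\<^esub> a) < G.fdeg a + G.fdeg b" by (rule G.fdeg_commutator[OF a(1) b(1)])
      then show ?thesis unfolding m(3) g[OF c] unfolding a(3) b(3) g[OF a(1)] g[OF b(1)] by simp
    qed
  qed
  then interpret V: fraction_degree D S g .
  \<comment> \<open>Multiples of \<open>\<one>\<close> in \<open>D\<close> are images of scalars
    from \<open>F\<close>, which is how the characteristic of \<open>F\<close> reaches
    \<open>D\<close>.\<close>
  have nmult: "\<And>n :: nat. [n] \<cdot>\<^bsub>D\<^esub> \<one>\<^bsub>D\<^esub> = \<iota> (([n] \<cdot>\<^bsub>F\<^esub> \<one>\<^bsub>F\<^esub>) \<odot>\<^bsub>A\<^esub> \<one>\<^bsub>A\<^esub>)"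
    using ring_hom_nat_mult_one[OF A.ring_axioms D(1) \<iota>(1)] M.smult_nat_mult_one[of "\<one>\<^bsub>A\<^esub>"] by simp
  show ?thesis
  proof (intro conjI allI impI)
    assume char0: "ring_char F = 0"
    have d0: "d\<^sup>2 \<noteq> 0"
    proof
      assume "d\<^sup>2 = 0"
      then have "carrier D = {\<zero>\<^bsub>D\<^esub>}" using D.dimension_zero[OF V.center_subfield] dim by simp
      then show False using D.one_closed D(2) by blast
    qed
    \<comment> \<open>The scalar \<open>d^2\<close> is invertible in \<open>F\<close>, so its image
      in \<open>A\<close> is nonzero. Degrees on \<open>A\<close> are natural numbers, hence this
      image is outside \<open>ball (-1)\<close>, as the trace argument demands.\<close>
    define c where "c = [d\<^sup>2] \<cdot>\<^bsub>F\<^esub> \<one>\<^bsub>F\<^esub>"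
    have c: "c \<in> carrier F" "c \<noteq> \<zero>\<^bsub>F\<^esub>"
      using F.nat_mult_one_eq_zero_iff[of "d\<^sup>2"] char0 d0 by (auto simp: c_def)
    define a where "a = c \<odot>\<^bsub>A\<^esub> \<one>\<^bsub>A\<^esub>"
    have a: "a \<in> carrier A" using c by (simp add: a_def)
    have "a \<noteq> \<zero>\<^bsub>A\<^esub>"
    proof
      assume "a = \<zero>\<^bsub>A\<^esub>"
      moreover have "inv\<^bsub>F\<^esub> c \<odot>\<^bsub>A\<^esub> a = \<one>\<^bsub>A\<^esub>" "inv\<^bsub>F\<^esub> c \<in> carrier F"
        unfolding a_def using c F.field_Units M.smult_assoc1[of "inv\<^bsub>F\<^esub> c" c "\<one>\<^bsub>A\<^esub>"] by auto
      ultimately have "\<one>\<^bsub>A\<^esub> = \<zero>\<^bsub>A\<^esub>" using M.smult_r_null by simp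
      then show False using i.hom_one i.hom_zero D(2) by simp
    qed
    then have nz: "\<iota> a \<noteq> \<zero>\<^bsub>D\<^esub>" "\<iota> a \<in> S - {\<zero>\<^bsub>D\<^esub>}" using \<iota>0 a by (auto simp: S_def)
    have "V.frac_deg (\<iota> a) \<ge> 0" using V.frac_deg_extends[OF nz(2)] g[OF a] by simp
    then have n: "[d\<^sup>2] \<cdot>\<^bsub>D\<^esub> \<one>\<^bsub>D\<^esub> \<notin> V.ball (-1)"
      unfolding nmult c_def[symmetric] a_def[symmetric] using nz(1) by (simp add: V.ball_def)
    have comm: "x \<otimes>\<^bsub>D\<^esub> y = y \<otimes>\<^bsub>D\<^esub> x" if "x \<in> carrier D" "y \<in> carrier D" for x y
      by (rule V.commutative_of_dimension_unit[OF dim n that])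
    then have "ring_center D = carrier D" by (auto simp: ring_center_def)
    then have "d\<^sup>2 = 1"
      using D.dimension_is_inj[OF V.center_subfield dim] D.dimension_one[OF V.center_subfield] by simp
    then show "d = 1" by simp
    show "\<forall>x \<in> carrier A. \<forall>y \<in> carrier A. x \<otimes>\<^bsub>A\<^esub> y = y \<otimes>\<^bsub>A\<^esub> x"
    proof (intro ballI)
      fix x y assume xy: "x \<in> carrier A" "y \<in> carrier A"
      then have "\<iota> (x \<otimes>\<^bsub>A\<^esub> y) = \<iota> (y \<otimes>\<^bsub>A\<^esub> x)" using comm by simp
      then show "x \<otimes>\<^bsub>A\<^esub> y = y \<otimes>\<^bsub>A\<^esub> x" using inj_onD[OF \<iota>(2)] xy by simp
    qed
  next
    fix p assume p: "ring_char F = p \<and> p > 0"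
    then have prime: "Factorial_Ring.prime p" using F.prime_ring_char by blast
    have "[p] \<cdot>\<^bsub>F\<^esub> \<one>\<^bsub>F\<^esub> = \<zero>\<^bsub>F\<^esub>" using F.nat_mult_one_eq_zero_iff[of p] p by simp
    then have "[p] \<cdot>\<^bsub>D\<^esub> \<one>\<^bsub>D\<^esub> = \<zero>\<^bsub>D\<^esub>" unfolding nmult using M.smult_l_null by simp
    then obtain k where "d\<^sup>2 = p ^ k" using V.dimension_prime_power[OF dim prime] by blast
    then have "d dvd p ^ k" by (metis dvd_triv_left power2_eq_square)
    then show "\<exists>k. d = p ^ k" using divides_primepow_nat[OF prime] by blast
  qed
qed

end
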